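(* Let $G$ be a locally graded $MNCL$-group. Then $G$ is locally finite and countable. Furthermore, $G=G^*=G'$. In particular, $G$ is perfect.
   Context: A Chernikov group is a group that is a finite extension of a direct product of finitely many quasicyclic (Prüfer) groups (finite groups included). For $m$ a positive integer or $\infty$, the $m$-layer $G_m$ of a group $G$ is the subgroup generated by all elements of $G$ of order $m$. A group $G$ is a $CL$-group if $G_m$ is a Chernikov group for every $m$ (positive integer or $\infty$). An $MNCL$-group (minimal non-$CL$-group) is a group that is not a $CL$-group but all of whose proper subgroups are $CL$-groups. A group is locally graded if every nontrivial finitely generated subgroup of it has a proper subgroup of finite index. $G'$ is the derived subgroup of $G$, and $G^*$ is the finite residual of $G$, i.e. the intersection of all normal subgroups of $G$ of finite index. *)

theory Defs
  imports
    "HOL-Algebra.Algebra"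
    "HOL-Library.Countable_Set"
    "HOL-Library.Extended_Nat"
    Complex_Main
begin

text \<open>The quasicyclic p-group, realised as the complex roots of unity of p-power order.\<close>

definition prufer_group :: "nat \<Rightarrow> complex monoid" where
  "prufer_group p = \<lparr>carrier = {z. \<exists>n. z ^ (p ^ n) = 1}, monoid.mult = (*), one = 1\<rparr>"

lemma group_prufer_group:
  assumes "p > 0"
  shows "group (prufer_group p)"
proof (rule groupI)
  fix x y
  assume "x \<in> carrier (prufer_group p)" "y \<in> carrier (prufer_group p)"
  then obtain m n where "x ^ (p ^ m) = 1" "y ^ (p ^ n) = 1"
    by (auto simp: prufer_group_def)
  then have "x ^ (p ^ (m + n)) = 1" "y ^ (p ^ (m + n)) = 1"
    by (simp_all add: power_add power_mult, metis mult.commute power_mult power_one)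
  then have "(x * y) ^ (p ^ (m + n)) = 1"
    by (simp add: power_mult_distrib)
  then show "x \<otimes>\<^bsub>prufer_group p\<^esub> y \<in> carrier (prufer_group p)"
    by (auto simp: prufer_group_def)
next
  fix x
  assume "x \<in> carrier (prufer_group p)"
  then obtain n where n: "x ^ (p ^ n) = 1"
    by (auto simp: prufer_group_def)
  with assms have "x \<noteq> 0"
    by (auto simp: zero_power)
  moreover from n have "inverse x ^ (p ^ n) = 1"
    by (simp add: power_inverse)
  ultimately show "\<exists>y\<in>carrier (prufer_group p).
      y \<otimes>\<^bsub>prufer_group p\<^esub> x = \<one>\<^bsub>prufer_group p\<^esub>"
    by (intro bexI[of _ "inverse x"]) (auto simp: prufer_group_def)
qed (auto simp: prufer_group_def)

text \<open>The primes need not be distinct; the empty product (k = 0) makes every finite group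
  a Chernikov group.\<close>

definition chernikov_group :: "('a, 'b) monoid_scheme \<Rightarrow> bool" where
  "chernikov_group G \<longleftrightarrow> group G \<and>
     (\<exists>N (k::nat) (p :: nat \<Rightarrow> nat).
        N \<lhd> G \<and> finite (carrier (G Mod N)) \<and>
        (\<forall>i<k. Factorial_Ring.prime (p i)) \<and>
        G\<lparr>carrier := N\<rparr> \<cong> product_group {..<k} (\<lambda>i. prufer_group (p i)))"

text \<open>The library function \<open>group.ord\<close> returns 0 on elements of infinite order.\<close>

definition elem_order :: "('a, 'b) monoid_scheme \<Rightarrow> 'a \<Rightarrow> enat" where
  "elem_order G x = (if group.ord G x = 0 then \<infinity> else enat (group.ord G x))"

definition layer :: "('a, 'b) monoid_scheme \<Rightarrow> enat \<Rightarrow> 'a set" where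
  "layer G m = generate G {x \<in> carrier G. elem_order G x = m}"

definition CL_group :: "('a, 'b) monoid_scheme \<Rightarrow> bool" where
  "CL_group G \<longleftrightarrow> group G \<and> (\<forall>m. m \<noteq> 0 \<longrightarrow> chernikov_group (G\<lparr>carrier := layer G m\<rparr>))"

definition MNCL_group :: "('a, 'b) monoid_scheme \<Rightarrow> bool" where
  "MNCL_group G \<longleftrightarrow> group G \<and> \<not> CL_group G \<and>
     (\<forall>H. subgroup H G \<and> H \<noteq> carrier G \<longrightarrow> CL_group (G\<lparr>carrier := H\<rparr>))"

definition locally_graded :: "('a, 'b) monoid_scheme \<Rightarrow> bool" where
  "locally_graded G \<longleftrightarrow> group G \<and>
     (\<forall>S. S \<subseteq> carrier G \<and> finite S \<and> generate G S \<noteq> {\<one>\<^bsub>G\<^esub>} \<longrightarrow>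
        (\<exists>K. subgroup K (G\<lparr>carrier := generate G S\<rparr>) \<and> K \<noteq> generate G S \<and>
             finite (rcosets\<^bsub>G\<lparr>carrier := generate G S\<rparr>\<^esub> K)))"

definition locally_finite :: "('a, 'b) monoid_scheme \<Rightarrow> bool" where
  "locally_finite G \<longleftrightarrow> group G \<and>
     (\<forall>S. S \<subseteq> carrier G \<and> finite S \<longrightarrow> finite (generate G S))"

definition finite_residual :: "('a, 'b) monoid_scheme \<Rightarrow> 'a set" where
  "finite_residual G = \<Inter> {N. N \<lhd> G \<and> finite (carrier (G Mod N))}"

definition perfect_group :: "('a, 'b) monoid_scheme \<Rightarrow> bool" where
  "perfect_group G \<longleftrightarrow> group G \<and> derived G (carrier G) = carrier G"

end

theory Submission
  imports Defs
begin

text \<open>A CL-group is periodic (its \<open>\<infinity>\<close>-layer is Chernikov, hence periodic), and each of its elements lies in a normal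
Chernikov subgroup, namely a layer; so it is locally finite. If a locally graded group all of whose proper subgroups
are CL-groups were finitely generated, it would have a proper subgroup of finite index, which is locally
finite, and by Schreier's lemma the whole group would be locally finite. Otherwise finitely generated subgroups are
proper and hence finite. So \<open>G\<close> is locally finite. As it is not a CL-group, some layer \<open>G\<^sub>m\<close> with \<open>m\<close> finite is not Chernikov;
a proper subgroup generated by elements of order \<open>m\<close> is its own \<open>m\<close>-layer and therefore Chernikov. Hence
\<open>G\<close> is generated by its elements of order \<open>m\<close>, and a set of such elements generates
either a Chernikov subgroup or all of \<open>G\<close> (locale \<open>loc_fin_MNCL\<close>).

Next, \<open>G\<close> has no proper subgroup of finite index. For a normal subgroup \<open>N\<close> of finite index,
some coset \<open>Nt\<close> has the property that its elements of order \<open>m\<close> generate \<open>G\<close>: otherwise each coset contributes a Chernikov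
subgroup, the divisible parts of these finitely many subgroups commute with one another, and their product has finite index and
makes \<open>G\<close> Chernikov (\<open>coset_generates\<close>). So \<open>G/N\<close> is cyclic of order at most \<open>m\<close>, and there is a least subgroup \<open>N\<close> of
finite index. If \<open>N \<noteq> G\<close>, then \<open>N\<close> is a CL-group without proper subgroups of finite index. An element with finitely many
conjugates under \<open>N\<close> is then centralised by \<open>N\<close>; applied to the divisible part of a layer of \<open>N\<close> and then to the layer
itself this shows that \<open>N\<close> is abelian, and hence divisible with finite \<open>k\<close>-torsion for every \<open>k\<close>. Write \<open>G = N\<langle>f\<rangle>\<close> with \<open>f\<close> of order \<open>m\<close>. The
map \<open>x \<mapsto> (xf)\<^sup>m\<close> is a homomorphism on \<open>N\<close> whose kernel has finite index, so it is trivial. For a prime \<open>p\<close> dividing the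
order of some element of \<open>N\<close> let \<open>H\<close> be the \<open>p'\<close>-part of \<open>N\<close>. Then \<open>H\<langle>f\<rangle>\<close> is proper, hence a CL-group, and \<open>H\<close> lies in the product of
its layers of order at most \<open>m\<close>; so only finitely many primes occur in \<open>H\<close>, and in \<open>N\<close>. Then \<open>N\<close> is
a finite product of quasicyclic groups and \<open>G\<close> is Chernikov, a contradiction (\<open>no_proper_fin_index\<close>).

Therefore \<open>G\<close> is its own finite residual. The quotient \<open>G/G'\<close> is abelian of exponent dividing \<open>m\<close>, and a nontrivial such group has a proper
subgroup of finite index (\<open>abelian_proper_fin_index\<close>), so \<open>G = G'\<close>. Finally, if \<open>G\<close> were uncountable,
all countable sets of elements of order \<open>m\<close> would generate Chernikov subgroups. Among these one can choose a subgroup whose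
divisible part \<open>D\<close> has a largest possible set of elements of prime order; \<open>D\<close> is then the divisible part of every larger one, and
this forces \<open>D\<close> to have finite index in \<open>G\<close> (\<open>countable_carrier\<close>).

Throughout, Chernikov subgroups are handled by an intrinsic description: an abelian divisible subgroup of finite index with finite
\<open>k\<close>-torsion for all \<open>k\<close>, in which only finitely many primes occur as orders (\<open>chernikov_group_iff\<close>).\<close>

section \<open>Subgroups of finite index\<close>

text \<open>For subgroups this says that \<open>K \<inter> H\<close> has finite index in \<open>H\<close>. The formulation by representatives allows subgroups of subgroups to be
compared inside one ambient group.\<close>

definition fin_index :: "('a, 'b) monoid_scheme \<Rightarrow> 'a set \<Rightarrow> 'a set \<Rightarrow> bool" where
  "fin_index G K H \<longleftrightarrow> (\<exists>T. finite T \<and> T \<subseteq> H \<and> (\<forall>x\<in>H. \<exists>t\<in>T. x \<otimes>\<^bsub>G\<^esub> inv\<^bsub>G\<^esub> t \<in> K))"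

text \<open>Normality relative to a subset of the ambient group: for a subgroup \<open>W\<close> this is \<open>V \<lhd> G\<lparr>carrier := W\<rparr>\<close>.\<close>

definition normal_in :: "('a, 'b) monoid_scheme \<Rightarrow> 'a set \<Rightarrow> 'a set \<Rightarrow> bool" where
  "normal_in G V W \<longleftrightarrow> subgroup V G \<and> V \<subseteq> W \<and>
     (\<forall>w\<in>W. \<forall>v\<in>V. w \<otimes>\<^bsub>G\<^esub> v \<otimes>\<^bsub>G\<^esub> inv\<^bsub>G\<^esub> w \<in> V)"

definition divisible :: "('a, 'b) monoid_scheme \<Rightarrow> 'a set \<Rightarrow> bool" where
  "divisible G D \<longleftrightarrow> (\<forall>k::nat. 0 < k \<longrightarrow> (\<forall>d\<in>D. \<exists>e\<in>D. e [^]\<^bsub>G\<^esub> k = d))"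

definition loc_fin :: "('a, 'b) monoid_scheme \<Rightarrow> 'a set \<Rightarrow> bool" where
  "loc_fin G H \<longleftrightarrow> (\<forall>S. finite S \<and> S \<subseteq> H \<longrightarrow> finite (generate G S))"

text \<open>Finite index is often seen from a map with finite range whose fibres lie in cosets; \<open>fin_index_map\<close> is the converse. Together
they replace the choice of transversals.\<close>

lemma fin_indexI:
  assumes fin: "finite (\<phi> ` H)"
    and sep: "\<And>x y. x \<in> H \<Longrightarrow> y \<in> H \<Longrightarrow> \<phi> x = \<phi> y \<Longrightarrow> x \<otimes>\<^bsub>G\<^esub> inv\<^bsub>G\<^esub> y \<in> K"
  shows "fin_index G K H"
proof -
  define r where "r v = (SOME x. x \<in> H \<and> \<phi> x = v)" for v
  have r: "r (\<phi> x) \<in> H \<and> \<phi> (r (\<phi> x)) = \<phi> x" if "x \<in> H" for x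
    unfolding r_def using that by (intro someI_ex[of "\<lambda>y. y \<in> H \<and> \<phi> y = \<phi> x"]) blast
  show ?thesis
    unfolding fin_index_def
    by (rule exI[of _ "r ` \<phi> ` H"]) (use r fin sep in fastforce)
qed

context group begin

lemma mult_inv_cancel [simp]:
  assumes "x \<in> carrier G" "y \<in> carrier G"
  shows "x \<otimes> (inv x \<otimes> y) = y" "inv x \<otimes> (x \<otimes> y) = y"
  using assms by (simp_all flip: m_assoc)

lemma fin_index_map:
  assumes "subgroup K G" "H \<subseteq> carrier G" "fin_index G K H"
  obtains \<phi> :: "'a \<Rightarrow> 'a" where "finite (\<phi> ` H)"
    "\<And>x y. x \<in> H \<Longrightarrow> y \<in> H \<Longrightarrow> \<phi> x = \<phi> y \<Longrightarrow> x \<otimes> inv y \<in> K"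
proof -
  obtain T where T: "finite T" "T \<subseteq> H" "\<forall>x\<in>H. \<exists>t\<in>T. x \<otimes> inv t \<in> K"
    using assms(3) unfolding fin_index_def by blast
  then obtain \<phi> where \<phi>: "\<And>x. x \<in> H \<Longrightarrow> \<phi> x \<in> T \<and> x \<otimes> inv (\<phi> x) \<in> K"
    by metis
  show thesis
  proof (rule that[of \<phi>])
    show "finite (\<phi> ` H)"
      using \<phi> T(1) by (meson finite_subset image_subsetI)
  next
    fix x y assume xy: "x \<in> H" "y \<in> H" "\<phi> x = \<phi> y"
    then have mem: "x \<in> carrier G" "y \<in> carrier G" "\<phi> x \<in> carrier G"
      using \<phi> T(2) assms(2) by blast+
    have "(x \<otimes> inv (\<phi> x)) \<otimes> inv (y \<otimes> inv (\<phi> x)) \<in> K"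
      using \<phi>[OF xy(1)] \<phi>[OF xy(2)] xy(3) assms(1)
      by (simp add: subgroup.m_closed subgroup.m_inv_closed)
    then show "x \<otimes> inv y \<in> K"
      using mem by (simp add: inv_mult_group m_assoc)
  qed
qed

lemma fin_index_mono:
  assumes "subgroup K G" "H \<subseteq> carrier G" "fin_index G K H" "L \<subseteq> H" "K \<subseteq> K'"
  shows "fin_index G K' L"
proof -
  obtain \<phi> :: "'a \<Rightarrow> 'a" where \<phi>: "finite (\<phi> ` H)"
    "\<And>x y. x \<in> H \<Longrightarrow> y \<in> H \<Longrightarrow> \<phi> x = \<phi> y \<Longrightarrow> x \<otimes> inv y \<in> K"
    using fin_index_map[OF assms(1-3)] by blast
  show ?thesis
  proof (rule fin_indexI[of \<phi>])
    show "finite (\<phi> ` L)" using \<phi>(1) assms(4) by (meson finite_subset image_mono)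
    show "x \<otimes> inv y \<in> K'" if "x \<in> L" "y \<in> L" "\<phi> x = \<phi> y" for x y
      using \<phi>(2)[of x y] that assms(4,5) by blast
  qed
qed

lemma fin_index_Int:
  assumes "subgroup K G" "subgroup L G" "H \<subseteq> carrier G" "fin_index G K H" "fin_index G L H"
  shows "fin_index G (K \<inter> L) H"
proof -
  obtain \<phi> :: "'a \<Rightarrow> 'a" where \<phi>: "finite (\<phi> ` H)"
    "\<And>x y. x \<in> H \<Longrightarrow> y \<in> H \<Longrightarrow> \<phi> x = \<phi> y \<Longrightarrow> x \<otimes> inv y \<in> K"
    using fin_index_map[OF assms(1,3,4)] by blast
  obtain \<psi> :: "'a \<Rightarrow> 'a" where \<psi>: "finite (\<psi> ` H)"
    "\<And>x y. x \<in> H \<Longrightarrow> y \<in> H \<Longrightarrow> \<psi> x = \<psi> y \<Longrightarrow> x \<otimes> inv y \<in> L"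
    using fin_index_map[OF assms(2,3,5)] by blast
  have "(\<lambda>x. (\<phi> x, \<psi> x)) ` H \<subseteq> \<phi> ` H \<times> \<psi> ` H" by auto
  then have "finite ((\<lambda>x. (\<phi> x, \<psi> x)) ` H)"
    using \<phi>(1) \<psi>(1) finite_subset by blast
  then show ?thesis
    by (rule fin_indexI) (use \<phi> \<psi> in auto)
qed

lemma fin_index_self:
  assumes "subgroup H G"
  shows "fin_index G H H"
  unfolding fin_index_def
  using assms subgroup.mem_carrier[OF assms]
  by (intro exI[of _ "{\<one>}"]) (auto simp: subgroup.one_closed)

lemma fin_index_trans:
  assumes "subgroup K G" "subgroup L G" "subgroup H G" "K \<subseteq> H" "fin_index G K H" "fin_index G L K"
  shows "fin_index G L H"
proof -
  obtain T where T: "finite T" "T \<subseteq> H" "\<forall>x\<in>H. \<exists>t\<in>T. x \<otimes> inv t \<in> K"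
    using assms(5) unfolding fin_index_def by blast
  obtain U where U: "finite U" "U \<subseteq> K" "\<forall>x\<in>K. \<exists>t\<in>U. x \<otimes> inv t \<in> L"
    using assms(6) unfolding fin_index_def by blast
  note car = subgroup.mem_carrier[OF assms(3)]
  have "\<exists>v\<in>(\<lambda>(u, t). u \<otimes> t) ` (U \<times> T). x \<otimes> inv v \<in> L" if x: "x \<in> H" for x
  proof -
    obtain t where t: "t \<in> T" "x \<otimes> inv t \<in> K" using T(3) x by blast
    then obtain u where u: "u \<in> U" "(x \<otimes> inv t) \<otimes> inv u \<in> L" using U(3) by blast
    have "x \<in> carrier G" "t \<in> carrier G" "u \<in> carrier G"
      using x t u T(2) U(2) assms(4) car by blast+
    then have "x \<otimes> inv (u \<otimes> t) = (x \<otimes> inv t) \<otimes> inv u"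
      by (simp add: inv_mult_group m_assoc)
    then show ?thesis using t u by force
  qed
  moreover have "(\<lambda>(u, t). u \<otimes> t) ` (U \<times> T) \<subseteq> H"
    using T(2) U(2) assms(3,4) by (auto simp: subgroup.m_closed subset_iff)
  ultimately show ?thesis
    unfolding fin_index_def using T(1) U(1)
    by (intro exI[of _ "(\<lambda>(u, t). u \<otimes> t) ` (U \<times> T)"]) auto
qed

lemma fin_index_iff_rcosets:
  assumes "subgroup K G"
  shows "fin_index G K (carrier G) \<longleftrightarrow> finite (rcosets K)"
proof
  assume "fin_index G K (carrier G)"
  then obtain T where T: "finite T" "T \<subseteq> carrier G" "\<forall>x\<in>carrier G. \<exists>t\<in>T. x \<otimes> inv t \<in> K"
    unfolding fin_index_def by blast
  have "rcosets K \<subseteq> (\<lambda>t. K #> t) ` T"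
  proof
    fix C assume "C \<in> rcosets K"
    then obtain x where x: "x \<in> carrier G" "C = K #> x" unfolding RCOSETS_def by blast
    then obtain t where t: "t \<in> T" "x \<otimes> inv t \<in> K" using T by blast
    then have "t \<in> carrier G" using T(2) by blast
    then have "x \<in> K #> t"
      using subgroup.rcos_module_rev[OF assms is_group _ x(1) t(2)] by blast
    then have "K #> x = K #> t"
      using repr_independence[OF _ \<open>t \<in> carrier G\<close> assms] by simp
    then show "C \<in> (\<lambda>t. K #> t) ` T" using t x by blast
  qed
  then show "finite (rcosets K)" using T(1) finite_surj by blast
next
  assume fin: "finite (rcosets K)"
  have "(\<lambda>x. K #> x) ` carrier G = rcosets K" unfolding RCOSETS_def by auto
  then have "finite ((\<lambda>x. K #> x) ` carrier G)" using fin by simp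
  then show "fin_index G K (carrier G)"
  proof (rule fin_indexI)
    fix x y assume xy: "x \<in> carrier G" "y \<in> carrier G" "K #> x = K #> y"
    then have "x \<in> K #> y" using rcos_self[OF xy(1) assms] by simp
    then show "x \<otimes> inv y \<in> K"
      using subgroup.rcos_module_imp[OF assms is_group xy(2)] by blast
  qed
qed

text \<open>Among the cosets of the powers of \<open>x\<close> two with small exponents coincide, so the factorial of the number of
cosets serves as a uniform exponent.\<close>

lemma fin_index_power:
  assumes "subgroup K G" "subgroup H G" "fin_index G K H"
  obtains c :: nat where "0 < c" "\<And>x. x \<in> H \<Longrightarrow> x [^] c \<in> K"
proof -
  have HG: "H \<subseteq> carrier G" using assms(2) subgroup.subset by blast
  obtain \<phi> :: "'a \<Rightarrow> 'a" where \<phi>: "finite (\<phi> ` H)"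
    "\<And>x y. x \<in> H \<Longrightarrow> y \<in> H \<Longrightarrow> \<phi> x = \<phi> y \<Longrightarrow> x \<otimes> inv y \<in> K"
    using fin_index_map[OF assms(1) HG assms(3)] by blast
  define n where "n = card (\<phi> ` H)"
  have "x [^] (fact n :: nat) \<in> K" if x: "x \<in> H" for x
  proof -
    have xG: "x \<in> carrier G" using x HG by blast
    have pow: "x [^] (i::nat) \<in> H" for i
      using x assms(2) by (induction i) (auto simp: subgroup.one_closed subgroup.m_closed)
    have "(\<lambda>i. \<phi> (x [^] i)) ` {..n} \<subseteq> \<phi> ` H" using pow by blast
    then have "card ((\<lambda>i. \<phi> (x [^] i)) ` {..n}) \<le> n" unfolding n_def by (rule card_mono[OF \<phi>(1)])
    then have "\<not> inj_on (\<lambda>i. \<phi> (x [^] i)) {..n}" using card_image by fastforce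
    then obtain i j where ij: "i \<le> n" "j \<le> n" "i < j" "\<phi> (x [^] i) = \<phi> (x [^] j)"
      unfolding inj_on_def by (metis atMost_iff linorder_neqE_nat)
    have "x [^] j \<otimes> inv (x [^] i) \<in> K" using \<phi>(2)[OF pow pow] ij(4) by metis
    moreover have "x [^] j = x [^] (j - i) \<otimes> x [^] i"
      using ij xG by (simp add: nat_pow_mult)
    ultimately have k: "x [^] (j - i) \<in> K" using xG by (simp add: m_assoc)
    have "j - i dvd fact n" using ij by (intro dvd_fact) auto
    then obtain q where "fact n = (j - i) * q" ..
    then have "x [^] (fact n :: nat) = (x [^] (j - i)) [^] q" using xG by (simp add: nat_pow_pow)
    also have "\<dots> \<in> K" using k assms(1)
      by (induction q) (auto simp: subgroup.one_closed subgroup.m_closed)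
    finally show ?thesis .
  qed
  then show thesis by (intro that[of "fact n"]) auto
qed

lemma subgroup_pow_closed:
  assumes "subgroup H G" "x \<in> H"
  shows "x [^] (n::nat) \<in> H"
  using assms by (induction n) (auto simp: subgroup.one_closed subgroup.m_closed)

text \<open>A divisible group has no proper subgroup of finite index: every element is a \<open>c\<close>-th power, where \<open>c\<close> sends the group into \<open>K\<close>.\<close>

lemma divisible_subset_fin_index:
  assumes "subgroup K G" "subgroup D G" "fin_index G K D" "divisible G D"
  shows "D \<subseteq> K"
  using fin_index_power[OF assms(1-3)] assms(4) unfolding divisible_def by (metis subsetI)

lemma centralizer_subgroup:
  assumes "A \<subseteq> carrier G"
  shows "subgroup {x \<in> carrier G. \<forall>y\<in>A. x \<otimes> y = y \<otimes> x} G"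
proof (rule subgroupI)
  fix a assume a: "a \<in> {x \<in> carrier G. \<forall>y\<in>A. x \<otimes> y = y \<otimes> x}"
  have "inv a \<otimes> y = y \<otimes> inv a" if "y \<in> A" for y
  proof -
    have y: "y \<in> carrier G" and ay: "a \<otimes> y = y \<otimes> a" using that a assms by auto
    have "inv a \<otimes> y = inv a \<otimes> (y \<otimes> a) \<otimes> inv a" using a y by (simp add: m_assoc)
    also have "\<dots> = y \<otimes> inv a" using a y by (simp flip: ay)
    finally show ?thesis .
  qed
  then show "inv a \<in> {x \<in> carrier G. \<forall>y\<in>A. x \<otimes> y = y \<otimes> x}" using a by simp
next
  fix a b assume ab: "a \<in> {x \<in> carrier G. \<forall>y\<in>A. x \<otimes> y = y \<otimes> x}"
    "b \<in> {x \<in> carrier G. \<forall>y\<in>A. x \<otimes> y = y \<otimes> x}"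
  have "a \<otimes> b \<otimes> y = y \<otimes> (a \<otimes> b)" if "y \<in> A" for y
  proof -
    have y: "y \<in> carrier G" "a \<otimes> y = y \<otimes> a" "b \<otimes> y = y \<otimes> b" using that ab assms by auto
    have "a \<otimes> b \<otimes> y = (a \<otimes> y) \<otimes> b" using y(1,3) ab by (simp add: m_assoc)
    also have "\<dots> = y \<otimes> (a \<otimes> b)" by (simp only: y(2)) (use y(1) ab in \<open>simp add: m_assoc\<close>)
    finally show ?thesis .
  qed
  then show "a \<otimes> b \<in> {x \<in> carrier G. \<forall>y\<in>A. x \<otimes> y = y \<otimes> x}" using ab by simp
next
  have "\<one> \<in> {x \<in> carrier G. \<forall>y\<in>A. x \<otimes> y = y \<otimes> x}" using assms by auto
  then show "{x \<in> carrier G. \<forall>y\<in>A. x \<otimes> y = y \<otimes> x} \<noteq> {}" by blast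
qed auto

text \<open>Orbit and stabiliser: the conjugates of \<open>y\<close> under \<open>H\<close> correspond to the cosets of its centraliser in \<open>H\<close>.\<close>

lemma centralizer_fin_index:
  assumes "y \<in> carrier G" "H \<subseteq> carrier G" "finite ((\<lambda>x. inv x \<otimes> y \<otimes> x) ` H)"
  shows "fin_index G {x \<in> carrier G. \<forall>z\<in>{y}. x \<otimes> z = z \<otimes> x} H"
proof (rule fin_indexI[OF assms(3)])
  fix a b assume ab: "a \<in> H" "b \<in> H" "inv a \<otimes> y \<otimes> a = inv b \<otimes> y \<otimes> b"
  then have G: "a \<in> carrier G" "b \<in> carrier G" using assms by auto
  have "a \<otimes> (inv a \<otimes> y \<otimes> a) \<otimes> inv b = a \<otimes> (inv b \<otimes> y \<otimes> b) \<otimes> inv b" using ab by simp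
  then have "y \<otimes> (a \<otimes> inv b) = (a \<otimes> inv b) \<otimes> y" using G assms(1) by (simp add: m_assoc)
  then show "a \<otimes> inv b \<in> {x \<in> carrier G. \<forall>z\<in>{y}. x \<otimes> z = z \<otimes> x}" using G by simp
qed

text \<open>The core consists of the \<open>g\<close> all of whose conjugates lie in \<open>K\<close>. It suffices to test the conjugates by representatives of the
cosets of \<open>K\<close>, so the core is a finite intersection of subgroups of finite index.\<close>

lemma normal_core:
  assumes "subgroup K G" "fin_index G K (carrier G)"
  obtains M where "M \<lhd> G" "M \<subseteq> K" "fin_index G M (carrier G)"
proof -
  define M where "M = {g \<in> carrier G. \<forall>x\<in>carrier G. x \<otimes> g \<otimes> inv x \<in> K}"
  obtain T where T: "finite T" "T \<subseteq> carrier G" "\<forall>x\<in>carrier G. \<exists>t\<in>T. x \<otimes> inv t \<in> K"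
    using assms(2) unfolding fin_index_def by blast
  have M_T: "g \<in> M" if g: "g \<in> carrier G" "\<forall>t\<in>T. t \<otimes> g \<otimes> inv t \<in> K" for g
  proof -
    have "x \<otimes> g \<otimes> inv x \<in> K" if x: "x \<in> carrier G" for x
    proof -
      obtain t where t: "t \<in> T" "x \<otimes> inv t \<in> K" using T x by blast
      have tG: "t \<in> carrier G" using t T by blast
      have "(x \<otimes> inv t) \<otimes> (t \<otimes> g \<otimes> inv t) \<otimes> inv (x \<otimes> inv t) \<in> K"
        using t g assms(1) by (simp add: subgroup.m_closed subgroup.m_inv_closed)
      then show ?thesis using x g tG by (simp add: m_assoc inv_mult_group)
    qed
    then show ?thesis using g unfolding M_def by blast
  qed
  have sub: "subgroup M G"
  proof (rule subgroupI)
    show "M \<subseteq> carrier G" unfolding M_def by blast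
    show "M \<noteq> {}" using assms(1) subgroup.one_closed unfolding M_def by fastforce
  next
    fix a assume a: "a \<in> M"
    have "x \<otimes> inv a \<otimes> inv x \<in> K" if "x \<in> carrier G" for x
    proof -
      have "inv (x \<otimes> a \<otimes> inv x) \<in> K" using a that assms(1) unfolding M_def
        by (simp add: subgroup.m_inv_closed)
      then show ?thesis using a that unfolding M_def by (simp add: inv_mult_group m_assoc)
    qed
    then show "inv a \<in> M" using a unfolding M_def by simp
  next
    fix a b assume ab: "a \<in> M" "b \<in> M"
    have "x \<otimes> (a \<otimes> b) \<otimes> inv x \<in> K" if "x \<in> carrier G" for x
    proof -
      have "(x \<otimes> a \<otimes> inv x) \<otimes> (x \<otimes> b \<otimes> inv x) \<in> K" using ab that assms(1) unfolding M_def
        by (simp add: subgroup.m_closed)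
      then show ?thesis using ab that unfolding M_def by (simp add: m_assoc)
    qed
    then show "a \<otimes> b \<in> M" using ab unfolding M_def by simp
  qed
  have "M \<lhd> G"
  proof (rule normal_invI[OF sub])
    fix x h assume xh: "x \<in> carrier G" "h \<in> M"
    have "y \<otimes> (x \<otimes> h \<otimes> inv x) \<otimes> inv y \<in> K" if y: "y \<in> carrier G" for y
    proof -
      have "(y \<otimes> x) \<otimes> h \<otimes> inv (y \<otimes> x) \<in> K" using xh y unfolding M_def by auto
      then show ?thesis using xh y unfolding M_def by (simp add: m_assoc inv_mult_group)
    qed
    then show "x \<otimes> h \<otimes> inv x \<in> M" using xh unfolding M_def by simp
  qed
  moreover have "M \<subseteq> K"
  proof
    fix g assume "g \<in> M"
    then have "g \<in> carrier G" "\<one> \<otimes> g \<otimes> inv \<one> \<in> K" unfolding M_def by blast+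
    then show "g \<in> K" by simp
  qed
  moreover have "fin_index G M (carrier G)"
  proof -
    obtain \<phi> :: "'a \<Rightarrow> 'a" where \<phi>: "finite (\<phi> ` carrier G)"
      "\<And>x y. x \<in> carrier G \<Longrightarrow> y \<in> carrier G \<Longrightarrow> \<phi> x = \<phi> y \<Longrightarrow> x \<otimes> inv y \<in> K"
      using fin_index_map[OF assms(1) subset_refl assms(2)] by blast
    define \<psi> where "\<psi> g = restrict (\<lambda>t. \<phi> (t \<otimes> g \<otimes> inv t)) T" for g
    have "\<psi> ` carrier G \<subseteq> (\<Pi>\<^sub>E t\<in>T. \<phi> ` carrier G)"
    proof (rule image_subsetI)
      fix g assume g: "g \<in> carrier G"
      show "\<psi> g \<in> (\<Pi>\<^sub>E t\<in>T. \<phi> ` carrier G)"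
        unfolding \<psi>_def restrict_PiE_iff
      proof
        fix t assume "t \<in> T"
        then have "t \<in> carrier G" using T(2) by blast
        then show "\<phi> (t \<otimes> g \<otimes> inv t) \<in> \<phi> ` carrier G" using g by simp
      qed
    qed
    then have "finite (\<psi> ` carrier G)"
      by (rule finite_subset) (simp add: finite_PiE[OF T(1)] \<phi>(1))
    then show ?thesis
    proof (rule fin_indexI)
      fix x y assume xy: "x \<in> carrier G" "y \<in> carrier G" "\<psi> x = \<psi> y"
      show "x \<otimes> inv y \<in> M"
      proof (rule M_T)
        show "\<forall>t\<in>T. t \<otimes> (x \<otimes> inv y) \<otimes> inv t \<in> K"
        proof
          fix t assume t: "t \<in> T"
          then have tG: "t \<in> carrier G" using T by blast
          have "\<phi> (t \<otimes> x \<otimes> inv t) = \<phi> (t \<otimes> y \<otimes> inv t)"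
            using fun_cong[OF xy(3), of t] t unfolding \<psi>_def by simp
          then have "(t \<otimes> x \<otimes> inv t) \<otimes> inv (t \<otimes> y \<otimes> inv t) \<in> K"
            using \<phi>(2) xy tG by simp
          then show "t \<otimes> (x \<otimes> inv y) \<otimes> inv t \<in> K"
            using xy tG by (simp add: m_assoc inv_mult_group)
        qed
      qed (use xy in simp)
    qed
  qed
  ultimately show thesis by (rule that)
qed

section \<open>Local finiteness\<close>

text \<open>Schreier's lemma. The elements \<open>t s (r(ts))\<^sup>-\<^sup>1\<close>, with \<open>t\<close> a representative, \<open>s\<close> a generator or its inverse and \<open>r\<close> choosing
representatives, generate a subgroup of \<open>K\<close> whose product with the set of representatives is closed under right multiplication. Several
representatives may lie in \<open>K\<close>; they are added to the generating set.\<close>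

lemma schreier:
  assumes "finite S" "S \<subseteq> carrier G" "subgroup K G" "K \<subseteq> generate G S" "fin_index G K (generate G S)"
  obtains R where "finite R" "R \<subseteq> K" "generate G R = K"
proof -
  define Q where "Q = generate G S"
  have Q: "subgroup Q G" unfolding Q_def using assms(2) generate_is_subgroup by blast
  note QG = subgroup.mem_carrier[OF Q]
  obtain T0 where T0: "finite T0" "T0 \<subseteq> Q" "\<forall>x\<in>Q. \<exists>t\<in>T0. x \<otimes> inv t \<in> K"
    using assms(5) unfolding fin_index_def Q_def by blast
  then obtain r where r: "\<And>x. x \<in> Q \<Longrightarrow> r x \<in> T0 \<and> x \<otimes> inv (r x) \<in> K" by metis
  define T where "T = insert \<one> T0"
  have TQ: "T \<subseteq> Q" unfolding T_def using T0 Q by (simp add: subgroup.one_closed)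
  define S' where "S' = S \<union> (\<lambda>s. inv s) ` S"
  have S'Q: "S' \<subseteq> Q" unfolding S'_def Q_def
    by (auto intro: generate.incl generate.inv)
  define Z where "Z = (\<lambda>(t, s). (t \<otimes> s) \<otimes> inv (r (t \<otimes> s))) ` (T \<times> S')"
  define R where "R = Z \<union> (T \<inter> K)"
  have XK: "Z \<subseteq> K" unfolding Z_def using TQ S'Q Q r by (auto simp: subgroup.m_closed subset_iff)
  have XG: "Z \<subseteq> carrier G" using XK assms(3) subgroup.subset by blast
  have KX: "subgroup (generate G Z) G" using generate_is_subgroup[OF XG] .
  note KXG = subgroup.mem_carrier[OF KX]
  \<comment> \<open>It will turn out that \<open>P\<close> is the whole of \<open>generate G S\<close>.\<close>
  define P where "P = (\<lambda>(k, t). k \<otimes> t) ` (generate G Z \<times> T)"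
  have step: "k \<otimes> t \<otimes> s \<in> P" if kts: "k \<in> generate G Z" "t \<in> T" "s \<in> S'" for k t s
  proof -
    have ts: "t \<otimes> s \<in> Q" using kts TQ S'Q Q by (auto simp: subgroup.m_closed subset_iff)
    define u where "u = (t \<otimes> s) \<otimes> inv (r (t \<otimes> s))"
    have "u \<in> Z" unfolding Z_def u_def using kts by force
    then have "k \<otimes> u \<in> generate G Z" using kts KX by (simp add: generate.incl subgroup.m_closed)
    moreover have rT: "r (t \<otimes> s) \<in> T" using r[OF ts] unfolding T_def by blast
    moreover have "k \<otimes> t \<otimes> s = (k \<otimes> u) \<otimes> r (t \<otimes> s)"
    proof -
      have "k \<in> carrier G" "t \<in> carrier G" "s \<in> carrier G" "r (t \<otimes> s) \<in> carrier G"
        using KXG kts TQ S'Q QG rT by blast+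
      then show ?thesis unfolding u_def by (simp add: m_assoc)
    qed
    ultimately show ?thesis unfolding P_def by force
  qed
  have PG: "P \<subseteq> carrier G" unfolding P_def using KXG TQ QG by auto
  have closed: "\<forall>p\<in>P. p \<otimes> g \<in> P" if "g \<in> generate G S" for g
    using that
  proof (induction g rule: generate.induct)
    case one
    then show ?case using PG by (auto simp: subset_iff)
  next
    case (incl h)
    then show ?case using step unfolding P_def S'_def by auto
  next
    case (inv h)
    then show ?case using step unfolding P_def S'_def by auto
  next
    case (eng h1 h2)
    have "h1 \<in> carrier G" "h2 \<in> carrier G"
      using eng assms(2) by (auto intro: generate_in_carrier)
    then show ?case using eng PG by (simp add: m_assoc[symmetric] subset_iff)
  qed
  have "\<one> \<otimes> \<one> \<in> P" unfolding P_def T_def by (rule image_eqI[of _ _ "(\<one>, \<one>)"]) (auto intro: generate.one)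
  then have one: "\<one> \<in> P" by simp
  have RK: "R \<subseteq> K" using XK unfolding R_def by blast
  have "K \<subseteq> generate G R"
  proof
    fix x assume x: "x \<in> K"
    then have xG: "x \<in> carrier G" by (rule subgroup.mem_carrier[OF assms(3)])
    have "\<one> \<otimes> x \<in> P" using closed one x assms(4) by blast
    then have "x \<in> P" using xG by simp
    then obtain k t where kt: "k \<in> generate G Z" "t \<in> T" "x = k \<otimes> t" unfolding P_def by auto
    have kK: "k \<in> K" using kt(1) generate_subgroup_incl[OF XK assms(3)] by blast
    have "t = inv k \<otimes> x" using kt KXG TQ QG by (simp add: subset_iff)
    then have "t \<in> K" using kK x assms(3) by (simp add: subgroup.m_closed subgroup.m_inv_closed)
    then have "t \<in> generate G R" using kt unfolding R_def by (simp add: generate.incl)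
    moreover have "k \<in> generate G R" using kt(1) mono_generate[of Z R] unfolding R_def by blast
    ultimately show "x \<in> generate G R" using kt(3) by (simp add: generate.eng)
  qed
  moreover have "generate G R \<subseteq> K" using RK assms(3) generate_subgroup_incl by blast
  moreover have "finite R" unfolding R_def Z_def S'_def T_def using assms(1) T0(1) by simp
  ultimately show thesis using that RK by blast
qed

lemma fin_index_finite:
  assumes "subgroup K G" "subgroup H G" "fin_index G K H" "finite (K \<inter> H)"
  shows "finite H"
proof -
  obtain T where T: "finite T" "T \<subseteq> H" "\<forall>x\<in>H. \<exists>t\<in>T. x \<otimes> inv t \<in> K"
    using assms(3) unfolding fin_index_def by blast
  have "H \<subseteq> (\<lambda>(k, t). k \<otimes> t) ` ((K \<inter> H) \<times> T)"
  proof
    fix x assume x: "x \<in> H"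
    then obtain t where t: "t \<in> T" "x \<otimes> inv t \<in> K" using T by blast
    have "x \<otimes> inv t \<in> H" using x t T assms(2) by (simp add: subgroup.m_closed subgroup.m_inv_closed subset_iff)
    moreover have "x = x \<otimes> inv t \<otimes> t"
      using x t T subgroup.mem_carrier[OF assms(2)] by (simp add: m_assoc subset_iff)
    ultimately show "x \<in> (\<lambda>(k, t). k \<otimes> t) ` ((K \<inter> H) \<times> T)" using t by force
  qed
  then show ?thesis using assms(4) T(1) finite_subset by fastforce
qed

text \<open>If \<open>Q \<subseteq> H\<close> is finitely generated, so is \<open>K \<inter> Q\<close> by Schreier's lemma; thus \<open>K \<inter> Q\<close> is finite, and so is \<open>Q\<close>.\<close>

lemma loc_fin_fin_index:
  assumes "subgroup K G" "subgroup H G" "loc_fin G K" "fin_index G K H"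
  shows "loc_fin G H"
  unfolding loc_fin_def
proof (intro allI impI)
  fix S assume S: "finite S \<and> S \<subseteq> H"
  define Q where "Q = generate G S"
  have HG: "H \<subseteq> carrier G" using assms(2) subgroup.subset by blast
  have Q: "subgroup Q G" unfolding Q_def using S HG generate_is_subgroup by blast
  have QH: "Q \<subseteq> H" unfolding Q_def using S assms(2) generate_subgroup_incl by blast
  have KQ: "subgroup (K \<inter> Q) G" using assms(1) Q subgroups_Inter_pair by blast
  have fi: "fin_index G K Q" using fin_index_mono[OF assms(1) HG assms(4) QH] by blast
  have "fin_index G (K \<inter> Q) Q"
    using fin_index_Int[OF assms(1) Q _ fi fin_index_self[OF Q]] Q subgroup.subset by blast
  then obtain R where R: "finite R" "R \<subseteq> K \<inter> Q" "generate G R = K \<inter> Q"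
    using schreier[of S "K \<inter> Q"] S HG KQ unfolding Q_def by blast
  then have "finite (K \<inter> Q)" using assms(3) unfolding loc_fin_def by (metis le_inf_iff)
  then show "finite (generate G S)"
    using fin_index_finite[OF assms(1) Q fi] unfolding Q_def by blast
qed

lemma set_multI: "a \<in> A \<Longrightarrow> b \<in> B \<Longrightarrow> a \<otimes> b \<in> A <#> B"
  unfolding set_mult_def by blast

lemma subgroup_set_mult:
  assumes "subgroup A G" "subgroup B G" "\<And>a b. a \<in> A \<Longrightarrow> b \<in> B \<Longrightarrow> b \<otimes> a \<otimes> inv b \<in> A"
  shows "subgroup (A <#> B) G"
proof (rule subgroupI)
  note AG = subgroup.mem_carrier[OF assms(1)] and BG = subgroup.mem_carrier[OF assms(2)]
  show "A <#> B \<subseteq> carrier G" using AG BG unfolding set_mult_def by auto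
  show "A <#> B \<noteq> {}" using assms(1,2) subgroup.one_closed unfolding set_mult_def by fastforce
  {
    fix x assume "x \<in> A <#> B"
    then obtain a b where ab: "a \<in> A" "b \<in> B" "x = a \<otimes> b" unfolding set_mult_def by auto
    have "inv x = (inv b \<otimes> inv a \<otimes> inv (inv b)) \<otimes> inv b"
      using ab AG BG by (simp add: inv_mult_group m_assoc)
    moreover have "inv b \<otimes> inv a \<otimes> inv (inv b) \<in> A"
      using assms ab by (simp add: subgroup.m_inv_closed)
    moreover have "inv b \<in> B" using ab(2) assms(2) by (simp add: subgroup.m_inv_closed)
    ultimately show "inv x \<in> A <#> B" by (simp only: set_multI)
  }
  {
    fix x y assume "x \<in> A <#> B" "y \<in> A <#> B"
    then obtain a b c d where ab: "a \<in> A" "b \<in> B" "x = a \<otimes> b" "c \<in> A" "d \<in> B" "y = c \<otimes> d"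
      unfolding set_mult_def by auto
    have "x \<otimes> y = (a \<otimes> (b \<otimes> c \<otimes> inv b)) \<otimes> (b \<otimes> d)"
      using ab AG BG by (simp add: m_assoc)
    moreover have "a \<otimes> (b \<otimes> c \<otimes> inv b) \<in> A" "b \<otimes> d \<in> B"
      using assms ab by (simp_all add: subgroup.m_closed)
    ultimately show "x \<otimes> y \<in> A <#> B" by (simp only: set_multI)
  }
qed

lemma subset_set_mult:
  assumes "subgroup A G" "subgroup B G"
  shows "A \<subseteq> A <#> B" "B \<subseteq> A <#> B"
proof -
  note AG = subgroup.mem_carrier[OF assms(1)] and BG = subgroup.mem_carrier[OF assms(2)]
  show "A \<subseteq> A <#> B"
  proof
    fix a assume a: "a \<in> A"
    show "a \<in> A <#> B" using set_multI[OF a subgroup.one_closed[OF assms(2)]] a AG by simp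
  qed
  show "B \<subseteq> A <#> B"
  proof
    fix b assume b: "b \<in> B"
    show "b \<in> A <#> B" using set_multI[OF subgroup.one_closed[OF assms(1)] b] b BG by simp
  qed
qed

lemma normal_in_set_mult:
  assumes "subgroup W G" "normal_in G A W" "normal_in G B W"
  shows "normal_in G (A <#> B) W"
proof -
  note WG = subgroup.mem_carrier[OF assms(1)]
  have A: "subgroup A G" "A \<subseteq> W" "\<And>w a. w \<in> W \<Longrightarrow> a \<in> A \<Longrightarrow> w \<otimes> a \<otimes> inv w \<in> A"
    and B: "subgroup B G" "B \<subseteq> W" "\<And>w a. w \<in> W \<Longrightarrow> a \<in> B \<Longrightarrow> w \<otimes> a \<otimes> inv w \<in> B"
    using assms(2,3) unfolding normal_in_def by auto
  have "subgroup (A <#> B) G" using A B by (intro subgroup_set_mult) auto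
  moreover have "A <#> B \<subseteq> W" using A B assms(1) unfolding set_mult_def
    by (auto simp: subset_iff subgroup.m_closed)
  moreover have "w \<otimes> x \<otimes> inv w \<in> A <#> B" if wx: "w \<in> W" "x \<in> A <#> B" for w x
  proof -
    obtain a b where ab: "a \<in> A" "b \<in> B" "x = a \<otimes> b" using wx unfolding set_mult_def by auto
    then have "w \<otimes> x \<otimes> inv w = (w \<otimes> a \<otimes> inv w) \<otimes> (w \<otimes> b \<otimes> inv w)"
      using wx WG A B by (simp add: m_assoc subset_iff)
    moreover have "w \<otimes> a \<otimes> inv w \<in> A" "w \<otimes> b \<otimes> inv w \<in> B" using A(3) B(3) wx(1) ab by blast+
    ultimately show ?thesis by (simp only: set_multI)
  qed
  ultimately show ?thesis unfolding normal_in_def by blast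
qed

text \<open>A principle used for local finiteness and for bounding the primes that occur as orders: a property
that passes to products of two relatively normal subgroups passes to the join of finitely many of them.\<close>

lemma normal_in_finite_join:
  assumes W: "subgroup W G" and one: "P {\<one>}"
    and mult: "\<And>A B. normal_in G A W \<Longrightarrow> normal_in G B W \<Longrightarrow> P A \<Longrightarrow> P B \<Longrightarrow> P (A <#> B)"
    and F: "finite F" "\<And>U. U \<in> F \<Longrightarrow> normal_in G U W \<and> P U"
  obtains V where "normal_in G V W" "P V" "\<And>U. U \<in> F \<Longrightarrow> U \<subseteq> V"
proof -
  have "\<exists>V. normal_in G V W \<and> P V \<and> (\<forall>U\<in>F. U \<subseteq> V)"
    using F
  proof (induction F rule: finite_induct)
    case empty
    have "normal_in G {\<one>} W"
      unfolding normal_in_def using W subgroup.mem_carrier[OF W]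
      by (auto simp: triv_subgroup subgroup.one_closed)
    then show ?case using one by blast
  next
    case (insert U F)
    then obtain V where V: "normal_in G V W" "P V" "\<forall>U\<in>F. U \<subseteq> V" by auto
    have U: "normal_in G U W" "P U" using insert by auto
    have "subgroup U G" "subgroup V G" using U V unfolding normal_in_def by auto
    then have "U \<subseteq> U <#> V" "V \<subseteq> U <#> V" using subset_set_mult by auto
    then have "\<forall>U'\<in>insert U F. U' \<subseteq> U <#> V" using V(3) by blast
    then show ?case using normal_in_set_mult[OF W U(1) V(1)] mult[OF U(1) V(1) U(2) V(2)] by blast
  qed
  then show thesis using that by blast
qed

text \<open>Modulo \<open>A\<close> a finite subset of \<open>AB\<close> generates the image of a finite subgroup \<open>C\<close> of \<open>B\<close>; so it lies in \<open>AC\<close>, where \<open>A\<close> has finite index.\<close>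

lemma loc_fin_set_mult:
  assumes "subgroup W G" "normal_in G A W" "normal_in G B W" "loc_fin G A" "loc_fin G B"
  shows "loc_fin G (A <#> B)"
  unfolding loc_fin_def
proof (intro allI impI)
  fix S assume S: "finite S \<and> S \<subseteq> A <#> B"
  have A: "subgroup A G" "A \<subseteq> W" "\<And>w a. w \<in> W \<Longrightarrow> a \<in> A \<Longrightarrow> w \<otimes> a \<otimes> inv w \<in> A"
    and B: "subgroup B G" "B \<subseteq> W" 
    using assms(2,3) unfolding normal_in_def by auto
  note AG = subgroup.mem_carrier[OF A(1)] and BG = subgroup.mem_carrier[OF B(1)]
  have "\<forall>s\<in>S. \<exists>a b. a \<in> A \<and> b \<in> B \<and> s = a \<otimes> b" using S unfolding set_mult_def by blast
  then obtain a b where ab: "\<And>s. s \<in> S \<Longrightarrow> a s \<in> A \<and> b s \<in> B \<and> s = a s \<otimes> b s" by metis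
  define C where "C = generate G (b ` S)"
  have bS: "b ` S \<subseteq> B" using ab by blast
  have C: "subgroup C G" unfolding C_def using bS B(1) subgroup.subset generate_is_subgroup
    by (metis dual_order.trans)
  have CB: "C \<subseteq> B" unfolding C_def using bS B(1) generate_subgroup_incl by blast
  have finC: "finite C" using assms(5) S bS unfolding loc_fin_def C_def by blast
  have AC: "subgroup (A <#> C) G"
    using A B C CB by (intro subgroup_set_mult) auto
  have "fin_index G A (A <#> C)"
    unfolding fin_index_def
  proof (intro exI conjI ballI)
    show "finite C" by (rule finC)
    show "C \<subseteq> A <#> C" using subset_set_mult A(1) C by blast
    fix x assume "x \<in> A <#> C"
    then obtain a c where "a \<in> A" "c \<in> C" "x = a \<otimes> c" unfolding set_mult_def by auto
    then show "\<exists>t\<in>C. x \<otimes> inv t \<in> A" using AG BG CB by (intro bexI[of _ c]) (auto simp: m_assoc subset_iff)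
  qed
  then have "loc_fin G (A <#> C)" using loc_fin_fin_index A(1) AC assms(4) by blast
  moreover have "S \<subseteq> A <#> C"
    using ab unfolding set_mult_def C_def by (force intro: generate.incl)
  ultimately show "finite (generate G S)" using S unfolding loc_fin_def by blast
qed

lemma loc_fin_if_normal_cover:
  assumes W: "subgroup W G" and cover: "\<And>x. x \<in> W \<Longrightarrow> \<exists>U. normal_in G U W \<and> loc_fin G U \<and> x \<in> U"
  shows "loc_fin G W"
  unfolding loc_fin_def
proof (intro allI impI)
  fix S assume S: "finite S \<and> S \<subseteq> W"
  have "\<forall>x\<in>S. \<exists>U. normal_in G U W \<and> loc_fin G U \<and> x \<in> U" using cover S by blast
  then obtain U where U: "\<And>x. x \<in> S \<Longrightarrow> normal_in G (U x) W \<and> loc_fin G (U x) \<and> x \<in> U x" by metis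
  have "loc_fin G {\<one>}"
    unfolding loc_fin_def
  proof (intro allI impI)
    fix S assume "finite S \<and> S \<subseteq> {\<one>}"
    then have "S = {} \<or> S = {\<one>}" by blast
    then show "finite (generate G S)" using generate_one generate_empty by auto
  qed
  then obtain V where V: "normal_in G V W" "loc_fin G V" "\<And>U'. U' \<in> U ` S \<Longrightarrow> U' \<subseteq> V"
    using normal_in_finite_join[OF W, of "loc_fin G" "U ` S"] loc_fin_set_mult[OF W] S U by blast
  then have "S \<subseteq> V" using U by blast
  then show "finite (generate G S)" using V(2) S unfolding loc_fin_def by blast
qed

text \<open>Here each cyclic subgroup is finite and normal.\<close>

lemma loc_fin_abelian_torsion:
  assumes D: "subgroup D G" and comm: "\<And>x y. x \<in> D \<Longrightarrow> y \<in> D \<Longrightarrow> x \<otimes> y = y \<otimes> x"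
    and tors: "\<And>x. x \<in> D \<Longrightarrow> 0 < ord x"
  shows "loc_fin G D"
proof (rule loc_fin_if_normal_cover[OF D])
  fix x assume x: "x \<in> D"
  note DG = subgroup.mem_carrier[OF D]
  have gD: "generate G {x} \<subseteq> D" using x D by (intro generate_subgroup_incl) auto
  have "w \<otimes> v \<otimes> inv w = v" if "w \<in> D" "v \<in> generate G {x}" for w v
  proof -
    have "v \<in> D" using that gD by blast
    then show ?thesis using comm[of w v] that DG by (simp add: m_assoc)
  qed
  then have "normal_in G (generate G {x}) D"
    unfolding normal_in_def using gD x DG by (auto intro: generate_is_subgroup)
  moreover have "finite (generate G {x})"
  proof -
    have xG: "x \<in> carrier G" using x DG by blast
    have "generate G {x} = {x [^] k |k. k \<in> {0..ord x - 1}}"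
      using generate_pow_nat[OF xG] ord_elems_inf_carrier[OF xG] tors[OF x] by simp
    then show ?thesis by (simp add: setcompr_eq_image)
  qed
  moreover have "loc_fin G (generate G {x})"
    unfolding loc_fin_def
    using \<open>finite (generate G {x})\<close> x DG generate_is_subgroup[of "{x}"]
    by (metis bot.extremum finite_subset generate_subgroup_incl insert_subset)
  moreover have "x \<in> generate G {x}" by (simp add: generate.incl)
  ultimately show "\<exists>U. normal_in G U D \<and> loc_fin G U \<and> x \<in> U" by blast
qed

end

section \<open>Chernikov subgroups\<close>

text \<open>A periodic group in which only finitely many primes divide the orders of elements. One number \<open>n\<close> instead of a set of primes keeps the
treatment of products and extensions short: the numbers are multiplied.\<close>

definition bounded_primes :: "('a, 'b) monoid_scheme \<Rightarrow> 'a set \<Rightarrow> bool" where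
  "bounded_primes G H \<longleftrightarrow> (\<exists>n::nat. 0 < n \<and> (\<forall>x\<in>H. \<exists>j::nat. x [^]\<^bsub>G\<^esub> (n ^ j) = \<one>\<^bsub>G\<^esub>))"

text \<open>Intrinsic description of the direct products of finitely many quasicyclic groups; the equivalence is given by
\<open>divisible_artinian_if_prufer_product\<close> and \<open>divisible_artinian_iso_prufer_product\<close>.\<close>

definition divisible_artinian :: "('a, 'b) monoid_scheme \<Rightarrow> 'a set \<Rightarrow> bool" where
  "divisible_artinian G D \<longleftrightarrow> subgroup D G \<and> (\<forall>x\<in>D. \<forall>y\<in>D. x \<otimes>\<^bsub>G\<^esub> y = y \<otimes>\<^bsub>G\<^esub> x) \<and>
     divisible G D \<and> bounded_primes G D \<and> (\<forall>k::nat. 0 < k \<longrightarrow> finite {x \<in> D. x [^]\<^bsub>G\<^esub> k = \<one>\<^bsub>G\<^esub>})"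

text \<open>The Chernikov property of a subgroup; see \<open>chernikov_group_iff\<close>. A witness \<open>D\<close> is automatically normal in \<open>H\<close>, being a set of powers
(\<open>chernikov_in_powers\<close>).\<close>

definition chernikov_in :: "('a, 'b) monoid_scheme \<Rightarrow> 'a set \<Rightarrow> bool" where
  "chernikov_in G H \<longleftrightarrow> subgroup H G \<and> (\<exists>D\<subseteq>H. divisible_artinian G D \<and> fin_index G D H)"

context group begin

lemma chernikov_inE:
  assumes "chernikov_in G H"
  obtains D where "subgroup H G" "D \<subseteq> H" "subgroup D G" "\<And>x y. x \<in> D \<Longrightarrow> y \<in> D \<Longrightarrow> x \<otimes> y = y \<otimes> x"
    "divisible G D" "bounded_primes G D" "\<And>k::nat. 0 < k \<Longrightarrow> finite {x \<in> D. x [^] k = \<one>}" "fin_index G D H"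
    "divisible_artinian G D"
  using assms unfolding chernikov_in_def divisible_artinian_def by blast

lemma divisible_artinian_finite_socle:
  assumes "divisible_artinian G D"
  shows "finite {x \<in> D. Factorial_Ring.prime (ord x)}"
proof -
  have DG: "subgroup D G" and bp: "bounded_primes G D"
    and fin: "\<And>k::nat. 0 < k \<Longrightarrow> finite {x \<in> D. x [^] k = \<one>}"
    using assms unfolding divisible_artinian_def by blast+
  obtain n :: nat where n: "0 < n" "\<And>x. x \<in> D \<Longrightarrow> \<exists>j::nat. x [^] (n ^ j) = \<one>"
    using bp unfolding bounded_primes_def by blast
  have "{x \<in> D. Factorial_Ring.prime (ord x)} \<subseteq> {x \<in> D. x [^] n = \<one>}"
  proof
    fix x assume "x \<in> {x \<in> D. Factorial_Ring.prime (ord x)}"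
    then have x: "x \<in> D" "Factorial_Ring.prime (ord x)" "x \<in> carrier G" using subgroup.mem_carrier[OF DG] by auto
    obtain j :: nat where "x [^] (n ^ j) = \<one>" using n(2)[OF x(1)] by blast
    then have "ord x dvd n ^ j" using pow_eq_id[OF x(3)] by blast
    then have "ord x dvd n" by (rule prime_dvd_power[OF x(2)])
    then show "x \<in> {x \<in> D. x [^] n = \<one>}" using x(1) pow_eq_id[OF x(3)] by blast
  qed
  then show ?thesis using fin[OF n(1)] finite_subset by blast
qed

lemma chernikov_in_finite:
  assumes "subgroup H G" "finite H"
  shows "chernikov_in G H"
proof -
  have one: "\<one> \<in> H" by (rule subgroup.one_closed[OF assms(1)])
  have "divisible_artinian G {\<one>}"
    unfolding divisible_artinian_def divisible_def bounded_primes_def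
    by (auto simp: triv_subgroup intro: exI[of _ 1])
  moreover have "fin_index G {\<one>} H"
    unfolding fin_index_def
    using assms(2) subgroup.mem_carrier[OF assms(1)]
    by (intro exI[of _ H]) (auto intro!: bexI[where P = "\<lambda>t. _ \<otimes> inv t = \<one>"])
  ultimately show ?thesis
    unfolding chernikov_in_def using assms(1) one by blast
qed

lemma bounded_primes_ord_pos:
  assumes "H \<subseteq> carrier G" "bounded_primes G H" "x \<in> H"
  shows "0 < ord x"
proof -
  obtain n j :: nat where "0 < n" "x [^] (n ^ j) = \<one>"
    using assms(2,3) unfolding bounded_primes_def by blast
  then have "ord x dvd n ^ j" using pow_eq_id assms(1,3) by blast
  then show ?thesis using \<open>0 < n\<close> by (auto intro: Nat.gr0I)
qed

lemma bounded_primes_extension: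
  assumes n: "0 < n" and K: "K \<subseteq> carrier G" "bounded_primes G K"
    and H: "H \<subseteq> carrier G" "\<And>x. x \<in> H \<Longrightarrow> \<exists>j::nat. x [^] ((n::nat) ^ j) \<in> K"
  shows "bounded_primes G H"
proof -
  obtain m :: nat where m: "0 < m" "\<And>x. x \<in> K \<Longrightarrow> \<exists>j::nat. x [^] (m ^ j) = \<one>"
    using K(2) unfolding bounded_primes_def by blast
  have "\<exists>j::nat. x [^] ((n * m) ^ j) = \<one>" if x: "x \<in> H" for x
  proof -
    obtain i :: nat where i: "x [^] (n ^ i) \<in> K" using H(2) x by blast
    obtain j :: nat where j: "(x [^] (n ^ i)) [^] (m ^ j) = \<one>" using m(2)[OF i] by blast
    have xG: "x \<in> carrier G" using x H(1) by blast
    have "ord x dvd n ^ i * m ^ j" using j xG by (simp add: nat_pow_pow pow_eq_id)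
    also have "n ^ i * m ^ j dvd n ^ (i + j) * m ^ (i + j)"
      by (intro mult_dvd_mono le_imp_power_dvd) auto
    finally have "x [^] ((n * m) ^ (i + j)) = \<one>" using xG by (simp add: pow_eq_id power_mult_distrib)
    then show ?thesis by blast
  qed
  then show ?thesis unfolding bounded_primes_def using n m(1) by (intro exI[of _ "n * m"]) auto
qed

lemma bounded_primes_fin_index:
  assumes "subgroup K G" "subgroup H G" "fin_index G K H" "bounded_primes G K"
  shows "bounded_primes G H"
proof -
  obtain c :: nat where c: "0 < c" "\<And>x. x \<in> H \<Longrightarrow> x [^] c \<in> K"
    using fin_index_power[OF assms(1-3)] by blast
  show ?thesis
  proof (rule bounded_primes_extension[OF c(1) _ assms(4)])
    show "\<exists>j. x [^] (c ^ j) \<in> K" if "x \<in> H" for x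
      using c(2)[OF that] by (intro exI[of _ 1]) simp
  qed (use assms subgroup.subset in blast)+
qed

lemma conj_power_closed:
  assumes "b \<in> carrier G" "A \<subseteq> carrier G" "\<And>a. a \<in> A \<Longrightarrow> b \<otimes> a \<otimes> inv b \<in> A" "a \<in> A"
  shows "b [^] i \<otimes> a \<otimes> inv (b [^] (i::nat)) \<in> A"
proof (induction i)
  case 0 then show ?case using assms(2,4) by (simp add: subset_iff)
next
  case (Suc i)
  have "b [^] Suc i \<otimes> a \<otimes> inv (b [^] Suc i) = b \<otimes> (b [^] i \<otimes> a \<otimes> inv (b [^] i)) \<otimes> inv b"
    unfolding nat_pow_Suc2[OF assms(1)]
    using assms by (simp add: inv_mult_group m_assoc subset_iff del: nat_pow_Suc)
  then show ?case using assms(3)[OF Suc] by simp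
qed

lemma pow_mult_normal:
  assumes "subgroup A G" "b \<in> carrier G" "a \<in> A" "\<And>a. a \<in> A \<Longrightarrow> b \<otimes> a \<otimes> inv b \<in> A"
  shows "\<exists>a'\<in>A. (a \<otimes> b) [^] (k::nat) = a' \<otimes> b [^] k"
proof (induction k)
  case 0
  show ?case using assms(1) by (intro bexI[of _ \<one>]) (auto simp: subgroup.one_closed)
next
  case (Suc k)
  note AG = subgroup.mem_carrier[OF assms(1)]
  have conj: "b [^] i \<otimes> c \<otimes> inv (b [^] i) \<in> A" if "c \<in> A" for c and i :: nat
    using conj_power_closed[OF assms(2) subgroup.subset[OF assms(1)] assms(4) that] .
  obtain a' where a': "a' \<in> A" "(a \<otimes> b) [^] k = a' \<otimes> b [^] k" using Suc by blast
  have "(a \<otimes> b) [^] Suc k = (a' \<otimes> (b [^] k \<otimes> a \<otimes> inv (b [^] k))) \<otimes> b [^] Suc k"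
    using a' assms(2,3) AG by (simp add: m_assoc)
  moreover have "a' \<otimes> (b [^] k \<otimes> a \<otimes> inv (b [^] k)) \<in> A"
    using a'(1) conj[OF assms(3)] assms(1) by (simp add: subgroup.m_closed)
  ultimately show ?case by blast
qed

text \<open>Modulo \<open>A\<close>, powers of \<open>ab\<close> are powers of \<open>b\<close>, so a suitable power of \<open>ab\<close> lies in \<open>A\<close>.\<close>

lemma bounded_primes_set_mult:
  assumes "subgroup W G" "normal_in G A W" "normal_in G B W" "bounded_primes G A" "bounded_primes G B"
  shows "bounded_primes G (A <#> B)"
proof -
  have A: "subgroup A G" "A \<subseteq> W" "\<And>w a. w \<in> W \<Longrightarrow> a \<in> A \<Longrightarrow> w \<otimes> a \<otimes> inv w \<in> A"
    and B: "subgroup B G" "B \<subseteq> W"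
    using assms(2,3) unfolding normal_in_def by auto
  obtain m :: nat where m: "0 < m" "\<And>x. x \<in> B \<Longrightarrow> \<exists>j::nat. x [^] (m ^ j) = \<one>"
    using assms(5) unfolding bounded_primes_def by blast
  note AG = subgroup.mem_carrier[OF A(1)] and BG = subgroup.mem_carrier[OF B(1)]
  show ?thesis
  proof (rule bounded_primes_extension[OF m(1) _ assms(4)])
    show "A \<subseteq> carrier G" "A <#> B \<subseteq> carrier G"
      using AG BG unfolding set_mult_def by auto
    fix x assume "x \<in> A <#> B"
    then obtain a b where ab: "a \<in> A" "b \<in> B" "x = a \<otimes> b" unfolding set_mult_def by auto
    obtain j where j: "b [^] (m ^ j) = \<one>" using m(2) ab by blast
    obtain a' where "a' \<in> A" "(a \<otimes> b) [^] (m ^ j) = a' \<otimes> b [^] (m ^ j)"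
      using pow_mult_normal[OF A(1) BG[OF ab(2)] ab(1)] A(3) ab(2) B(2) by blast
    then have "x [^] (m ^ j) \<in> A" using j ab AG by simp
    then show "\<exists>j. x [^] (m ^ j) \<in> A" by blast
  qed
qed

lemma chernikov_in_bounded_primes:
  assumes "chernikov_in G H"
  shows "bounded_primes G H"
  using chernikov_inE[OF assms] bounded_primes_fin_index by metis

lemma chernikov_in_loc_fin:
  assumes "chernikov_in G H"
  shows "loc_fin G H"
proof -
  obtain D where D: "subgroup H G" "subgroup D G" "\<And>x y. x \<in> D \<Longrightarrow> y \<in> D \<Longrightarrow> x \<otimes> y = y \<otimes> x"
    "bounded_primes G D" "fin_index G D H"
    using chernikov_inE[OF assms] by metis
  have "loc_fin G D"
    using loc_fin_abelian_torsion[OF D(2,3)] bounded_primes_ord_pos[OF subgroup.subset[OF D(2)] D(4)] by blast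
  then show ?thesis using loc_fin_fin_index D by blast
qed

text \<open>In each of the finitely many cosets of \<open>D\<close>, two elements of \<open>S\<close> differ by a factor in \<open>D\<close>, which again has exponent \<open>k\<close>
because it commutes with one of them.\<close>

lemma finite_bounded_exponent_fin_index:
  assumes D: "subgroup D G" "finite {d \<in> D. d [^] k = \<one>}" and M: "M \<subseteq> carrier G" "fin_index G D M"
    and S: "S \<subseteq> M" "\<And>x. x \<in> S \<Longrightarrow> x [^] (k::nat) = \<one>"
    and comm: "\<And>x y. x \<in> S \<Longrightarrow> y \<in> S \<Longrightarrow> x \<otimes> inv y \<in> D \<Longrightarrow> (x \<otimes> inv y) \<otimes> y = y \<otimes> (x \<otimes> inv y)"
  shows "finite S"
proof -
  obtain \<phi> :: "'a \<Rightarrow> 'a" where \<phi>: "finite (\<phi> ` M)"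
    "\<And>x y. x \<in> M \<Longrightarrow> y \<in> M \<Longrightarrow> \<phi> x = \<phi> y \<Longrightarrow> x \<otimes> inv y \<in> D"
    using fin_index_map[OF D(1) M] by blast
  have SG: "x \<in> carrier G" if "x \<in> S" for x using that S(1) M(1) by blast
  have "finite (S \<inter> \<phi> -` {v})" for v
  proof (cases "S \<inter> \<phi> -` {v} = {}")
    case False
    then obtain y where y: "y \<in> S" "\<phi> y = v" by blast
    have "S \<inter> \<phi> -` {v} \<subseteq> (\<lambda>d. d \<otimes> y) ` {d \<in> D. d [^] k = \<one>}"
    proof
      fix x assume x: "x \<in> S \<inter> \<phi> -` {v}"
      define d where "d = x \<otimes> inv y"
      have "\<phi> x = \<phi> y" "x \<in> M" "y \<in> M" using x y S(1) by auto
      then have d: "d \<in> D" unfolding d_def by (intro \<phi>(2))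
      have G: "d \<in> carrier G" "y \<in> carrier G" unfolding d_def using x y SG by auto
      have xd: "x = d \<otimes> y" unfolding d_def using x y SG by (simp add: m_assoc)
      have "d \<otimes> y = y \<otimes> d" using comm[of x y] x y d unfolding d_def by blast
      then have "x [^] k = d [^] k \<otimes> y [^] k" unfolding xd by (rule pow_mult_distrib[OF _ G])
      then have "d [^] k = \<one>" using S(2)[of x] S(2)[OF y(1)] x G by simp
      then show "x \<in> (\<lambda>d. d \<otimes> y) ` {d \<in> D. d [^] k = \<one>}" using xd d by blast
    qed
    then show ?thesis using D(2) finite_surj by blast
  qed simp
  moreover have "finite (\<phi> ` S)" using finite_subset[OF image_mono[OF S(1)] \<phi>(1)] .
  moreover have "S = (\<Union>v\<in>\<phi> ` S. S \<inter> \<phi> -` {v})" by auto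
  ultimately show ?thesis by (metis (no_types, lifting) finite_UN)
qed

lemma chernikov_in_abelian_finite_torsion:
  assumes "chernikov_in G H" "subgroup B G" "B \<subseteq> H" "\<And>x y. x \<in> B \<Longrightarrow> y \<in> B \<Longrightarrow> x \<otimes> y = y \<otimes> x" "0 < (k::nat)"
  shows "finite {x \<in> B. x [^] k = \<one>}"
proof -
  obtain D where D: "subgroup H G" "subgroup D G" "fin_index G D H" "\<And>k::nat. 0 < k \<Longrightarrow> finite {x \<in> D. x [^] k = \<one>}"
    using chernikov_inE[OF assms(1)] by metis
  show ?thesis
  proof (rule finite_bounded_exponent_fin_index[OF D(2) D(4)[OF assms(5)] subgroup.subset[OF D(1)] D(3)])
    fix x y assume "x \<in> {x \<in> B. x [^] k = \<one>}" "y \<in> {x \<in> B. x [^] k = \<one>}"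
    then have "x \<otimes> inv y \<in> B" "y \<in> B"
      by (auto intro: subgroup.m_closed[OF assms(2)] subgroup.m_inv_closed[OF assms(2)])
    then show "(x \<otimes> inv y) \<otimes> y = y \<otimes> (x \<otimes> inv y)" by (rule assms(4))
  qed (use assms(3) in auto)
qed

text \<open>The divisible part of a Chernikov group is the set of all \<open>c\<close>-th powers, for every sufficiently divisible \<open>c\<close>: it contains these
powers because it has finite index, and consists of such powers because it is divisible. This makes its invariance under
automorphisms evident, and allows one exponent to be used for finitely many groups at once.\<close>

lemma chernikov_in_powers:
  assumes "chernikov_in G H"
  obtains c0 :: nat where "0 < c0"
    "\<And>c::nat. 0 < c \<Longrightarrow> c0 dvd c \<Longrightarrow> divisible_artinian G ((\<lambda>z. z [^] c) ` H) \<and>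
       (\<lambda>z. z [^] c) ` H \<subseteq> H \<and> fin_index G ((\<lambda>z. z [^] c) ` H) H"
proof -
  obtain D where D: "subgroup H G" "D \<subseteq> H" "subgroup D G" "divisible G D" "fin_index G D H" "divisible_artinian G D"
    using chernikov_inE[OF assms(1)] by metis
  obtain c0 :: nat where c0: "0 < c0" "\<And>x. x \<in> H \<Longrightarrow> x [^] c0 \<in> D"
    using fin_index_power[OF D(3,1,5)] by blast
  have "(\<lambda>z. z [^] c) ` H = D" if c: "0 < c" "c0 dvd c" for c :: nat
  proof
    obtain q where q: "c = c0 * q" using c by blast
    have "x [^] c \<in> D" if "x \<in> H" for x
      using subgroup_pow_closed[OF D(3) c0(2)[OF that]] subgroup.mem_carrier[OF D(1) that]
      by (simp add: q nat_pow_pow)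
    then show "(\<lambda>z. z [^] c) ` H \<subseteq> D" by blast
    show "D \<subseteq> (\<lambda>z. z [^] c) ` H"
    proof
      fix d assume "d \<in> D"
      then obtain e where "e \<in> D" "e [^] c = d" using D(4) c(1) unfolding divisible_def by blast
      then show "d \<in> (\<lambda>z. z [^] c) ` H" using D(2) by blast
    qed
  qed
  then show thesis using that[OF c0(1)] D by metis
qed

text \<open>Induction on the order of \<open>x\<close>. For a prime \<open>q\<close> dividing it, \<open>x\<^sup>q\<close> lies in \<open>A\<close>, hence equals \<open>a\<^sup>q\<close> with \<open>a \<in> A\<close>, and \<open>xa\<^sup>-\<^sup>1\<close> has order \<open>1\<close> or \<open>q\<close>.\<close>

lemma torsion_subset_divisible:
  assumes A: "subgroup A G" "A \<subseteq> B" "divisible G A"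
    and B: "subgroup B G" "\<And>x y. x \<in> B \<Longrightarrow> y \<in> B \<Longrightarrow> x \<otimes> y = y \<otimes> x" "\<And>x. x \<in> B \<Longrightarrow> 0 < ord x"
    and soc: "\<And>x. x \<in> B \<Longrightarrow> Factorial_Ring.prime (ord x) \<Longrightarrow> x \<in> A"
  shows "B \<subseteq> A"
proof -
  note BG = subgroup.mem_carrier[OF B(1)]
  have "x \<in> A" if "x \<in> B" for x
    using that
  proof (induction "ord x" arbitrary: x rule: less_induct)
    case less
    have xG: "x \<in> carrier G" using BG less.prems by blast
    show ?case
    proof (cases "ord x = 1")
      case True
      then have "x = \<one>" using xG ord_eq_1 by blast
      then show ?thesis using A(1) subgroup.one_closed by blast
    next
      case False
      then obtain q where q: "Factorial_Ring.prime q" "q dvd ord x" using prime_factor_nat by blast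
      have q0: "q \<noteq> 0" "1 < q" using q(1) prime_gt_1_nat[OF q(1)] by auto
      have "ord (x [^] q) = ord x div q" using ord_pow[OF xG q(2) q0(1)] .
      also have "\<dots> < ord x" using B(3)[OF less.prems] q0(2) by simp
      finally have "x [^] q \<in> A" using less.hyps subgroup_pow_closed[OF B(1) less.prems] by blast
      then obtain a where a: "a \<in> A" "a [^] q = x [^] q"
        using A(3) q0 unfolding divisible_def by (metis gr0I)
      have aB: "a \<in> B" "inv a \<in> B" using a A subgroup.m_inv_closed[OF A(1)] by blast+
      have aG: "a \<in> carrier G" using BG aB by blast
      have "x \<otimes> inv a = inv a \<otimes> x" using B(2) less.prems aB by blast
      then have "(x \<otimes> inv a) [^] q = \<one>"
        using xG aG a(2) by (simp add: pow_mult_distrib nat_pow_inv)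
      then have "ord (x \<otimes> inv a) dvd q" using xG aG by (simp add: pow_eq_id)
      then consider "ord (x \<otimes> inv a) = 1" | "ord (x \<otimes> inv a) = q"
        using q(1) unfolding prime_nat_iff by blast
      then have "x \<otimes> inv a \<in> A"
      proof cases
        case 1
        then have "x \<otimes> inv a = \<one>" using ord_eq_1[of "x \<otimes> inv a"] xG aG by simp
        then show ?thesis using subgroup.one_closed[OF A(1)] by simp
      next
        case 2
        then show ?thesis using soc[OF subgroup.m_closed[OF B(1) less.prems aB(2)]] q(1) by simp
      qed
      then have "x \<otimes> inv a \<otimes> a \<in> A" using a(1) subgroup.m_closed[OF A(1)] by blast
      then show ?thesis using xG aG by (simp add: m_assoc)
    qed
  qed
  then show ?thesis by blast
qed

text \<open>Centralisers are subgroups; this is applied first with \<open>S\<close> and then with the subgroup generated by \<open>S\<close>.\<close>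

lemma generate_abelian:
  assumes S: "S \<subseteq> carrier G" and comm: "\<And>x y. x \<in> S \<Longrightarrow> y \<in> S \<Longrightarrow> x \<otimes> y = y \<otimes> x"
    and x: "x \<in> generate G S" and y: "y \<in> generate G S"
  shows "x \<otimes> y = y \<otimes> x"
proof -
  have gS: "generate G S \<subseteq> carrier G" by (rule generate_incl[OF S])
  have "generate G S \<subseteq> {x \<in> carrier G. \<forall>y\<in>S. x \<otimes> y = y \<otimes> x}"
    using S comm by (intro generate_subgroup_incl centralizer_subgroup) auto
  then have "S \<subseteq> {x \<in> carrier G. \<forall>y\<in>generate G S. x \<otimes> y = y \<otimes> x}"
    using S by fastforce
  then have "generate G S \<subseteq> {x \<in> carrier G. \<forall>y\<in>generate G S. x \<otimes> y = y \<otimes> x}"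
    by (rule generate_subgroup_incl[OF _ centralizer_subgroup[OF gS]])
  then show ?thesis using x y by blast
qed

lemma abelian_pow_subgroup:
  assumes A: "subgroup A G" "\<And>x y. x \<in> A \<Longrightarrow> y \<in> A \<Longrightarrow> x \<otimes> y = y \<otimes> x"
  shows "subgroup ((\<lambda>x. x [^] (k::nat)) ` A) G"
proof (rule subgroupI)
  note AG = subgroup.mem_carrier[OF A(1)]
  show "(\<lambda>x. x [^] k) ` A \<subseteq> carrier G" using AG by auto
  show "(\<lambda>x. x [^] k) ` A \<noteq> {}" using subgroup.one_closed[OF A(1)] by blast
  show "inv a \<in> (\<lambda>x. x [^] k) ` A" if a: "a \<in> (\<lambda>x. x [^] k) ` A" for a
  proof -
    obtain x where "x \<in> A" "a = x [^] k" using a by blast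
    then have "inv a = (inv x) [^] k" "inv x \<in> A" using AG subgroup.m_inv_closed[OF A(1)] by (auto simp: nat_pow_inv)
    then show ?thesis by blast
  qed
  show "a \<otimes> b \<in> (\<lambda>x. x [^] k) ` A" if ab: "a \<in> (\<lambda>x. x [^] k) ` A" "b \<in> (\<lambda>x. x [^] k) ` A" for a b
  proof -
    obtain x y where "x \<in> A" "a = x [^] k" "y \<in> A" "b = y [^] k" using ab by blast
    then have "a \<otimes> b = (x \<otimes> y) [^] k" "x \<otimes> y \<in> A"
      using AG A(2) subgroup.m_closed[OF A(1)] by (auto simp: pow_mult_distrib)
    then show ?thesis by blast
  qed
qed

lemma abelian_bounded_primes_generate:
  assumes A: "A = generate G S" "S \<subseteq> carrier G" "\<And>x y. x \<in> A \<Longrightarrow> y \<in> A \<Longrightarrow> x \<otimes> y = y \<otimes> x"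
    and S: "bounded_primes G S"
  shows "bounded_primes G A"
proof -
  have sA: "subgroup A G" unfolding A(1) using A(2) by (rule generate_is_subgroup)
  note AG = subgroup.mem_carrier[OF sA]
  obtain n :: nat where n: "0 < n" "\<And>x. x \<in> S \<Longrightarrow> \<exists>j::nat. x [^] (n ^ j) = \<one>"
    using S unfolding bounded_primes_def by blast
  let ?B = "{x \<in> A. \<exists>j::nat. x [^] (n ^ j) = \<one>}"
  have "subgroup ?B G"
  proof (rule subgroupI)
    show "?B \<subseteq> carrier G" using AG by blast
    have "\<one> \<in> ?B" using subgroup.one_closed[OF sA] by simp
    then show "?B \<noteq> {}" by blast
  next
    fix a assume "a \<in> ?B"
    then show "inv a \<in> ?B" using AG subgroup.m_inv_closed[OF sA] by (auto simp: nat_pow_inv) 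
  next
    fix a b assume ab: "a \<in> ?B" "b \<in> ?B"
    then obtain i j :: nat where ij: "a [^] (n ^ i) = \<one>" "b [^] (n ^ j) = \<one>" by blast
    have G: "a \<in> carrier G" "b \<in> carrier G" using ab AG by auto
    have "ord a dvd n ^ (i + j)" "ord b dvd n ^ (i + j)"
      using ij G by (auto simp: pow_eq_id power_add)
    then have "a [^] (n ^ (i + j)) = \<one>" "b [^] (n ^ (i + j)) = \<one>" using G by (auto simp: pow_eq_id)
    then have "(a \<otimes> b) [^] (n ^ (i + j)) = \<one>" using ab G A(3)[of a b] by (simp add: pow_mult_distrib)
    then show "a \<otimes> b \<in> ?B" using ab subgroup.m_closed[OF sA] by blast
  qed
  moreover have "S \<subseteq> ?B" using n(2) unfolding A(1) by (auto intro: generate.incl)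
  ultimately have "A \<subseteq> ?B" unfolding A(1) using generate_subgroup_incl by blast
  then show ?thesis unfolding bounded_primes_def using n(1) by blast
qed

lemma divisible_generate:
  assumes A: "A = generate G S" "S \<subseteq> carrier G" "\<And>x y. x \<in> A \<Longrightarrow> y \<in> A \<Longrightarrow> x \<otimes> y = y \<otimes> x"
    and S: "divisible G S"
  shows "divisible G A"
  unfolding divisible_def
proof (intro allI impI)
  fix k :: nat assume k: "0 < k"
  have sA: "subgroup A G" unfolding A(1) using A(2) by (rule generate_is_subgroup)
  have "S \<subseteq> (\<lambda>x. x [^] k) ` A"
  proof
    fix s assume "s \<in> S"
    then obtain e where "e \<in> S" "e [^] k = s" using S k unfolding divisible_def by blast
    then show "s \<in> (\<lambda>x. x [^] k) ` A" unfolding A(1) by (blast intro: generate.incl)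
  qed
  then have "A \<subseteq> (\<lambda>x. x [^] k) ` A"
    using generate_subgroup_incl[OF _ abelian_pow_subgroup[OF sA A(3)]] unfolding A(1) by blast
  then show "\<forall>d\<in>A. \<exists>e\<in>A. e [^] k = d" by blast
qed

lemma generate_finite_support:
  assumes "S \<subseteq> carrier G" "x \<in> generate G S"
  obtains F where "finite F" "F \<subseteq> S" "x \<in> generate G F"
proof -
  have "\<exists>F. finite F \<and> F \<subseteq> S \<and> x \<in> generate G F"
    using assms(2)
  proof (induction x rule: generate.induct)
    case one
    show ?case by (rule exI[of _ "{}"]) (simp add: generate.one)
  next
    case (incl h)
    then show ?case by (intro exI[of _ "{h}"]) (simp add: generate.incl)
  next
    case (inv h)
    then show ?case by (intro exI[of _ "{h}"]) (simp add: generate.inv)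
  next
    case (eng h1 h2)
    then obtain F1 F2 where F: "finite F1" "F1 \<subseteq> S" "h1 \<in> generate G F1" "finite F2" "F2 \<subseteq> S" "h2 \<in> generate G F2"
      by blast
    have "h1 \<in> generate G (F1 \<union> F2)" "h2 \<in> generate G (F1 \<union> F2)"
      using F mono_generate[of F1 "F1 \<union> F2"] mono_generate[of F2 "F1 \<union> F2"] by blast+
    then show ?case using F by (intro exI[of _ "F1 \<union> F2"]) (simp add: generate.eng)
  qed
  then show thesis using that by blast
qed

lemma countable_generate:
  assumes "S \<subseteq> carrier G" "countable S" "loc_fin G (carrier G)"
  shows "countable (generate G S)"
proof -
  have "generate G S \<subseteq> (\<Union>F\<in>{F. F \<subseteq> S \<and> finite F}. generate G F)"
    using generate_finite_support[OF assms(1)] by blast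
  moreover have "countable (\<Union>F\<in>{F. F \<subseteq> S \<and> finite F}. generate G F)"
  proof (rule countable_UN)
    show "countable {F. F \<subseteq> S \<and> finite F}"
      using countable_Collect_finite_subset[OF assms(2)] by (simp add: conj_commute)
    fix F assume "F \<in> {F. F \<subseteq> S \<and> finite F}"
    then show "countable (generate G F)"
      using assms(1,3) unfolding loc_fin_def by (auto intro: countable_finite)
  qed
  ultimately show ?thesis using countable_subset by blast
qed

end

section \<open>Products of quasicyclic groups\<close>

abbreviation prufer_product :: "nat \<Rightarrow> (nat \<Rightarrow> nat) \<Rightarrow> (nat \<Rightarrow> complex) monoid" where
  "prufer_product k p \<equiv> product_group {..<k} (\<lambda>i. prufer_group (p i))"

text \<open>The primitive \<open>p\<^sup>n\<close>-th root of unity \<open>e\<^bsup>2\<pi>i/p\<^sup>n\<^esup>\<close>; each of these is the \<open>p\<close>-th power of the next one.\<close>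

definition prufer_root :: "nat \<Rightarrow> nat \<Rightarrow> complex" where
  "prufer_root p n = cis (2 * pi / real (p ^ n))"

lemma carrier_prufer_group: "z \<in> carrier (prufer_group p) \<longleftrightarrow> (\<exists>n. z ^ (p ^ n) = 1)"
  and mult_prufer_group [simp]: "z \<otimes>\<^bsub>prufer_group p\<^esub> w = z * w"
  and one_prufer_group [simp]: "\<one>\<^bsub>prufer_group p\<^esub> = 1"
  by (simp_all add: prufer_group_def)

lemma pow_prufer_product:
  "z \<in> carrier (prufer_product k p) \<Longrightarrow> z [^]\<^bsub>prufer_product k p\<^esub> (j::nat) = (\<lambda>i\<in>{..<k}. z i ^ j)"
  by (induction j) (auto simp: fun_eq_iff PiE_iff)

lemma prufer_root_eq_iff:
  assumes "0 < p"
  shows "prufer_root p n ^ a = prufer_root p n ^ b \<longleftrightarrow> a mod p ^ n = b mod p ^ n"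
proof -
  have n: "0 < p ^ n" using assms by simp
  have pow: "prufer_root p n ^ c = cis (2 * pi * real c / real (p ^ n))" for c
    by (simp add: prufer_root_def DeMoivre mult_ac)
  have one: "prufer_root p n ^ (p ^ n) = 1"
    unfolding pow using assms by simp
  have red: "prufer_root p n ^ c = prufer_root p n ^ (c mod p ^ n)" for c
  proof -
    have "prufer_root p n ^ c = prufer_root p n ^ (p ^ n * (c div p ^ n) + c mod p ^ n)" by simp
    also have "\<dots> = prufer_root p n ^ (c mod p ^ n)"
      unfolding power_add power_mult one by simp
    finally show ?thesis .
  qed
  have "inj_on (\<lambda>c. prufer_root p n ^ c) {..<p ^ n}"
    using bij_betw_roots_unity[OF n] unfolding bij_betw_def pow by simp
  then have "prufer_root p n ^ (a mod p ^ n) = prufer_root p n ^ (b mod p ^ n) \<longleftrightarrow> a mod p ^ n = b mod p ^ n"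
    by (rule inj_on_eq_iff) (use n in auto)
  then show ?thesis using red[of a] red[of b] by simp
qed

lemma prufer_root_0 [simp]: "prufer_root p 0 = 1"
  by (simp add: prufer_root_def)

lemma prufer_root_step:
  assumes "0 < p"
  shows "prufer_root p (n + m) ^ (p ^ m) = prufer_root p n"
  using assms by (simp add: prufer_root_def DeMoivre power_add)

lemma prufer_group_rootE:
  assumes "0 < p" "z \<in> carrier (prufer_group p)"
  obtains n a where "z = prufer_root p n ^ a"
proof -
  obtain n where n: "z ^ (p ^ n) = 1" using assms(2) unfolding carrier_prufer_group by blast
  have "0 < p ^ n" using assms(1) by simp
  from bij_betw_roots_unity[OF this] n obtain k where "z = cis (2 * pi * real k / real (p ^ n))"
    unfolding bij_betw_def by blast
  also have "\<dots> = prufer_root p n ^ k" by (simp add: prufer_root_def DeMoivre mult_ac)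
  finally show thesis by (rule that)
qed

lemma prufer_root_mem:
  assumes "0 < p"
  shows "prufer_root p n ^ a \<in> carrier (prufer_group p)"
proof -
  have "(prufer_root p n ^ a) ^ (p ^ n) = (prufer_root p n ^ (p ^ n)) ^ a"
    by (simp flip: power_mult add: mult.commute)
  also have "\<dots> = 1" using prufer_root_step[OF assms, of 0 n] by simp
  finally show ?thesis unfolding carrier_prufer_group by blast
qed

text \<open>Split \<open>k\<close> into a power \<open>p\<^sup>i\<close> and a factor \<open>r\<close> prime to \<open>p\<close>. A \<open>p\<^sup>i\<close>-th root is found \<open>i\<close> levels further up; raising to the \<open>r\<close>-th power is
invertible on a cyclic \<open>p\<close>-group.\<close>

lemma prufer_group_divisible:
  assumes p: "Factorial_Ring.prime p" and z: "z \<in> carrier (prufer_group p)" and k: "0 < k"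
  shows "\<exists>w\<in>carrier (prufer_group p). w ^ k = z"
proof -
  have p0: "0 < p" using p by (rule prime_gt_0_nat)
  obtain n a where na: "z = prufer_root p n ^ a" using prufer_group_rootE[OF p0 z] by blast
  have "\<not> is_unit p" using p not_prime_unit by blast
  with k obtain r where r: "k = p ^ multiplicity p k * r" "\<not> p dvd r"
    using multiplicity_decompose'[of k p] by (metis less_numeral_extra(3))
  define i where "i = multiplicity p k"
  have "coprime r (p ^ (n + i))"
    using prime_imp_coprime[OF p r(2)] by (simp add: coprime_commute)
  then obtain s t where st: "r * s = p ^ (n + i) * t + 1"
    using bezout_nat[of r "p ^ (n + i)"] r(1) k by (metis bot_nat_0.not_eq_extremum coprime_iff_gcd_eq_1 mult_0_right)
  define y where "y = prufer_root p (n + i) ^ a"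
  have y1: "y ^ (p ^ (n + i)) = 1"
  proof -
    have "y ^ (p ^ (n + i)) = (prufer_root p (0 + (n + i)) ^ (p ^ (n + i))) ^ a"
      unfolding y_def by (simp flip: power_mult add: mult.commute)
    then show ?thesis unfolding prufer_root_step[OF p0] by simp
  qed
  have yi: "y ^ (p ^ i) = z"
  proof -
    have "y ^ (p ^ i) = (prufer_root p (n + i) ^ (p ^ i)) ^ a"
      unfolding y_def by (simp flip: power_mult add: mult.commute)
    then show ?thesis unfolding prufer_root_step[OF p0] na .
  qed
  have k': "k = p ^ i * r" using r(1) unfolding i_def .
  have "(y ^ s) ^ k = (y ^ (r * s)) ^ (p ^ i)"
    by (subst k') (simp add: power_mult[symmetric] ac_simps)
  also have "y ^ (r * s) = y"
    unfolding st power_add[of y] power_mult[of y] y1 by simp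
  finally have "(y ^ s) ^ k = z" using yi by simp
  moreover have "y ^ s \<in> carrier (prufer_group p)"
    unfolding y_def power_mult[symmetric] by (rule prufer_root_mem[OF p0])
  ultimately show ?thesis by blast
qed

text \<open>The isomorphism carries powers to coordinatewise powers, so each clause reduces to complex roots of unity.\<close>

lemma (in group) divisible_artinian_if_prufer_product:
  assumes D: "subgroup D G" and p: "\<And>i. i < k \<Longrightarrow> Factorial_Ring.prime (p i)"
    and iso: "G\<lparr>carrier := D\<rparr> \<cong> prufer_product k p"
  shows "divisible_artinian G D"
proof -
  obtain h where h: "h \<in> iso (G\<lparr>carrier := D\<rparr>) (prufer_product k p)"
    using iso unfolding is_iso_def by blast
  then have bij: "bij_betw h D (carrier (prufer_product k p))"
    and hom: "\<And>x y. x \<in> D \<Longrightarrow> y \<in> D \<Longrightarrow> h (x \<otimes> y) = h x \<otimes>\<^bsub>prufer_product k p\<^esub> h y"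
    unfolding iso_def hom_def by auto
  note inj = inj_onD[OF bij_betw_imp_inj_on[OF bij]]
  have hD: "h x \<in> carrier (prufer_product k p)" if "x \<in> D" for x using bij that bij_betwE by metis
  note DG = subgroup.mem_carrier[OF D]
  have idem: "h \<one> = h \<one> \<otimes>\<^bsub>prufer_product k p\<^esub> h \<one>"
    using hom[of \<one> \<one>] subgroup.one_closed[OF D] by simp
  have h1i: "h \<one> i = 1" if "i < k" for i
  proof -
    have "h \<one> i \<in> carrier (prufer_group (p i))"
      using hD[OF subgroup.one_closed[OF D]] that by auto
    then have "h \<one> i \<noteq> 0" using prime_gt_0_nat[OF p[OF that]]
      by (auto simp: carrier_prufer_group power_0_left)
    moreover have "h \<one> i = h \<one> i * h \<one> i"
      by (subst idem) (use that in simp)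
    ultimately show ?thesis by simp
  qed
  have h1: "h \<one> = (\<lambda>i\<in>{..<k}. 1)"
    using hD[OF subgroup.one_closed[OF D]] h1i by (auto simp: PiE_iff extensional_def)
  have hpow: "h (x [^] (j::nat)) = (\<lambda>i\<in>{..<k}. h x i ^ j)" if x: "x \<in> D" for x j
  proof (induction j)
    case 0 then show ?case by (simp add: h1)
  next
    case (Suc j)
    have "h (x [^] Suc j) = h (x [^] j) \<otimes>\<^bsub>prufer_product k p\<^esub> h x"
      using hom[OF subgroup_pow_closed[OF D x] x] by simp
    then show ?case unfolding Suc by (auto simp: fun_eq_iff)
  qed
  have pow1: "x [^] (j::nat) = \<one> \<longleftrightarrow> (\<forall>i<k. h x i ^ j = 1)" if x: "x \<in> D" for x j
  proof
    assume "x [^] j = \<one>"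
    then have eq: "(\<lambda>i\<in>{..<k}. h x i ^ j) = (\<lambda>i\<in>{..<k}. 1)" using hpow[OF x, of j] h1 by simp
    show "\<forall>i<k. h x i ^ j = 1"
    proof (intro allI impI)
      fix i assume "i < k" then show "h x i ^ j = 1" using fun_cong[OF eq, of i] by simp
    qed
  next
    assume "\<forall>i<k. h x i ^ j = 1"
    then have "h (x [^] j) = h \<one>" unfolding hpow[OF x] h1 by (auto simp: fun_eq_iff)
    then show "x [^] j = \<one>" using inj subgroup_pow_closed[OF D x] subgroup.one_closed[OF D] by blast
  qed
  have comm: "x \<otimes> y = y \<otimes> x" if "x \<in> D" "y \<in> D" for x y
  proof (rule inj)
    show "h (x \<otimes> y) = h (y \<otimes> x)" using hom that by (simp add: mult.commute)
  qed (use that subgroup.m_closed[OF D] in auto)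
  have "divisible G D"
    unfolding divisible_def
  proof (intro allI impI ballI)
    fix j :: nat and d assume j: "0 < j" and d: "d \<in> D"
    have "\<forall>i\<in>{..<k}. \<exists>w. w \<in> carrier (prufer_group (p i)) \<and> w ^ j = h d i"
    proof
      fix i assume "i \<in> {..<k}"
      then have "h d i \<in> carrier (prufer_group (p i))" "Factorial_Ring.prime (p i)" using hD[OF d] p by auto
      then show "\<exists>w. w \<in> carrier (prufer_group (p i)) \<and> w ^ j = h d i"
        using prufer_group_divisible[OF _ _ j] by blast
    qed
    then obtain w where w: "\<And>i. i < k \<Longrightarrow> w i \<in> carrier (prufer_group (p i)) \<and> w i ^ j = h d i"
      by (metis lessThan_iff)
    have "restrict w {..<k} \<in> carrier (prufer_product k p)" using w by auto
    then obtain e where e: "e \<in> D" "h e = restrict w {..<k}"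
      using bij_betw_imp_surj_on[OF bij] by (metis imageE)
    have "h (e [^] j) = h d"
      unfolding hpow[OF e(1)] e(2) using w hD[OF d] by (auto simp: fun_eq_iff PiE_iff extensional_def)
    then have "e [^] j = d" using inj subgroup_pow_closed[OF D e(1)] d by blast
    then show "\<exists>e\<in>D. e [^] j = d" using e by blast
  qed
  moreover have "bounded_primes G D"
    unfolding bounded_primes_def
  proof (rule exI[of _ "\<Prod>i<k. p i"], intro conjI ballI)
    let ?n = "\<Prod>i<k. p i"
    show "0 < ?n" using p prime_gt_0_nat by (intro prod_pos) auto
    fix x assume x: "x \<in> D"
    have "\<forall>i\<in>{..<k}. \<exists>j. h x i ^ (p i ^ j) = 1"
      using hD[OF x] by (auto simp: PiE_iff carrier_prufer_group)
    then obtain j where j: "\<And>i. i < k \<Longrightarrow> h x i ^ (p i ^ j i) = 1" by (metis lessThan_iff)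
    have "h x i ^ (?n ^ (\<Sum>i<k. j i)) = 1" if i: "i < k" for i
    proof -
      have "p i dvd ?n" using i by (intro dvd_prodI) auto
      moreover have "j i \<le> (\<Sum>i<k. j i)" using i by (intro member_le_sum) auto
      ultimately have "p i ^ j i dvd ?n ^ (\<Sum>i<k. j i)"
        by (meson dvd_power_same le_imp_power_dvd dvd_trans)
      then obtain q where "?n ^ (\<Sum>i<k. j i) = p i ^ j i * q" ..
      then show ?thesis using j[OF i] by (simp add: power_mult)
    qed
    then show "\<exists>j. x [^] (?n ^ j) = \<one>" using pow1[OF x] by blast
  qed
  moreover have "finite {x \<in> D. x [^] j = \<one>}" if j: "0 < j" for j :: nat
  proof -
    have "h ` {x \<in> D. x [^] j = \<one>} \<subseteq> (\<Pi>\<^sub>E i\<in>{..<k}. {z. z ^ j = 1})"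
    proof (rule image_subsetI)
      fix x assume x: "x \<in> {x \<in> D. x [^] j = \<one>}"
      then have "h x \<in> extensional {..<k}" "\<forall>i<k. h x i ^ j = 1"
        using hD pow1 by (auto simp: PiE_iff)
      then show "h x \<in> (\<Pi>\<^sub>E i\<in>{..<k}. {z. z ^ j = 1})" by (simp add: PiE_iff)
    qed
    moreover have "finite (\<Pi>\<^sub>E i\<in>{..<k}. {z::complex. z ^ j = 1})"
      using j by (intro finite_PiE finite_roots_unity) auto
    ultimately have "finite (h ` {x \<in> D. x [^] j = \<one>})" by (rule finite_subset)
    moreover have "inj_on h {x \<in> D. x [^] j = \<one>}"
      by (rule inj_on_subset[OF bij_betw_imp_inj_on[OF bij]]) auto
    ultimately show ?thesis by (rule finite_imageD)
  qed
  ultimately show ?thesis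
    unfolding divisible_artinian_def using D comm by blast
qed

context group begin

text \<open>Divisibility yields a sequence \<open>s\<close> starting with \<open>1, e\<close> in which every entry is the \<open>p\<close>-th power of the next, and the homomorphism sends the root
of level \<open>n\<close> to \<open>s n\<close>. Two expressions of the same root of unity are compared after lifting them to a common level.\<close>

lemma prufer_embedding:
  assumes p: "Factorial_Ring.prime p" and e: "e \<in> carrier G" "e [^] p = \<one>"
    and div: "divisible G (carrier G)"
  obtains \<phi> s where "\<phi> \<in> hom (prufer_group p) G" "\<And>n. s n \<in> carrier G" "s (Suc 0) = e"
    "\<And>n m. s (n + m) [^] (p ^ m) = s n" "\<And>n a. \<phi> (prufer_root p n ^ a) = s n [^] a"
proof -
  have p0: "0 < p" using p by (rule prime_gt_0_nat)
  have "\<forall>d. \<exists>r. d \<in> carrier G \<longrightarrow> r \<in> carrier G \<and> r [^] p = d"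
    using div p0 unfolding divisible_def by blast
  then obtain r where r: "\<And>d. d \<in> carrier G \<Longrightarrow> r d \<in> carrier G \<and> r d [^] p = d" by metis
  define s where "s n = (case n of 0 \<Rightarrow> \<one> | Suc m \<Rightarrow> (r ^^ m) e)" for n
  have rm: "(r ^^ m) e \<in> carrier G" for m by (induction m) (use e r in auto)
  have sG: "s n \<in> carrier G" for n unfolding s_def using rm by (cases n) auto
  have s1: "s (Suc 0) = e" unfolding s_def by simp
  have sp: "s (Suc n) [^] p = s n" for n
    unfolding s_def using e(2) r rm by (cases n) auto
  have step: "s (n + m) [^] (p ^ m) = s n" for n m
  proof (induction m)
    case 0 then show ?case using sG by simp
  next
    case (Suc m)
    have "s (n + Suc m) [^] (p ^ Suc m) = (s (Suc (n + m)) [^] p) [^] (p ^ m)"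
      using sG by (simp add: nat_pow_pow)
    then show ?case using sp Suc by simp
  qed
  have red: "s n [^] a = s n [^] b" if "a mod p ^ n = b mod p ^ n" for n a b :: nat
  proof -
    have "s n [^] c = s n [^] (c mod p ^ n)" for c
    proof -
      have "s n [^] (p ^ n) = \<one>" using step[of 0 n] unfolding s_def by simp
      then have "s n [^] (p ^ n * (c div p ^ n)) = \<one>"
        using sG by (simp flip: nat_pow_pow)
      moreover have "s n [^] c = s n [^] (p ^ n * (c div p ^ n)) \<otimes> s n [^] (c mod p ^ n)"
        using sG by (simp add: nat_pow_mult)
      ultimately show ?thesis using sG by simp
    qed
    then show ?thesis using that by metis
  qed
  have lift_root: "prufer_root p n ^ a = prufer_root p (n + m) ^ (p ^ m * a)"
    and lift_s: "s n [^] a = s (n + m) [^] (p ^ m * a)" for n m a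
    using prufer_root_step[OF p0, of n m] step[of n m] sG by (simp_all add: power_mult flip: nat_pow_pow)
  have uniq: "s n [^] a = s m [^] b" if "prufer_root p n ^ a = prufer_root p m ^ b" for n a m b
  proof -
    have "prufer_root p (n + m) ^ (p ^ m * a) = prufer_root p (n + m) ^ (p ^ n * b)"
      using that lift_root[of n a m] lift_root[of m b n] by (simp add: add.commute)
    then have "s (n + m) [^] (p ^ m * a) = s (n + m) [^] (p ^ n * b)"
      using prufer_root_eq_iff[OF p0] red by blast
    then show ?thesis using lift_s[of n a m] lift_s[of m b n] by (simp add: add.commute)
  qed
  define \<phi> where "\<phi> z = (SOME y. \<exists>n a. z = prufer_root p n ^ a \<and> y = s n [^] a)" for z
  have \<phi>: "\<phi> (prufer_root p n ^ a) = s n [^] a" for n a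
    unfolding \<phi>_def
  proof (rule some_equality)
    show "\<exists>n' a'. prufer_root p n ^ a = prufer_root p n' ^ a' \<and> s n [^] a = s n' [^] a'" by blast
    fix y assume "\<exists>n' a'. prufer_root p n ^ a = prufer_root p n' ^ a' \<and> y = s n' [^] a'"
    then obtain n' a' where "prufer_root p n ^ a = prufer_root p n' ^ a'" "y = s n' [^] a'" by blast
    then show "y = s n [^] a" using uniq[of n a n' a'] by simp
  qed
  have "\<phi> \<in> hom (prufer_group p) G"
  proof (rule homI)
    fix z assume "z \<in> carrier (prufer_group p)"
    then obtain n a where "z = prufer_root p n ^ a" using prufer_group_rootE[OF p0] by blast
    then show "\<phi> z \<in> carrier G" using \<phi> sG by simp
  next
    fix z w assume "z \<in> carrier (prufer_group p)" "w \<in> carrier (prufer_group p)"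
    then obtain n a m b where zw: "z = prufer_root p n ^ a" "w = prufer_root p m ^ b"
      using prufer_group_rootE[OF p0] by metis
    have z: "z = prufer_root p (n + m) ^ (p ^ m * a)" using lift_root zw(1) by simp
    have w: "w = prufer_root p (n + m) ^ (p ^ n * b)" using lift_root[of m b n] zw(2) by (simp add: add.commute)
    have "z * w = prufer_root p (n + m) ^ (p ^ m * a + p ^ n * b)" unfolding z w by (simp add: power_add)
    then show "\<phi> (z \<otimes>\<^bsub>prufer_group p\<^esub> w) = \<phi> z \<otimes> \<phi> w"
      using \<phi> z w sG by (simp add: nat_pow_mult)
  qed
  then show thesis using that sG s1 step \<phi> by blast
qed

end

context comm_group begin

text \<open>One more quasicyclic factor, starting at \<open>e\<close>, is adjoined to an embedded product. Injectivity survives: a nontrivial element of the new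
factor has a power which is a generator of its subgroup of order \<open>q\<close>, so if it were mapped into the image of the old product, \<open>e\<close> would lie
there too.\<close>

lemma prufer_product_extend:
  assumes div: "divisible G (carrier G)"
    and pr: "\<And>i. i < k \<Longrightarrow> Factorial_Ring.prime (p i)"
    and hom: "\<Phi> \<in> hom (prufer_product k p) G" and inj: "inj_on \<Phi> (carrier (prufer_product k p))"
    and q: "Factorial_Ring.prime q" and e: "e \<in> carrier G" "e [^] q = \<one>" "e \<notin> \<Phi> ` carrier (prufer_product k p)"
  obtains \<Psi> where "\<Psi> \<in> hom (prufer_product (Suc k) (p(k := q))) G"
    "inj_on \<Psi> (carrier (prufer_product (Suc k) (p(k := q))))"
    "insert e (\<Phi> ` carrier (prufer_product k p)) \<subseteq> \<Psi> ` carrier (prufer_product (Suc k) (p(k := q)))"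
proof -
  let ?P = "prufer_product k p" and ?Q = "prufer_product (Suc k) (p(k := q))"
  have q0: "0 < q" using q by (rule prime_gt_0_nat)
  have grp: "group (prufer_group (p i))" if "i < k" for i
    using group_prufer_group prime_gt_0_nat[OF pr[OF that]] by blast
  have P: "group ?P" using grp by (intro product_group) auto
  have Q: "group ?Q" using grp group_prufer_group[OF q0] by (intro product_group) (auto simp: less_Suc_eq)
  interpret \<Phi>: group_hom ?P G \<Phi> using P hom is_group by (simp add: group_hom_def group_hom_axioms_def)
  define I where "I = \<Phi> ` carrier ?P"
  have I: "subgroup I G" unfolding I_def by (rule \<Phi>.img_is_subgroup)
  obtain \<phi> s where \<phi>: "\<phi> \<in> hom (prufer_group q) G" "\<And>n. s n \<in> carrier G" "s (Suc 0) = e"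
    "\<And>n m. s (n + m) [^] (q ^ m) = s n" "\<And>n a. \<phi> (prufer_root q n ^ a) = s n [^] a"
    using prufer_embedding[OF q e(1,2) div] by metis
  define \<Psi> where "\<Psi> z = \<Phi> (restrict z {..<k}) \<otimes> \<phi> (z k)" for z
  have mem: "restrict z {..<k} \<in> carrier ?P" "z k \<in> carrier (prufer_group q)" if "z \<in> carrier ?Q" for z
  proof -
    have z: "z i \<in> carrier (prufer_group ((p(k := q)) i))" if "i < Suc k" for i
      using PiE_mem[of z "{..<Suc k}" "\<lambda>i. carrier (prufer_group ((p(k := q)) i))" i]
        \<open>z \<in> carrier ?Q\<close> that
      unfolding carrier_product_group lessThan_iff by blast
    show "z k \<in> carrier (prufer_group q)" using z[of k] by simp
    have "z i \<in> carrier (prufer_group (p i))" if "i < k" for i using z[of i] that by simp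
    then show "restrict z {..<k} \<in> carrier ?P"
      unfolding carrier_product_group restrict_PiE_iff by simp
  qed
  have \<phi>G: "\<phi> z \<in> carrier G" if "z \<in> carrier (prufer_group q)" for z using \<phi>(1) that by (rule hom_in_carrier)
  have \<Psi>: "\<Psi> \<in> hom ?Q G"
  proof (rule homI)
    fix z assume z: "z \<in> carrier ?Q"
    then show "\<Psi> z \<in> carrier G" unfolding \<Psi>_def using mem[OF z] \<phi>G by (intro m_closed \<Phi>.hom_closed) auto
  next
    fix z w assume z: "z \<in> carrier ?Q" and w: "w \<in> carrier ?Q"
    have "restrict (z \<otimes>\<^bsub>?Q\<^esub> w) {..<k} = restrict z {..<k} \<otimes>\<^bsub>?P\<^esub> restrict w {..<k}"
      by (auto simp: fun_eq_iff)
    moreover have "(z \<otimes>\<^bsub>?Q\<^esub> w) k = z k \<otimes>\<^bsub>prufer_group q\<^esub> w k" by simp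
    ultimately have "\<Psi> (z \<otimes>\<^bsub>?Q\<^esub> w) = (\<Phi> (restrict z {..<k}) \<otimes> \<Phi> (restrict w {..<k})) \<otimes> (\<phi> (z k) \<otimes> \<phi> (w k))"
      unfolding \<Psi>_def using \<Phi>.hom_mult[OF mem(1)[OF z] mem(1)[OF w]] hom_mult[OF \<phi>(1) mem(2)[OF z] mem(2)[OF w]]
      by (simp only:)
    then show "\<Psi> (z \<otimes>\<^bsub>?Q\<^esub> w) = \<Psi> z \<otimes> \<Psi> w"
      unfolding \<Psi>_def
      using \<Phi>.hom_closed[OF mem(1)[OF z]] \<Phi>.hom_closed[OF mem(1)[OF w]] \<phi>G[OF mem(2)[OF z]] \<phi>G[OF mem(2)[OF w]]
      by (simp only: m_ac m_closed)
  qed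
  interpret \<Psi>: group_hom ?Q G \<Psi> using Q \<Psi> is_group by (simp add: group_hom_def group_hom_axioms_def)
  have \<phi>_inj: "z = 1" if z: "z \<in> carrier (prufer_group q)" "\<phi> z \<in> I" for z
  proof (rule ccontr)
    assume z1: "z \<noteq> 1"
    obtain n a where na: "z = prufer_root q n ^ a" using prufer_group_rootE[OF q0 z(1)] by blast
    have nd: "\<not> q ^ n dvd a"
      using z1 prufer_root_eq_iff[OF q0, of n a 0] unfolding na by (auto simp: dvd_eq_mod_eq_0)
    then have a0: "a \<noteq> 0" by (metis dvd_0_right)
    have "\<not> is_unit q" using q not_prime_unit by blast
    with a0 obtain b where b: "a = q ^ multiplicity q a * b" "\<not> q dvd b"
      using multiplicity_decompose'[of a q] by metis
    define i where "i = multiplicity q a"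
    have "i < n" using nd b(1) unfolding i_def by (metis dvd_triv_left le_imp_power_dvd dvd_trans linorder_not_le)
    then obtain j where j: "n = Suc 0 + (i + j)" by (metis add_Suc less_iff_Suc_add plus_nat.add_0)
    have "\<phi> z [^] (q ^ j) = s n [^] (q ^ (i + j) * b)"
      unfolding na \<phi>(5) using \<phi>(2) b(1) unfolding i_def[symmetric]
      by (simp add: nat_pow_pow power_add ac_simps)
    also have "\<dots> = (s n [^] (q ^ (i + j))) [^] b" using \<phi>(2) by (simp add: nat_pow_pow)
    also have "\<dots> = e [^] b" unfolding j \<phi>(4) \<phi>(3) ..
    finally have eb: "e [^] b \<in> I" using subgroup_pow_closed[OF I z(2)] by metis
    have "coprime b q" using prime_imp_coprime[OF q b(2)] by (simp add: coprime_commute)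
    moreover have "b \<noteq> 0" using b(2) by (metis dvd_0_right)
    ultimately obtain u v where "b * u = q * v + 1" using bezout_nat[of b q] by (metis coprime_iff_gcd_eq_1)
    then have "(e [^] b) [^] u = (e [^] q) [^] v \<otimes> e"
      using e(1) by (simp add: nat_pow_pow)
    then have "(e [^] b) [^] u = e" using e(1,2) by simp
    then show False using subgroup_pow_closed[OF I eb, of u] e(3) unfolding I_def by simp
  qed
  have "inj_on \<Psi> (carrier ?Q)"
    unfolding \<Psi>.inj_on_one_iff
  proof (intro allI impI)
    fix z assume z: "z \<in> carrier ?Q" "\<Psi> z = \<one>"
    have G: "\<Phi> (restrict z {..<k}) \<in> carrier G" "\<phi> (z k) \<in> carrier G"
      using \<Phi>.hom_closed[OF mem(1)[OF z(1)]] \<phi>G[OF mem(2)[OF z(1)]] by blast+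
    have "\<phi> (z k) = inv (\<Phi> (restrict z {..<k}))"
      using z(2) G unfolding \<Psi>_def by (metis inv_equality inv_inv)
    moreover have "\<Phi> (restrict z {..<k}) \<in> I" unfolding I_def using mem(1)[OF z(1)] by blast
    ultimately have "\<phi> (z k) \<in> I" using subgroup.m_inv_closed[OF I] by simp
    then have zk: "z k = 1" by (rule \<phi>_inj[OF mem(2)[OF z(1)]])
    then have "\<phi> (z k) = \<one>" using \<phi>(5)[of 0 0] by simp
    then have "\<Phi> (restrict z {..<k}) = \<one>" using z(2) G unfolding \<Psi>_def by simp
    then have rz: "restrict z {..<k} = \<one>\<^bsub>?P\<^esub>" using inj mem(1)[OF z(1)] unfolding \<Phi>.inj_on_one_iff by blast
    have "z i = 1" if "i < k" for i using that fun_cong[OF rz, of i] by simp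
    then show "z = \<one>\<^bsub>?Q\<^esub>" using z(1) zk by (auto simp: fun_eq_iff PiE_iff extensional_def less_Suc_eq)
  qed
  moreover have "insert e (\<Phi> ` carrier ?P) \<subseteq> \<Psi> ` carrier ?Q"
  proof -
    have "\<Phi> y \<in> \<Psi> ` carrier ?Q" if y: "y \<in> carrier ?P" for y
    proof -
      have "y(k := 1) \<in> carrier ?Q" using y by (auto simp: PiE_iff extensional_def less_Suc_eq carrier_prufer_group)
      moreover have "restrict (y(k := 1)) {..<k} = y"
        using y by (auto simp: PiE_iff extensional_def fun_eq_iff)
      then have "\<Psi> (y(k := 1)) = \<Phi> y"
        unfolding \<Psi>_def using \<phi>(5)[of 0 0] \<Phi>.hom_closed[OF y] by simp
      ultimately show ?thesis by (metis imageI)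
    qed
    moreover have "e \<in> \<Psi> ` carrier ?Q"
    proof -
      let ?y = "\<one>\<^bsub>?P\<^esub>(k := prufer_root q (Suc 0))"
      have "?y \<in> carrier ?Q"
        using prufer_root_mem[OF q0, of "Suc 0" 1] by (auto simp: PiE_iff extensional_def less_Suc_eq carrier_prufer_group)
      moreover have "restrict ?y {..<k} = \<one>\<^bsub>?P\<^esub>" by (auto simp: fun_eq_iff)
      then have "\<Psi> ?y = \<Phi> \<one>\<^bsub>?P\<^esub> \<otimes> \<phi> (prufer_root q (Suc 0))" unfolding \<Psi>_def by (simp only: fun_upd_same)
      then have "\<Psi> ?y = e"
        using \<phi>(5)[of "Suc 0" 1] \<phi>(3) e(1) \<Phi>.hom_one by simp
      ultimately show ?thesis by (metis imageI)
    qed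
    ultimately show ?thesis by blast
  qed
  ultimately show thesis using that \<Psi> by blast
qed

text \<open>Starting from the empty product, factors are adjoined as long as some element of prime order is missed. This ends because there are
finitely many such elements. The image is then a divisible subgroup containing all elements of prime order, hence everything.\<close>

lemma divisible_artinian_iso_prufer_product:
  assumes "divisible_artinian G (carrier G)"
  shows "\<exists>k p. (\<forall>i<k. Factorial_Ring.prime (p i)) \<and> G \<cong> prufer_product k p"
proof -
  have div: "divisible G (carrier G)" and bp: "bounded_primes G (carrier G)"
    using assms unfolding divisible_artinian_def by blast+
  have tors: "0 < ord x" if "x \<in> carrier G" for x using bounded_primes_ord_pos[OF subset_refl bp that] .
  define Soc where "Soc = {x \<in> carrier G. Factorial_Ring.prime (ord x)}"
  have "finite Soc" unfolding Soc_def by (rule divisible_artinian_finite_socle[OF assms])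
  define good where "good k p \<Phi> \<longleftrightarrow> (\<forall>i<k. Factorial_Ring.prime (p i)) \<and> \<Phi> \<in> hom (prufer_product k p) G \<and>
    inj_on \<Phi> (carrier (prufer_product k p))" for k p and \<Phi> :: "(nat \<Rightarrow> complex) \<Rightarrow> 'a"
  have ex: "\<exists>k p \<Psi>. good k p \<Psi> \<and> \<Psi> ` carrier (prufer_product k p) = carrier G" if "good k p \<Phi>" for k p \<Phi>
    using that
  proof (induction "card (Soc - \<Phi> ` carrier (prufer_product k p))" arbitrary: k p \<Phi> rule: less_induct)
    case less
    let ?P = "prufer_product k p"
    have pr: "\<And>i. i < k \<Longrightarrow> Factorial_Ring.prime (p i)" and hom: "\<Phi> \<in> hom ?P G" and inj: "inj_on \<Phi> (carrier ?P)"
      using less.prems unfolding good_def by auto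
    have P: "group ?P" using group_prufer_group prime_gt_0_nat[OF pr] by (intro product_group) auto
    interpret \<Phi>: group_hom ?P G \<Phi> using P hom is_group by (simp add: group_hom_def group_hom_axioms_def)
    have img: "subgroup (\<Phi> ` carrier ?P) G" by (rule \<Phi>.img_is_subgroup)
    show ?case
    proof (cases "Soc \<subseteq> \<Phi> ` carrier ?P")
      case True
      have "divisible G (\<Phi> ` carrier ?P)"
        unfolding divisible_def
      proof (intro allI impI ballI)
        fix j :: nat and d assume j: "0 < j" and "d \<in> \<Phi> ` carrier ?P"
        then obtain z where z: "z \<in> carrier ?P" "d = \<Phi> z" by blast
        have "\<forall>i\<in>{..<k}. \<exists>w. w \<in> carrier (prufer_group (p i)) \<and> w ^ j = z i"
        proof
          fix i assume "i \<in> {..<k}"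
          then have "z i \<in> carrier (prufer_group (p i))" "Factorial_Ring.prime (p i)" using z(1) pr by auto
          then show "\<exists>w. w \<in> carrier (prufer_group (p i)) \<and> w ^ j = z i"
            using prufer_group_divisible[OF _ _ j] by blast
        qed
        then obtain w where w: "\<And>i. i < k \<Longrightarrow> w i \<in> carrier (prufer_group (p i)) \<and> w i ^ j = z i"
          by (metis lessThan_iff)
        have wP: "restrict w {..<k} \<in> carrier ?P" using w by auto
        have "restrict w {..<k} [^]\<^bsub>?P\<^esub> j = z"
          unfolding pow_prufer_product[OF wP] using w z(1) by (auto simp: fun_eq_iff PiE_iff extensional_def)
        then have "\<Phi> (restrict w {..<k}) [^] j = d"
          using \<Phi>.hom_nat_pow[OF wP, of j] z(2) by simp
        then show "\<exists>e\<in>\<Phi> ` carrier ?P. e [^] j = d" using wP by blast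
      qed
      then have "carrier G \<subseteq> \<Phi> ` carrier ?P"
        using torsion_subset_divisible[OF img _ _ subgroup_self _ tors] True m_comm subgroup.subset[OF img]
        unfolding Soc_def by blast
      then show ?thesis using less.prems subgroup.subset[OF img] by blast
    next
      case False
      then obtain e where e: "e \<in> carrier G" "Factorial_Ring.prime (ord e)" "e \<notin> \<Phi> ` carrier ?P"
        unfolding Soc_def by blast
      obtain \<Psi> where \<Psi>: "\<Psi> \<in> hom (prufer_product (Suc k) (p(k := ord e))) G"
        "inj_on \<Psi> (carrier (prufer_product (Suc k) (p(k := ord e))))"
        "insert e (\<Phi> ` carrier ?P) \<subseteq> \<Psi> ` carrier (prufer_product (Suc k) (p(k := ord e)))"
        using prufer_product_extend[OF div pr hom inj e(2,1) pow_ord_eq_1[OF e(1)] e(3)] by metis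
      have "good (Suc k) (p(k := ord e)) \<Psi>"
        unfolding good_def using \<Psi>(1,2) pr e(2) by (auto simp: less_Suc_eq)
      moreover have "Soc - \<Psi> ` carrier (prufer_product (Suc k) (p(k := ord e))) \<subset> Soc - \<Phi> ` carrier ?P"
        using \<Psi>(3) e unfolding Soc_def by blast
      then have "card (Soc - \<Psi> ` carrier (prufer_product (Suc k) (p(k := ord e)))) < card (Soc - \<Phi> ` carrier ?P)"
        using \<open>finite Soc\<close> by (intro psubset_card_mono) auto
      ultimately show ?thesis using less.hyps by blast
    qed
  qed
  \<comment> \<open>The empty product; the value \<open>2\<close> is arbitrary.\<close>
  have "good 0 (\<lambda>_. 2) (\<lambda>_. \<one>)"
    unfolding good_def by (auto intro!: homI)
  then obtain k p \<Psi> where \<Psi>: "good k p \<Psi>" "\<Psi> ` carrier (prufer_product k p) = carrier G" using ex by blast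
  then have "\<Psi> \<in> iso (prufer_product k p) G"
    unfolding good_def iso_def bij_betw_def by blast
  moreover have "group (prufer_product k p)"
    using \<Psi>(1) group_prufer_group prime_gt_0_nat unfolding good_def by (intro product_group) auto
  ultimately have "G \<cong> prufer_product k p"
    using group.iso_sym is_isoI by blast
  then show ?thesis using \<Psi>(1) unfolding good_def by blast
qed

end

section \<open>CL-subgroups of a group\<close>

text \<open>The CL-property of a subgroup. The \<open>\<infinity>\<close>-layer contributes that there are no elements of infinite order, since Chernikov groups are periodic; the
value \<open>0\<close> of \<open>ord\<close> stands for infinite order.\<close>

definition CL_in :: "('a, 'b) monoid_scheme \<Rightarrow> 'a set \<Rightarrow> bool" where
  "CL_in G H \<longleftrightarrow> (\<forall>x\<in>H. 0 < group.ord G x) \<and>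
     (\<forall>m>0. chernikov_in G (generate G {x \<in> H. group.ord G x = m}))"

context group begin

lemma fin_index_consistent:
  assumes "subgroup H G" "L \<subseteq> H"
  shows "fin_index (G\<lparr>carrier := H\<rparr>) K L \<longleftrightarrow> fin_index G K L"
proof -
  have "x \<otimes>\<^bsub>G\<lparr>carrier := H\<rparr>\<^esub> inv\<^bsub>G\<lparr>carrier := H\<rparr>\<^esub> t = x \<otimes> inv t" if "t \<in> L" for x t
    using m_inv_consistent[OF assms(1)] that assms(2) by auto
  then show ?thesis unfolding fin_index_def by (metis subsetD)
qed

lemma divisible_artinian_consistent:
  assumes "divisible_artinian G D"
  shows "divisible_artinian (G\<lparr>carrier := D\<rparr>) D"
proof -
  have D: "subgroup D G" using assms unfolding divisible_artinian_def by blast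
  have "subgroup D (G\<lparr>carrier := D\<rparr>)"
    using subgroup_incl[OF D D] by simp
  then show ?thesis
    using assms unfolding divisible_artinian_def divisible_def bounded_primes_def
    by (simp add: nat_pow_consistent[symmetric])
qed

lemma conj_pow:
  assumes "x \<in> carrier G" "z \<in> carrier G"
  shows "(x \<otimes> z \<otimes> inv x) [^] (c::nat) = x \<otimes> z [^] c \<otimes> inv x"
  by (induction c) (use assms in \<open>simp_all add: m_assoc\<close>)

lemma ord_conj:
  assumes "x \<in> carrier G" "z \<in> carrier G"
  shows "ord (x \<otimes> z \<otimes> inv x) = ord z"
proof -
  have "(x \<otimes> z \<otimes> inv x) [^] c = \<one> \<longleftrightarrow> z [^] c = \<one>" for c :: nat
  proof -
    have "x \<otimes> z [^] c \<otimes> inv x = \<one> \<longleftrightarrow> x \<otimes> z [^] c = x" using assms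
      by (metis inv_closed inv_solve_right' l_one m_closed nat_pow_closed one_closed)
    then show ?thesis using conj_pow[OF assms] assms by simp
  qed
  then show ?thesis using ord_unique[of "x \<otimes> z \<otimes> inv x" "ord z"] assms by (simp add: pow_eq_id)
qed

lemma chernikov_group_iff:
  assumes H: "subgroup H G"
  shows "chernikov_group (G\<lparr>carrier := H\<rparr>) \<longleftrightarrow> chernikov_in G H"
proof
  let ?A = "G\<lparr>carrier := H\<rparr>"
  have A: "group ?A" by (rule subgroup_imp_group[OF H])
  {
    assume "chernikov_group ?A"
    then obtain N and k :: nat and p :: "nat \<Rightarrow> nat" where N: "N \<lhd> ?A" "finite (carrier (?A Mod N))"
      "\<forall>i<k. Factorial_Ring.prime (p i)" "?A\<lparr>carrier := N\<rparr> \<cong> prufer_product k p"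
      unfolding chernikov_group_def by blast
    have NA: "subgroup N ?A" using N(1) normal_imp_subgroup by blast
    have NG: "subgroup N G" using incl_subgroup[OF H NA] .
    have NH: "N \<subseteq> H" using subgroup.subset[OF NA] by simp
    have "divisible_artinian G N"
      by (rule divisible_artinian_if_prufer_product[OF NG]) (use N(3,4) in auto)
    moreover have "fin_index ?A N (carrier ?A)"
      using group.fin_index_iff_rcosets[OF A NA] N(2) unfolding FactGroup_def by simp
    then have "fin_index G N H" using fin_index_consistent[OF H subset_refl] by simp
    ultimately show "chernikov_in G H" unfolding chernikov_in_def using H NH by blast
  next
    assume "chernikov_in G H"
    then obtain c :: nat where "0 < c"
      and "\<And>d::nat. 0 < d \<Longrightarrow> c dvd d \<Longrightarrow> divisible_artinian G ((\<lambda>z. z [^] d) ` H) \<and>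
        (\<lambda>z. z [^] d) ` H \<subseteq> H \<and> fin_index G ((\<lambda>z. z [^] d) ` H) H"
      using chernikov_in_powers by metis
    moreover define D where "D = (\<lambda>z. z [^] c) ` H"
    ultimately have D: "divisible_artinian G D" "D \<subseteq> H" "fin_index G D H" by auto
    have DG: "subgroup D G" using D(1) unfolding divisible_artinian_def by blast
    have DA: "subgroup D ?A" using subgroup_incl[OF DG H D(2)] .
    have "D \<lhd> ?A"
    proof (rule group.normal_invI[OF A DA])
      fix x d assume x: "x \<in> carrier ?A" and "d \<in> D"
      then obtain z where z: "z \<in> H" "d = z [^] c" unfolding D_def by blast
      have xH: "x \<in> H" using x by simp
      have G: "x \<in> carrier G" "z \<in> carrier G" using xH z(1) subgroup.mem_carrier[OF H] by blast+
      have "x \<otimes> z \<otimes> inv x \<in> H"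
        using xH z(1) H by (simp add: subgroup.m_closed subgroup.m_inv_closed)
      then have "x \<otimes> d \<otimes> inv x \<in> D" unfolding D_def z(2) conj_pow[OF G, symmetric] by blast
      then show "x \<otimes>\<^bsub>?A\<^esub> d \<otimes>\<^bsub>?A\<^esub> inv\<^bsub>?A\<^esub> x \<in> D" using m_inv_consistent[OF H xH] by simp
    qed
    moreover have "finite (carrier (?A Mod D))"
      using group.fin_index_iff_rcosets[OF A DA] fin_index_consistent[OF H subset_refl] D(3)
      unfolding FactGroup_def by simp
    moreover have "comm_group (G\<lparr>carrier := D\<rparr>)"
      using group.group_comm_groupI[OF subgroup_imp_group[OF DG]] D(1)
      unfolding divisible_artinian_def by simp
    then have "\<exists>k p. (\<forall>i<k. Factorial_Ring.prime (p i)) \<and> G\<lparr>carrier := D\<rparr> \<cong> prufer_product k p"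
      by (rule comm_group.divisible_artinian_iso_prufer_product)
        (use divisible_artinian_consistent[OF D(1)] in simp)
    ultimately show "chernikov_group ?A" unfolding chernikov_group_def using A by auto
  }
qed

lemma ord_consistent:
  assumes "subgroup H G"
  shows "group.ord (G\<lparr>carrier := H\<rparr>) x = ord x"
  unfolding group.ord_def[OF subgroup_imp_group[OF assms]] ord_def
  by (simp add: nat_pow_consistent[symmetric])

lemma CL_group_iff:
  assumes H: "subgroup H G"
  shows "CL_group (G\<lparr>carrier := H\<rparr>) \<longleftrightarrow> CL_in G H"
proof -
  let ?A = "G\<lparr>carrier := H\<rparr>"
  have A: "group ?A" by (rule subgroup_imp_group[OF H])
  have HG: "H \<subseteq> carrier G" by (rule subgroup.subset[OF H])
  define L where "L m = generate G {x \<in> H. ord x = m}" for m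
  have LG: "subgroup (L m) G" for m unfolding L_def using HG by (intro generate_is_subgroup) auto
  have "layer ?A m = generate G {x \<in> H. elem_order ?A x = m}" for m
    unfolding layer_def using generate_consistent[OF _ H] by simp
  then have layer: "layer ?A m = generate G {x \<in> H. (if ord x = 0 then \<infinity> else enat (ord x)) = m}" for m
    unfolding elem_order_def ord_consistent[OF H] .
  have fin: "layer ?A (enat m) = L m" if "0 < m" for m
  proof -
    have "{x \<in> H. (if ord x = 0 then \<infinity> else enat (ord x)) = enat m} = {x \<in> H. ord x = m}"
      using that by auto
    then show ?thesis unfolding layer L_def by simp
  qed
  have inf: "layer ?A \<infinity> = L 0"
  proof -
    have "{x \<in> H. (if ord x = 0 then \<infinity> else enat (ord x)) = \<infinity>} = {x \<in> H. ord x = 0}"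
      by (auto split: if_splits)
    then show ?thesis unfolding layer L_def by simp
  qed
  have "CL_group ?A \<longleftrightarrow> (\<forall>m. chernikov_in G (L m))"
  proof -
    have "CL_group ?A \<longleftrightarrow> (\<forall>m. m \<noteq> 0 \<longrightarrow> chernikov_group (G\<lparr>carrier := layer ?A m\<rparr>))"
      unfolding CL_group_def using A by simp
    also have "\<dots> \<longleftrightarrow> (\<forall>m. chernikov_group (G\<lparr>carrier := L m\<rparr>))"
    proof safe
      fix m assume *: "\<forall>m. m \<noteq> 0 \<longrightarrow> chernikov_group (G\<lparr>carrier := layer ?A m\<rparr>)"
      show "chernikov_group (G\<lparr>carrier := L m\<rparr>)"
      proof (cases "m = 0")
        case True
        then show ?thesis using *[rule_format, of \<infinity>] inf by simp
      next
        case False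
        then show ?thesis using *[rule_format, of "enat m"] fin[of m] by (simp add: zero_enat_def)
      qed
    next
      fix m :: enat assume *: "\<forall>m. chernikov_group (G\<lparr>carrier := L m\<rparr>)" and m: "m \<noteq> 0"
      then show "chernikov_group (G\<lparr>carrier := layer ?A m\<rparr>)"
        using fin inf by (cases m) (auto simp: zero_enat_def)
    qed
    finally show ?thesis using chernikov_group_iff[OF LG] by simp
  qed
  also have "\<dots> \<longleftrightarrow> CL_in G H"
  proof
    assume *: "\<forall>m. chernikov_in G (L m)"
    have "0 < ord x" if x: "x \<in> H" for x
    proof (rule ccontr)
      assume "\<not> 0 < ord x"
      then have "x \<in> L 0" using x unfolding L_def by (intro generate.incl) simp
      then show False
        using bounded_primes_ord_pos[OF subgroup.subset[OF LG] chernikov_in_bounded_primes[OF *[rule_format]]]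
          \<open>\<not> 0 < ord x\<close> by metis
    qed
    then show "CL_in G H" using * unfolding CL_in_def L_def by blast
  next
    assume *: "CL_in G H"
    have "chernikov_in G (L m)" for m
    proof (cases "m = 0")
      case True
      have none: "{x \<in> H. ord x = 0} = {}" using * unfolding CL_in_def by auto
      have "L 0 = {\<one>}" unfolding L_def none by (rule generate_empty)
      then show ?thesis using True chernikov_in_finite[OF triv_subgroup] by simp
    next
      case False
      then show ?thesis using * unfolding CL_in_def L_def by blast
    qed
    then show "\<forall>m. chernikov_in G (L m)" by blast
  qed
  finally show ?thesis .
qed

lemma conj_generate:
  assumes S: "S \<subseteq> carrier G" and h: "h \<in> carrier G"
    and S': "\<And>s. s \<in> S \<Longrightarrow> h \<otimes> s \<otimes> inv h \<in> S'"
    and v: "v \<in> generate G S"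
  shows "h \<otimes> v \<otimes> inv h \<in> generate G S'"
  using v
proof (induction v rule: generate.induct)
  case one
  then show ?case using h by (simp add: generate.one)
next
  case (incl s)
  then show ?case using S' by (simp add: generate.incl)
next
  case (inv s)
  then have "inv (h \<otimes> s \<otimes> inv h) \<in> generate G S'" using S' by (intro generate.inv)
  then show ?case using inv S h by (simp add: inv_mult_group m_assoc subset_iff)
next
  case (eng a b)
  then have "a \<in> carrier G" "b \<in> carrier G" using generate_in_carrier[OF S] by blast+
  then have "h \<otimes> (a \<otimes> b) \<otimes> inv h = (h \<otimes> a \<otimes> inv h) \<otimes> (h \<otimes> b \<otimes> inv h)"
    using h by (simp add: m_assoc)
  then show ?case using eng by (simp add: generate.eng)
qed

lemma normal_in_generate:
  assumes H: "subgroup H G" and S: "S \<subseteq> H" "\<And>h s. h \<in> H \<Longrightarrow> s \<in> S \<Longrightarrow> h \<otimes> s \<otimes> inv h \<in> S"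
  shows "normal_in G (generate G S) H"
proof -
  have HG: "H \<subseteq> carrier G" by (rule subgroup.subset[OF H])
  then have SG: "S \<subseteq> carrier G" using S(1) by blast
  have "h \<otimes> v \<otimes> inv h \<in> generate G S" if "h \<in> H" "v \<in> generate G S" for h v
    using conj_generate[OF SG _ S(2)] that HG by blast
  then show ?thesis
    unfolding normal_in_def using generate_is_subgroup[OF SG] generate_subgroup_incl[OF S(1) H] by blast
qed

lemma normal_in_layer:
  assumes H: "subgroup H G"
  shows "normal_in G (generate G {x \<in> H. ord x = m}) H"
proof (rule normal_in_generate[OF H])
  fix h s assume hs: "h \<in> H" "s \<in> {x \<in> H. ord x = m}"
  then have "h \<otimes> s \<otimes> inv h \<in> H" using H by (simp add: subgroup.m_closed subgroup.m_inv_closed)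
  then show "h \<otimes> s \<otimes> inv h \<in> {x \<in> H. ord x = m}"
    using hs ord_conj subgroup.mem_carrier[OF H] by auto
qed auto

text \<open>A subgroup generated by elements of order \<open>m\<close> is its own \<open>m\<close>-layer.\<close>

lemma generate_order_idem:
  assumes Z: "Z \<subseteq> {x \<in> carrier G. ord x = m}"
  shows "generate G {x \<in> generate G Z. ord x = m} = generate G Z"
proof
  have "subgroup (generate G Z) G" using Z by (intro generate_is_subgroup) auto
  then show "generate G {x \<in> generate G Z. ord x = m} \<subseteq> generate G Z"
    by (rule generate_subgroup_incl[rotated]) auto
  show "generate G Z \<subseteq> generate G {x \<in> generate G Z. ord x = m}"
    by (rule mono_generate) (use Z in \<open>auto intro: generate.incl\<close>)
qed

text \<open>Each element of order \<open>k\<close> lies in the \<open>k\<close>-layer, which is normal and, being Chernikov, locally finite.\<close>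

lemma CL_in_loc_fin:
  assumes H: "subgroup H G" and CL: "CL_in G H"
  shows "loc_fin G H"
proof (rule loc_fin_if_normal_cover[OF H])
  fix x assume x: "x \<in> H"
  have "chernikov_in G (generate G {y \<in> H. ord y = ord x})" using CL x unfolding CL_in_def by blast
  then have "loc_fin G (generate G {y \<in> H. ord y = ord x})" by (rule chernikov_in_loc_fin)
  moreover have "x \<in> generate G {y \<in> H. ord y = ord x}" using x by (intro generate.incl) simp
  ultimately show "\<exists>U. normal_in G U H \<and> loc_fin G U \<and> x \<in> U"
    using normal_in_layer[OF H] by blast
qed

text \<open>A finite set that generates a proper subgroup lies in a CL-group. If it generates \<open>G\<close>, local gradedness provides a proper
subgroup of finite index; this is a CL-group, so it is locally finite, and \<open>G\<close> inherits that by Schreier's lemma.\<close>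

lemma locally_graded_proper_CL_loc_fin:
  assumes lg: "locally_graded G"
    and CL: "\<And>H. subgroup H G \<Longrightarrow> H \<noteq> carrier G \<Longrightarrow> CL_in G H"
  shows "loc_fin G (carrier G)"
  unfolding loc_fin_def
proof (intro allI impI)
  fix S assume S: "finite S \<and> S \<subseteq> carrier G"
  have Q: "subgroup (generate G S) G" using S by (intro generate_is_subgroup) simp
  have SQ: "S \<subseteq> generate G S" by (auto intro: generate.incl)
  show "finite (generate G S)"
  proof (cases "generate G S = carrier G")
    case False
    then have "loc_fin G (generate G S)" using CL_in_loc_fin[OF Q] CL[OF Q] by blast
    then show ?thesis using S SQ unfolding loc_fin_def by blast
  next
    case gen: True
    show ?thesis
    proof (cases "generate G S = {\<one>}")
      case False
      have "\<exists>K. subgroup K (G\<lparr>carrier := generate G S\<rparr>) \<and> K \<noteq> generate G S \<and>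
          finite (rcosets\<^bsub>G\<lparr>carrier := generate G S\<rparr>\<^esub> K)"
        using lg S False unfolding locally_graded_def by blast
      then obtain K where K: "subgroup K G" "K \<noteq> carrier G" "finite (rcosets K)"
        unfolding gen by auto
      have "loc_fin G K" using CL_in_loc_fin[OF K(1)] CL[OF K(1,2)] by blast
      moreover have "fin_index G K (carrier G)" using fin_index_iff_rcosets[OF K(1)] K(3) by blast
      ultimately have "loc_fin G (carrier G)" using loc_fin_fin_index[OF K(1) subgroup_self] by blast
      then show ?thesis using S unfolding loc_fin_def by blast
    qed simp
  qed
qed

lemma loc_fin_ord_pos:
  assumes "loc_fin G (carrier G)" "x \<in> carrier G"
  shows "0 < ord x"
proof -
  let ?A = "generate G {x}"
  have A: "subgroup ?A G" using assms(2) by (intro generate_is_subgroup) simp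
  have fin: "finite ?A" using assms unfolding loc_fin_def by simp
  have "x \<in> ?A" by (simp add: generate.incl)
  then have "1 \<le> group.ord (G\<lparr>carrier := ?A\<rparr>) x"
    using group.ord_ge_1[OF subgroup_imp_group[OF A], of x] fin by simp
  then show ?thesis unfolding ord_consistent[OF A] by simp
qed

end

section \<open>Locally finite MNCL-groups\<close>

text \<open>What remains of the hypotheses once local finiteness is known and a layer that is not Chernikov has been chosen.\<close>

locale loc_fin_MNCL = group G for G (structure) +
  fixes m :: nat
  assumes m_pos: "0 < m"
    and loc_fin: "loc_fin G (carrier G)"
    and proper_CL: "\<And>H. subgroup H G \<Longrightarrow> H \<noteq> carrier G \<Longrightarrow> CL_in G H"
    and layer_generates: "generate G {x \<in> carrier G. ord x = m} = carrier G"
    and not_chernikov: "\<not> chernikov_in G (carrier G)"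
begin

abbreviation order_m where "order_m \<equiv> {x \<in> carrier G. ord x = m}"

text \<open>The dichotomy that drives the proof: elements of order \<open>m\<close> generate a Chernikov group or everything.\<close>

lemma chernikov_in_generate:
  assumes Z: "Z \<subseteq> order_m" and ne: "generate G Z \<noteq> carrier G"
  shows "chernikov_in G (generate G Z)"
proof -
  have H: "subgroup (generate G Z) G" using Z by (intro generate_is_subgroup) auto
  have "chernikov_in G (generate G {x \<in> generate G Z. ord x = m})"
    using proper_CL[OF H ne] m_pos unfolding CL_in_def by blast
  then show ?thesis unfolding generate_order_idem[OF Z] .
qed

lemma ord_pos: "x \<in> carrier G \<Longrightarrow> 0 < ord x"
  by (rule loc_fin_ord_pos[OF loc_fin])

end

lemma (in group) loc_fin_MNCL_exists:
  assumes lf: "loc_fin G (carrier G)" and notCL: "\<not> CL_in G (carrier G)"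
    and CL: "\<And>H. subgroup H G \<Longrightarrow> H \<noteq> carrier G \<Longrightarrow> CL_in G H"
  obtains m where "loc_fin_MNCL G m"
proof -
  obtain m where m: "0 < m" "\<not> chernikov_in G (generate G {x \<in> carrier G. ord x = m})"
    using notCL loc_fin_ord_pos[OF lf] unfolding CL_in_def by blast
  let ?H = "generate G {x \<in> carrier G. ord x = m}"
  have H: "subgroup ?H G" by (intro generate_is_subgroup) auto
  have "?H = carrier G"
  proof (rule ccontr)
    assume ne: "?H \<noteq> carrier G"
    have "chernikov_in G (generate G {x \<in> ?H. ord x = m})"
      using CL[OF H ne] m(1) unfolding CL_in_def by blast
    then show False using m(2) unfolding generate_order_idem[OF subset_refl] by blast
  qed
  then have "loc_fin_MNCL G m"
    using m lf CL by unfold_locales auto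
  then show thesis by (rule that)
qed

context group begin

section \<open>Finite quotients are cyclic\<close>

lemma bounded_primes_UN:
  assumes "finite T" "\<And>t. t \<in> T \<Longrightarrow> bounded_primes G (E t)" "\<And>t. t \<in> T \<Longrightarrow> E t \<subseteq> carrier G"
  shows "bounded_primes G (\<Union>t\<in>T. E t)"
  using assms
proof (induction T rule: finite_induct)
  case empty
  show ?case unfolding bounded_primes_def by (auto intro: exI[of _ 1])
next
  case (insert t T)
  obtain a :: nat where a: "0 < a" "\<And>x. x \<in> E t \<Longrightarrow> \<exists>j::nat. x [^] (a ^ j) = \<one>"
    using insert.prems(1)[of t] unfolding bounded_primes_def by blast
  have "bounded_primes G (\<Union>t\<in>T. E t)" using insert.IH insert.prems by simp
  then obtain b :: nat where b: "0 < b" "\<And>x. x \<in> (\<Union>t\<in>T. E t) \<Longrightarrow> \<exists>j::nat. x [^] (b ^ j) = \<one>"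
    unfolding bounded_primes_def by blast
  have "\<exists>j::nat. x [^] ((a * b) ^ j) = \<one>" if x: "x \<in> (\<Union>t\<in>insert t T. E t)" for x
  proof -
    have xG: "x \<in> carrier G" using x insert.prems(2) by blast
    obtain j :: nat where "ord x dvd a ^ j \<or> ord x dvd b ^ j"
      using a(2)[of x] b(2)[of x] x pow_eq_id[OF xG] by blast
    then have "ord x dvd (a * b) ^ j"
      unfolding power_mult_distrib using dvd_mult dvd_mult2 by blast
    then show ?thesis using pow_eq_id[OF xG] by blast
  qed
  then show ?case unfolding bounded_primes_def using a(1) b(1)
    by (intro exI[of _ "a * b"]) auto
qed

lemma divisible_UN:
  assumes "\<And>t. t \<in> T \<Longrightarrow> divisible G (E t)"
  shows "divisible G (\<Union>t\<in>T. E t)"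
  unfolding divisible_def
proof (intro allI impI ballI)
  fix k :: nat and d assume k: "0 < k" and "d \<in> (\<Union>t\<in>T. E t)"
  then obtain t where t: "t \<in> T" "d \<in> E t" by blast
  then obtain e where "e \<in> E t" "e [^] k = d" using assms[OF t(1)] k unfolding divisible_def by blast
  then show "\<exists>e\<in>(\<Union>t\<in>T. E t). e [^] k = d" using t(1) by blast
qed

text \<open>The \<open>k\<close>-torsion is distributed over the layers of order at most \<open>k\<close>.\<close>

lemma CL_in_abelian_finite_torsion:
  assumes H: "subgroup H G" and CL: "CL_in G H" and E: "subgroup E G" "E \<subseteq> H"
    and comm: "\<And>x y. x \<in> E \<Longrightarrow> y \<in> E \<Longrightarrow> x \<otimes> y = y \<otimes> x" and k: "0 < (k::nat)"
  shows "finite {x \<in> E. x [^] k = \<one>}"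
proof -
  define M where "M d = generate G {x \<in> H. ord x = d}" for d
  note HG = subgroup.mem_carrier[OF H]
  have MG: "subgroup (M d) G" for d unfolding M_def using HG by (intro generate_is_subgroup) auto
  have "{x \<in> E. x [^] k = \<one>} \<subseteq> (\<Union>d\<in>{1..k}. {x \<in> E \<inter> M d. x [^] k = \<one>})"
  proof
    fix x assume x: "x \<in> {x \<in> E. x [^] k = \<one>}"
    then have xH: "x \<in> H" using E(2) by blast
    have "0 < ord x" using CL xH unfolding CL_in_def by blast
    moreover have "ord x dvd k" using x HG[OF xH] pow_eq_id by blast
    then have "ord x \<le> k" using k by (rule dvd_imp_le)
    moreover have "x \<in> M (ord x)" unfolding M_def using xH by (intro generate.incl) simp
    ultimately have "ord x \<in> {1..k}" "x \<in> {x \<in> E \<inter> M (ord x). x [^] k = \<one>}" using x by auto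
    then show "x \<in> (\<Union>d\<in>{1..k}. {x \<in> E \<inter> M d. x [^] k = \<one>})" by blast
  qed
  moreover have "finite (\<Union>d\<in>{1..k}. {x \<in> E \<inter> M d. x [^] k = \<one>})"
  proof (rule finite_UN_I)
    fix d assume "d \<in> {1..k}"
    then have "chernikov_in G (M d)" using CL unfolding CL_in_def M_def by auto
    then show "finite {x \<in> E \<inter> M d. x [^] k = \<one>}"
      by (rule chernikov_in_abelian_finite_torsion)
        (use subgroups_Inter_pair[OF E(1) MG] comm k in auto)
  qed simp
  ultimately show ?thesis by (rule finite_subset)
qed

text \<open>The conjugates of \<open>y\<close> under \<open>A\<close> have the order of \<open>y\<close> and lie in \<open>E\<close>, so they are finite in number and the centraliser of \<open>y\<close> has
finite index in the divisible group \<open>A\<close>.\<close>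

lemma divisible_centralizes:
  assumes A: "subgroup A G" "divisible G A" and E: "E \<subseteq> carrier G" "\<And>k::nat. 0 < k \<Longrightarrow> finite {x \<in> E. x [^] k = \<one>}"
    and nor: "\<And>a e. a \<in> A \<Longrightarrow> e \<in> E \<Longrightarrow> inv a \<otimes> e \<otimes> a \<in> E" and y: "y \<in> E" "0 < ord y" and x: "x \<in> A"
  shows "x \<otimes> y = y \<otimes> x"
proof -
  note AG = subgroup.mem_carrier[OF A(1)]
  have yG: "y \<in> carrier G" using y E by blast
  have "(\<lambda>a. inv a \<otimes> y \<otimes> a) ` A \<subseteq> {x \<in> E. x [^] ord y = \<one>}"
  proof (rule image_subsetI)
    fix a assume a: "a \<in> A"
    have "(inv a \<otimes> y \<otimes> inv (inv a)) [^] ord y = inv a \<otimes> y [^] ord y \<otimes> inv (inv a)"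
      by (rule conj_pow) (use AG[OF a] yG in auto)
    then show "inv a \<otimes> y \<otimes> a \<in> {x \<in> E. x [^] ord y = \<one>}"
      using nor[OF a y(1)] AG[OF a] yG by simp
  qed
  then have "finite ((\<lambda>a. inv a \<otimes> y \<otimes> a) ` A)" using E(2)[OF y(2)] finite_subset by blast
  then have "fin_index G {x \<in> carrier G. \<forall>z\<in>{y}. x \<otimes> z = z \<otimes> x} A"
    by (rule centralizer_fin_index[OF yG subgroup.subset[OF A(1)]])
  then have "A \<subseteq> {x \<in> carrier G. \<forall>z\<in>{y}. x \<otimes> z = z \<otimes> x}"
    using divisible_subset_fin_index[OF centralizer_subgroup A(1) _ A(2)] yG by blast
  then show ?thesis using x by blast
qed

end

context loc_fin_MNCL begin

text \<open>Suppose that for no coset of \<open>N\<close> its elements of order \<open>m\<close> generate \<open>G\<close>. Then they generate Chernikov groups \<open>A t\<close>, which are normalised by \<open>N\<close>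
and permuted by conjugation. The divisible parts \<open>E t\<close> lie in \<open>N\<close>, commute with each other, and generate a normal abelian divisible
subgroup \<open>D\<close>. It is divisible Artinian because \<open>N\<close> is a CL-group. Modulo \<open>D\<close> the group is generated by finitely
many finite groups, hence finite by local finiteness. Thus \<open>G\<close> is Chernikov.\<close>

lemma coset_generates:
  assumes N: "N \<lhd> G" and fi: "fin_index G N (carrier G)"
  shows "\<exists>t\<in>carrier G. generate G {y \<in> order_m. y \<otimes> inv t \<in> N} = carrier G"
proof (rule ccontr)
  define C where "C t = {y \<in> order_m. y \<otimes> inv t \<in> N}" for t
  define A where "A t = generate G (C t)" for t
  assume "\<not> (\<exists>t\<in>carrier G. generate G {y \<in> order_m. y \<otimes> inv t \<in> N} = carrier G)"
  then have ne: "A t \<noteq> carrier G" if "t \<in> carrier G" for t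
    using that unfolding A_def C_def by blast
  have NG: "subgroup N G" using N normal_imp_subgroup by blast
  note Ncar = subgroup.mem_carrier[OF NG]
  have CY: "C t \<subseteq> order_m" for t unfolding C_def by blast
  have CG: "C t \<subseteq> carrier G" for t unfolding C_def by blast
  have AG: "subgroup (A t) G" for t unfolding A_def by (rule generate_is_subgroup[OF CG])
  note Acar = subgroup.mem_carrier[OF AG]
  have chern: "chernikov_in G (A t)" if "t \<in> carrier G" for t
    using chernikov_in_generate[OF CY] ne[OF that] unfolding A_def by blast
  have Nne: "N \<noteq> carrier G"
  proof
    assume "N = carrier G"
    then have "C \<one> = order_m" unfolding C_def by auto
    then show False using ne[OF one_closed] layer_generates unfolding A_def by simp
  qed
  have NCL: "CL_in G N" by (rule proper_CL[OF NG Nne])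
  have Ceq: "C s = C t" if "s \<in> carrier G" "t \<in> carrier G" "s \<otimes> inv t \<in> N" for s t
  proof -
    have "y \<otimes> inv s \<in> N \<longleftrightarrow> y \<otimes> inv t \<in> N" if y: "y \<in> carrier G" for y
    proof
      assume "y \<otimes> inv s \<in> N"
      then have "(y \<otimes> inv s) \<otimes> (s \<otimes> inv t) \<in> N" using \<open>s \<otimes> inv t \<in> N\<close> by (rule subgroup.m_closed[OF NG])
      then show "y \<otimes> inv t \<in> N" using y \<open>s \<in> carrier G\<close> \<open>t \<in> carrier G\<close> by (simp add: m_assoc)
    next
      assume "y \<otimes> inv t \<in> N"
      then have "(y \<otimes> inv t) \<otimes> inv (s \<otimes> inv t) \<in> N"
        using subgroup.m_closed[OF NG _ subgroup.m_inv_closed[OF NG \<open>s \<otimes> inv t \<in> N\<close>]] by blast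
      then show "y \<otimes> inv s \<in> N" using y \<open>s \<in> carrier G\<close> \<open>t \<in> carrier G\<close> by (simp add: m_assoc inv_mult_group)
    qed
    then show ?thesis unfolding C_def by blast
  qed
  obtain T where T: "finite T" "T \<subseteq> carrier G" "\<forall>x\<in>carrier G. \<exists>t\<in>T. x \<otimes> inv t \<in> N"
    using fi unfolding fin_index_def by blast
  have rep: "\<exists>t\<in>T. C s = C t" if "s \<in> carrier G" for s
  proof -
    obtain t where t: "t \<in> T" "s \<otimes> inv t \<in> N" using T(3) \<open>s \<in> carrier G\<close> by blast
    have "C s = C t" by (rule Ceq[OF \<open>s \<in> carrier G\<close> _ t(2)]) (use t(1) T(2) in blast)
    then show ?thesis using t(1) by blast
  qed
  have "\<exists>c0::nat. 0 < c0 \<and> (\<forall>c>0. c0 dvd c \<longrightarrow> divisible_artinian G ((\<lambda>z. z [^] c) ` A t) \<and>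
      (\<lambda>z. z [^] c) ` A t \<subseteq> A t \<and> fin_index G ((\<lambda>z. z [^] c) ` A t) (A t))" if "t \<in> carrier G" for t
    using chernikov_in_powers[OF chern[OF that]] by metis
  then obtain c0 :: "'a \<Rightarrow> nat" where c0: "\<And>t. t \<in> carrier G \<Longrightarrow> 0 < c0 t \<and> (\<forall>c>0. c0 t dvd c \<longrightarrow>
      divisible_artinian G ((\<lambda>z. z [^] c) ` A t) \<and>
      (\<lambda>z. z [^] c) ` A t \<subseteq> A t \<and> fin_index G ((\<lambda>z. z [^] c) ` A t) (A t))"
    by metis
  \<comment> \<open>A common exponent, so that conjugation carries the divisible parts of the \<open>A t\<close> to one another.\<close>
  define c where "c = (\<Prod>t\<in>T. c0 t)"
  define E where "E t = (\<lambda>z. z [^] c) ` A t" for t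
  have c: "0 < c" unfolding c_def using c0 T(2) by (intro prod_pos) auto
  have E: "divisible_artinian G (E t)" "E t \<subseteq> A t" "fin_index G (E t) (A t)" if t: "t \<in> T" for t
  proof -
    have "c0 t dvd c" unfolding c_def using t T(1) by (intro dvd_prodI) auto
    then show "divisible_artinian G (E t)" "E t \<subseteq> A t" "fin_index G (E t) (A t)"
      using c0[of t] t T(2) c unfolding E_def by blast+
  qed
  have EG: "subgroup (E t) G" and Ediv: "divisible G (E t)" and Ebp: "bounded_primes G (E t)"
    and Efin: "\<And>k::nat. 0 < k \<Longrightarrow> finite {x \<in> E t. x [^] k = \<one>}" if "t \<in> T" for t
    using E(1)[OF that] unfolding divisible_artinian_def by blast+
  have conjE: "g \<otimes> e \<otimes> inv g \<in> E (g \<otimes> t \<otimes> inv g)" if g: "g \<in> carrier G" "t \<in> carrier G" and e: "e \<in> E t" for g t e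
  proof -
    obtain z where z: "z \<in> A t" "e = z [^] c" using e unfolding E_def by blast
    have "g \<otimes> y \<otimes> inv g \<in> C (g \<otimes> t \<otimes> inv g)" if y: "y \<in> C t" for y
    proof -
      have yG: "y \<in> carrier G" "ord y = m" "y \<otimes> inv t \<in> N" using y unfolding C_def by auto
      have "g \<otimes> (y \<otimes> inv t) \<otimes> inv g \<in> N" using normal.inv_op_closed2[OF N g(1) yG(3)] .
      then have "(g \<otimes> y \<otimes> inv g) \<otimes> inv (g \<otimes> t \<otimes> inv g) \<in> N"
        using g yG(1) by (simp add: m_assoc inv_mult_group)
      then show ?thesis unfolding C_def using yG ord_conj[OF g(1) yG(1)] g by simp
    qed
    then have "g \<otimes> z \<otimes> inv g \<in> A (g \<otimes> t \<otimes> inv g)"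
      using conj_generate[OF CG g(1)] z(1) unfolding A_def by blast
    then show ?thesis unfolding z(2) E_def conj_pow[OF g(1) Acar[OF z(1)], symmetric] by blast
  qed
  have EN_conj: "g \<otimes> e \<otimes> inv g \<in> E t" if g: "g \<in> N" and t: "t \<in> carrier G" and e: "e \<in> E t" for g t e
  proof -
    have gG: "g \<in> carrier G" using Ncar g .
    have "t \<otimes> inv g \<otimes> inv t \<in> N" using normal.inv_op_closed2[OF N t] subgroup.m_inv_closed[OF NG g] .
    then have "g \<otimes> (t \<otimes> inv g \<otimes> inv t) \<in> N" by (rule subgroup.m_closed[OF NG g])
    then have "(g \<otimes> t \<otimes> inv g) \<otimes> inv t \<in> N" using gG t by (simp add: m_assoc)
    then have "C (g \<otimes> t \<otimes> inv g) = C t" using gG t by (intro Ceq) auto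
    then have "E (g \<otimes> t \<otimes> inv g) = E t" unfolding E_def A_def by simp
    then show ?thesis using conjE[OF gG t e] by simp
  qed
  \<comment> \<open>A divisible group has trivial image in the finite group \<open>G/N\<close>.\<close>
  have EN: "E t \<subseteq> N" if t: "t \<in> T" for t
    using divisible_subset_fin_index[OF NG EG[OF t] _ Ediv[OF t]]
      fin_index_mono[OF NG subset_refl fi subgroup.subset[OF EG[OF t]] subset_refl] by blast
  define S where "S = (\<Union>t\<in>T. E t)"
  have SG: "S \<subseteq> carrier G" unfolding S_def using EG subgroup.subset by blast
  have Scomm: "x \<otimes> y = y \<otimes> x" if xy: "x \<in> S" "y \<in> S" for x y
  proof -
    obtain s t where st: "s \<in> T" "x \<in> E s" "t \<in> T" "y \<in> E t" using xy unfolding S_def by blast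
    show ?thesis
    proof (rule divisible_centralizes[OF EG[OF st(1)] Ediv[OF st(1)] subgroup.subset[OF EG[OF st(3)]] Efin[OF st(3)] _ st(4) _ st(2)])
      show "0 < ord y" using xy SG by (intro ord_pos) blast
      fix a e assume a: "a \<in> E s" "e \<in> E t"
      have aN: "a \<in> N" using a(1) EN[OF st(1)] by blast
      have tG: "t \<in> carrier G" using st(3) T(2) by blast
      have "inv a \<otimes> e \<otimes> inv (inv a) \<in> E t"
        by (rule EN_conj[OF subgroup.m_inv_closed[OF NG aN] tG a(2)])
      then show "inv a \<otimes> e \<otimes> a \<in> E t" using Ncar[OF aN] by simp
    qed
  qed
  define D where "D = generate G S"
  have DG: "subgroup D G" unfolding D_def by (rule generate_is_subgroup[OF SG])
  have Dcomm: "x \<otimes> y = y \<otimes> x" if "x \<in> D" "y \<in> D" for x y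
    using generate_abelian[OF SG Scomm] that unfolding D_def by blast
  have DN: "D \<subseteq> N" unfolding D_def S_def using EN by (intro generate_subgroup_incl[OF _ NG]) blast
  have "divisible G S" unfolding S_def by (rule divisible_UN[OF Ediv])
  then have Ddiv: "divisible G D" using divisible_generate[OF D_def SG Dcomm] by blast
  have "bounded_primes G S" unfolding S_def
    using bounded_primes_UN[OF T(1), of E] Ebp EG subgroup.subset by blast
  then have Dbp: "bounded_primes G D" using abelian_bounded_primes_generate[OF D_def SG Dcomm] by blast
  have "finite {x \<in> D. x [^] k = \<one>}" if "0 < k" for k :: nat
    by (rule CL_in_abelian_finite_torsion[OF NG NCL DG DN Dcomm that])
  then have Dart: "divisible_artinian G D"
    unfolding divisible_artinian_def using DG Dcomm Ddiv Dbp by blast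
  have conjS: "g \<otimes> e \<otimes> inv g \<in> S" if g: "g \<in> carrier G" and e: "e \<in> S" for g e
  proof -
    obtain t where t: "t \<in> T" "e \<in> E t" using e unfolding S_def by blast
    have tG: "t \<in> carrier G" using t T(2) by blast
    obtain t' where t': "t' \<in> T" "C (g \<otimes> t \<otimes> inv g) = C t'" using rep[of "g \<otimes> t \<otimes> inv g"] g tG by auto
    then have "E (g \<otimes> t \<otimes> inv g) = E t'" unfolding E_def A_def by simp
    then show ?thesis using conjE[OF g tG t(2)] t'(1) unfolding S_def by blast
  qed
  have Dnor: "normal_in G D (carrier G)"
    unfolding D_def by (rule normal_in_generate[OF subgroup_self SG conjS])
  have "\<exists>R. finite R \<and> R \<subseteq> A t \<and> (\<forall>x\<in>A t. \<exists>r\<in>R. x \<otimes> inv r \<in> E t)" if "t \<in> T" for t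
    using E(3)[OF that] unfolding fin_index_def by blast
  then obtain R where R: "\<And>t. t \<in> T \<Longrightarrow> finite (R t) \<and> R t \<subseteq> A t \<and> (\<forall>x\<in>A t. \<exists>r\<in>R t. x \<otimes> inv r \<in> E t)"
    by metis
  \<comment> \<open>A finite group that, together with \<open>D\<close>, generates \<open>G\<close>.\<close>
  define F where "F = generate G (\<Union>t\<in>T. R t)"
  have RG: "(\<Union>t\<in>T. R t) \<subseteq> carrier G" using R Acar by blast
  have FG: "subgroup F G" unfolding F_def by (rule generate_is_subgroup[OF RG])
  note Fcar = subgroup.mem_carrier[OF FG]
  have "finite (\<Union>t\<in>T. R t)" using T(1) R by (intro finite_UN_I) auto
  then have Ffin: "finite F" using loc_fin RG unfolding F_def loc_fin_def by simp
  have DF: "subgroup (D <#> F) G"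
  proof (rule subgroup_set_mult[OF DG FG])
    show "b \<otimes> a \<otimes> inv b \<in> D" if "a \<in> D" "b \<in> F" for a b
      using Dnor that(1) Fcar[OF that(2)] unfolding normal_in_def by blast
  qed
  have "order_m \<subseteq> D <#> F"
  proof
    fix y assume y: "y \<in> order_m"
    then have "y \<in> C y" unfolding C_def using subgroup.one_closed[OF NG] by simp
    then obtain t where t: "t \<in> T" "y \<in> C t" using rep[of y] y by blast
    have yA: "y \<in> A t" unfolding A_def using t(2) by (rule generate.incl)
    obtain r where r: "r \<in> R t" "y \<otimes> inv r \<in> E t" using R[OF t(1)] yA by blast
    have rF: "r \<in> F" unfolding F_def using t(1) r(1) by (intro generate.incl) blast
    have "y \<otimes> inv r \<in> D" unfolding D_def S_def using r(2) t(1) by (intro generate.incl) blast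
    then have "(y \<otimes> inv r) \<otimes> r \<in> D <#> F" using rF by (rule set_multI)
    then show "y \<in> D <#> F" using y Fcar[OF rF] by (simp add: m_assoc)
  qed
  from generate_subgroup_incl[OF this DF] have GDF: "carrier G \<subseteq> D <#> F" unfolding layer_generates .
  have "fin_index G D (carrier G)"
    unfolding fin_index_def
  proof (intro exI[of _ F] conjI ballI)
    show "F \<subseteq> carrier G" using Fcar by blast
    fix x assume "x \<in> carrier G"
    then obtain d f where df: "d \<in> D" "f \<in> F" "x = d \<otimes> f" using GDF unfolding set_mult_def by blast
    then have "x \<otimes> inv f = d" using Fcar subgroup.mem_carrier[OF DG] by (simp add: m_assoc)
    then show "\<exists>t\<in>F. x \<otimes> inv t \<in> D" using df by blast
  qed (rule Ffin)
  then have "chernikov_in G (carrier G)"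
    unfolding chernikov_in_def using subgroup_self Dart subgroup.subset[OF DG] by blast
  then show False using not_chernikov by blast
qed

lemma generate_singleton:
  assumes f: "f \<in> carrier G"
  shows "finite (generate G {f})" "\<And>b. b \<in> generate G {f} \<Longrightarrow> \<exists>i < ord f. b = f [^] i"
proof -
  show "finite (generate G {f})" using loc_fin f unfolding loc_fin_def by simp
  fix b assume "b \<in> generate G {f}"
  moreover have "generate G {f} = {f [^] k |k. k \<in> {0..ord f - 1}}"
    using generate_pow_nat[OF f] ord_elems_inf_carrier[OF f] ord_pos[OF f] by simp
  ultimately obtain i where "i \<le> ord f - 1" "b = f [^] i" by auto
  then show "\<exists>i < ord f. b = f [^] i" using ord_pos[OF f] by (intro exI[of _ i]) auto
qed

text \<open>It is enough that \<open>f H f\<^sup>-\<^sup>1 \<subseteq> H\<close>, because \<open>f\<close> has finite order and its inverse is one of its powers.\<close>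

lemma cyclic_extension:
  assumes H: "subgroup H G" and f: "f \<in> carrier G" and nor: "\<And>h. h \<in> H \<Longrightarrow> f \<otimes> h \<otimes> inv f \<in> H"
  shows "subgroup (H <#> generate G {f}) G" "fin_index G H (H <#> generate G {f})"
proof -
  note HG = subgroup.mem_carrier[OF H]
  have F: "subgroup (generate G {f}) G" using f by (intro generate_is_subgroup) simp
  note FG = subgroup.mem_carrier[OF F]
  have pow: "f [^] i \<otimes> h \<otimes> inv (f [^] i) \<in> H" if "h \<in> H" for h and i :: nat
    using conj_power_closed[OF f subgroup.subset[OF H] nor that] .
  show "subgroup (H <#> generate G {f}) G"
    by (rule subgroup_set_mult[OF H F]) (use generate_singleton(2)[OF f] pow in blast)
  show "fin_index G H (H <#> generate G {f})"
    unfolding fin_index_def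
  proof (intro exI[of _ "generate G {f}"] conjI ballI)
    show "finite (generate G {f})" by (rule generate_singleton(1)[OF f])
    show "generate G {f} \<subseteq> H <#> generate G {f}" by (rule subset_set_mult(2)[OF H F])
    fix x assume "x \<in> H <#> generate G {f}"
    then obtain h b where hb: "h \<in> H" "b \<in> generate G {f}" "x = h \<otimes> b" unfolding set_mult_def by blast
    then have "x \<otimes> inv b = h" using HG FG by (simp add: m_assoc)
    then have "x \<otimes> inv b \<in> H" using hb(1) by simp
    then show "\<exists>t\<in>generate G {f}. x \<otimes> inv t \<in> H" using hb(2) by blast
  qed
qed

text \<open>All generators found by \<open>coset_generates\<close> lie in one coset \<open>N f\<close>.\<close>

lemma finite_quotient_cyclic:
  assumes N: "N \<lhd> G" and fi: "fin_index G N (carrier G)"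
  obtains f where "f \<in> order_m" "generate G {y \<in> order_m. y \<otimes> inv f \<in> N} = carrier G"
    "N <#> generate G {f} = carrier G"
proof -
  have NG: "subgroup N G" using N normal_imp_subgroup by blast
  obtain t where t: "t \<in> carrier G" "generate G {y \<in> order_m. y \<otimes> inv t \<in> N} = carrier G"
    using coset_generates[OF N fi] by blast
  have "{y \<in> order_m. y \<otimes> inv t \<in> N} \<noteq> {}"
  proof
    assume none: "{y \<in> order_m. y \<otimes> inv t \<in> N} = {}"
    have "carrier G = {\<one>}" using t(2) unfolding none generate_empty by simp
    then show False using not_chernikov chernikov_in_finite[OF subgroup_self] by simp
  qed
  then obtain f where f: "f \<in> order_m" "f \<otimes> inv t \<in> N" by blast
  have fG: "f \<in> carrier G" using f by blast
  have "{y \<in> order_m. y \<otimes> inv t \<in> N} \<subseteq> {y \<in> order_m. y \<otimes> inv f \<in> N}"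
  proof
    fix y assume "y \<in> {y \<in> order_m. y \<otimes> inv t \<in> N}"
    then have y: "y \<in> order_m" "y \<otimes> inv t \<in> N" by auto
    have "(y \<otimes> inv t) \<otimes> inv (f \<otimes> inv t) \<in> N"
      by (rule subgroup.m_closed[OF NG y(2) subgroup.m_inv_closed[OF NG f(2)]])
    then show "y \<in> {y \<in> order_m. y \<otimes> inv f \<in> N}" using y(1) fG t(1) by (simp add: m_assoc inv_mult_group)
  qed
  from mono_generate[OF this] have sub: "carrier G \<subseteq> generate G {y \<in> order_m. y \<otimes> inv f \<in> N}" unfolding t(2) .
  have "generate G {y \<in> order_m. y \<otimes> inv f \<in> N} \<subseteq> carrier G" by (rule generate_incl) auto
  with sub have gen: "generate G {y \<in> order_m. y \<otimes> inv f \<in> N} = carrier G" by (rule subset_antisym[rotated])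
  have NF: "subgroup (N <#> generate G {f}) G"
    by (rule cyclic_extension(1)[OF NG fG normal.inv_op_closed2[OF N fG]])
  have "{y \<in> order_m. y \<otimes> inv f \<in> N} \<subseteq> N <#> generate G {f}"
  proof
    fix y assume "y \<in> {y \<in> order_m. y \<otimes> inv f \<in> N}"
    then have y: "y \<in> carrier G" "y \<otimes> inv f \<in> N" by auto
    have "(y \<otimes> inv f) \<otimes> f \<in> N <#> generate G {f}"
      by (rule set_multI[OF y(2)]) (simp add: generate.incl)
    then show "y \<in> N <#> generate G {f}" using y(1) fG by (simp add: m_assoc)
  qed
  from generate_subgroup_incl[OF this NF] have "carrier G \<subseteq> N <#> generate G {f}" unfolding gen .
  then have "N <#> generate G {f} = carrier G" using subgroup.subset[OF NF] by blast
  then show thesis using that f(1) gen by blast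
qed

lemma card_rcosets_le:
  assumes N: "N \<lhd> G" and fi: "fin_index G N (carrier G)"
  shows "card (rcosets N) \<le> m"
proof -
  have NG: "subgroup N G" using N normal_imp_subgroup by blast
  obtain f where f: "f \<in> order_m" "N <#> generate G {f} = carrier G" using finite_quotient_cyclic[OF N fi] by blast
  have fG: "f \<in> carrier G" using f(1) by blast
  have "rcosets N \<subseteq> (\<lambda>i. N #> f [^] i) ` {..<m}"
  proof
    fix c assume "c \<in> rcosets N"
    then obtain x where x: "x \<in> carrier G" "c = N #> x" unfolding RCOSETS_def by blast
    then obtain n b where nb: "n \<in> N" "b \<in> generate G {f}" "x = n \<otimes> b" using f(2) unfolding set_mult_def by blast
    obtain i where i: "i < m" "b = f [^] i" using generate_singleton(2)[OF fG nb(2)] f(1) by auto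
    have "x \<in> N #> f [^] i" unfolding nb(3) i(2) by (rule rcosI[OF nb(1) subgroup.subset[OF NG]]) (simp add: fG)
    then have "N #> f [^] i = N #> x" by (rule repr_independence[OF _ _ NG]) (simp add: fG)
    then show "c \<in> (\<lambda>i. N #> f [^] i) ` {..<m}" using x(2) i(1) by blast
  qed
  then have "card (rcosets N) \<le> card {..<m}" by (rule surj_card_le[OF finite_lessThan])
  then show ?thesis by simp
qed

text \<open>Indices of normal subgroups are at most \<open>m\<close>, so one can take \<open>N\<close> with largest index. Intersecting \<open>N\<close> with another normal subgroup of finite
index does not change the index, hence does not change \<open>N\<close>.\<close>

lemma least_fin_index_subgroup:
  obtains N where "N \<lhd> G" "fin_index G N (carrier G)"
    "\<And>K. subgroup K G \<Longrightarrow> fin_index G K (carrier G) \<Longrightarrow> N \<subseteq> K"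
proof -
  let ?P = "\<lambda>N. N \<lhd> G \<and> fin_index G N (carrier G)"
  have "carrier G \<lhd> G" by (rule normal_invI[OF subgroup_self]) (simp only: m_closed inv_closed)
  then have "?P (carrier G)" using fin_index_self[OF subgroup_self] by blast
  moreover have "\<forall>K. ?P K \<longrightarrow> card (rcosets K) < Suc m" using card_rcosets_le by (simp add: less_Suc_eq_le)
  ultimately have "\<exists>N. ?P N \<and> (\<forall>K. ?P K \<longrightarrow> card (rcosets K) \<le> card (rcosets N))"
    by (rule ex_has_greatest_nat)
  then obtain N where N: "?P N" and max: "\<And>K. ?P K \<Longrightarrow> card (rcosets K) \<le> card (rcosets N)" by blast
  have NG: "subgroup N G" using N normal_imp_subgroup by blast
  have "N \<subseteq> K" if K: "subgroup K G" "fin_index G K (carrier G)" for K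
  proof -
    obtain M where M: "M \<lhd> G" "M \<subseteq> K" "fin_index G M (carrier G)" using normal_core[OF K] by blast
    have MG: "subgroup M G" using M(1) normal_imp_subgroup by blast
    define L where "L = N \<inter> M"
    have L: "L \<lhd> G" unfolding L_def using normal_subgroup_intersect N M(1) by blast
    have LG: "subgroup L G" using L normal_imp_subgroup by blast
    have Lfi: "fin_index G L (carrier G)"
      unfolding L_def using fin_index_Int[OF NG MG subset_refl] N M(3) by blast
    have finL: "finite (rcosets L)" using fin_index_iff_rcosets[OF LG] Lfi by blast
    \<comment> \<open>The map from cosets of \<open>L\<close> to cosets of \<open>N\<close> is onto, hence injective by the choice of \<open>N\<close>.\<close>
    define h where "h c = N #> (SOME y. y \<in> c)" for c
    have h: "h (L #> x) = N #> x" if x: "x \<in> carrier G" for x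
    proof -
      have "x \<in> L #> x" by (rule rcos_self[OF x LG])
      then have "(SOME y. y \<in> L #> x) \<in> L #> x" by (rule someI)
      moreover have "L #> x \<subseteq> N #> x" unfolding L_def r_coset_def by blast
      ultimately have "(SOME y. y \<in> L #> x) \<in> N #> x" by blast
      then show ?thesis unfolding h_def using repr_independence[OF _ x NG] by blast
    qed
    have "h ` (rcosets L) = rcosets N"
    proof -
      have "rcosets L = (\<lambda>x. L #> x) ` carrier G" "rcosets N = (\<lambda>x. N #> x) ` carrier G"
        unfolding RCOSETS_def by blast+
      then show ?thesis using h by (simp add: image_image)
    qed
    moreover have "card (rcosets L) \<le> card (rcosets N)" using max L Lfi by blast
    ultimately have "card (h ` (rcosets L)) = card (rcosets L)"
      using card_image_le[OF finL, of h] by simp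
    then have inj: "inj_on h (rcosets L)" by (rule eq_card_imp_inj_on[OF finL])
    have "x \<in> L" if x: "x \<in> N" for x
    proof -
      have xG: "x \<in> carrier G" using x subgroup.mem_carrier[OF NG] by blast
      have "h (L #> x) = h (L #> \<one>)"
        unfolding h[OF xG] h[OF one_closed] using coset_join2[OF xG NG x] coset_join2[OF one_closed NG subgroup.one_closed[OF NG]]
        by simp
      then have "L #> x = L #> \<one>"
        using inj_onD[OF inj] rcosetsI[OF subgroup.subset[OF LG]] xG by blast
      then have "x \<in> L #> \<one>" using rcos_self[OF xG LG] by simp
      then show ?thesis using coset_join2[OF one_closed LG subgroup.one_closed[OF LG]] by simp
    qed
    then show ?thesis using M(2) unfolding L_def by blast
  qed
  then show thesis using that N by blast
qed

end

section \<open>Abelian groups and proper subgroups of finite index\<close>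

lemma (in group_hom) subgroup_preimage:
  assumes "subgroup M H"
  shows "subgroup {x \<in> carrier G. h x \<in> M} G"
proof (rule G.subgroupI)
  have "\<one>\<^bsub>G\<^esub> \<in> {x \<in> carrier G. h x \<in> M}" using subgroup.one_closed[OF assms] by simp
  then show "{x \<in> carrier G. h x \<in> M} \<noteq> {}" by blast
qed (use assms in \<open>auto simp: subgroup.m_closed subgroup.m_inv_closed\<close>)

context group begin

text \<open>The \<open>k\<close>-th power map is a composition of \<open>p\<close>-th power maps for primes \<open>p\<close>.\<close>

lemma abelian_pow_prime_not_surj:
  assumes H: "subgroup H G" and k: "0 < (k::nat)" "(\<lambda>x. x [^] k) ` H \<noteq> H"
  obtains p where "Factorial_Ring.prime p" "(\<lambda>x. x [^] (p::nat)) ` H \<noteq> H"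
proof -
  note HG = subgroup.mem_carrier[OF H]
  have "\<exists>p. Factorial_Ring.prime p \<and> (\<lambda>x. x [^] (p::nat)) ` H \<noteq> H"
    using k
  proof (induction k rule: less_induct)
    case (less k)
    show ?case
    proof (cases "k = 1")
      case True
      then show ?thesis using less.prems(2) HG by simp
    next
      case False
      then obtain p where p: "Factorial_Ring.prime p" "p dvd k" using prime_factor_nat by blast
      then obtain l where l: "k = p * l" by blast
      have p1: "1 < p" using p(1) by (rule prime_gt_1_nat)
      show ?thesis
      proof (cases "(\<lambda>x. x [^] p) ` H = H")
        case True
        have "(\<lambda>x. x [^] k) ` H = (\<lambda>x. x [^] l) ` ((\<lambda>x. x [^] p) ` H)"
          unfolding image_image l using HG by (intro image_cong) (auto simp: nat_pow_pow)
        then have "(\<lambda>x. x [^] l) ` H \<noteq> H" using less.prems(2) True by simp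
        moreover have "0 < l" "l < k" using l less.prems(1) p1 by auto
        ultimately show ?thesis using less.IH[of l] by simp
      qed (use p(1) in blast)
    qed
  qed
  then show thesis using that by blast
qed

text \<open>The exponent may be taken to be a prime \<open>p\<close>. By Zorn's lemma choose \<open>M\<close> maximal among the subgroups that contain all \<open>p\<close>-th
powers but not a given \<open>x0\<close>. If \<open>y \<notin> M\<close>, then \<open>x0 \<in> M y\<^sup>r\<close> with \<open>r\<close> prime to \<open>p\<close>, whence \<open>y \<in> M x0\<^sup>i\<close> for some \<open>i < p\<close>. So \<open>M\<close> has index at most \<open>p\<close>:
\<open>H/M\<close> is a line through \<open>x0\<close> over the field with \<open>p\<close> elements.\<close>

lemma abelian_proper_fin_index:
  assumes H: "subgroup H G" and comm: "\<And>x y. x \<in> H \<Longrightarrow> y \<in> H \<Longrightarrow> x \<otimes> y = y \<otimes> x"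
    and k: "0 < (k::nat)" "(\<lambda>x. x [^] k) ` H \<noteq> H"
  obtains M where "subgroup M G" "M \<subseteq> H" "M \<noteq> H" "fin_index G M H"
proof -
  note HG = subgroup.mem_carrier[OF H]
  obtain p where p: "Factorial_Ring.prime p" "(\<lambda>x. x [^] (p::nat)) ` H \<noteq> H"
    using abelian_pow_prime_not_surj[OF H k] by blast
  have p0: "0 < p" using p(1) by (rule prime_gt_0_nat)
  define C where "C = (\<lambda>x. x [^] p) ` H"
  have C: "subgroup C G" unfolding C_def by (rule abelian_pow_subgroup[OF H comm])
  have CH: "C \<subseteq> H" unfolding C_def using subgroup_pow_closed[OF H] by blast
  then obtain x0 where x0: "x0 \<in> H" "x0 \<notin> C" using p(2) unfolding C_def by blast
  have x0G: "x0 \<in> carrier G" using x0 HG by blast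
  define Z where "Z = {M. subgroup M G \<and> C \<subseteq> M \<and> M \<subseteq> H \<and> x0 \<notin> M}"
  have "\<exists>M\<in>Z. \<forall>L\<in>Z. M \<subseteq> L \<longrightarrow> L = M"
  proof (rule subset_Zorn_nonempty)
    show "Z \<noteq> {}" unfolding Z_def using C CH x0 by blast
    fix \<C> assume ne: "\<C> \<noteq> {}" and ch: "subset.chain Z \<C>"
    then have sub: "\<And>M. M \<in> \<C> \<Longrightarrow> subgroup M G \<and> C \<subseteq> M \<and> M \<subseteq> H \<and> x0 \<notin> M"
      and lin: "\<And>M L. M \<in> \<C> \<Longrightarrow> L \<in> \<C> \<Longrightarrow> M \<subseteq> L \<or> L \<subseteq> M"
      unfolding subset_chain_def Z_def by blast+
    obtain M0 where M0: "M0 \<in> \<C>" using ne by blast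
    have "subgroup (\<Union>\<C>) G"
    proof (rule subgroupI)
      show "\<Union>\<C> \<subseteq> carrier G" using sub HG by blast
      have "\<one> \<in> M0" using sub[OF M0] subgroup.one_closed by blast
      then show "\<Union>\<C> \<noteq> {}" using M0 by blast
    next
      fix a assume "a \<in> \<Union>\<C>"
      then obtain M where M: "M \<in> \<C>" "a \<in> M" by blast
      have "inv a \<in> M" using sub[OF M(1)] M(2) by (simp add: subgroup.m_inv_closed)
      then show "inv a \<in> \<Union>\<C>" using M(1) by blast
    next
      fix a b assume "a \<in> \<Union>\<C>" "b \<in> \<Union>\<C>"
      then obtain M L where M: "M \<in> \<C>" "a \<in> M" "L \<in> \<C>" "b \<in> L" by blast
      then obtain K where K: "K \<in> \<C>" "a \<in> K" "b \<in> K" using lin[of M L] by blast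
      have "a \<otimes> b \<in> K" using sub[OF K(1)] K(2,3) by (simp add: subgroup.m_closed)
      then show "a \<otimes> b \<in> \<Union>\<C>" using K(1) by blast
    qed
    then show "\<Union>\<C> \<in> Z" unfolding Z_def using sub M0 by blast
  qed
  then obtain M where MZ: "M \<in> Z" and max: "\<And>L. L \<in> Z \<Longrightarrow> M \<subseteq> L \<Longrightarrow> L = M" by blast
  have M: "subgroup M G" "C \<subseteq> M" "M \<subseteq> H" "x0 \<notin> M" using MZ unfolding Z_def by blast+
  note MG = subgroup.mem_carrier[OF M(1)]
  have powp: "y [^] p \<in> M" if "y \<in> H" for y using that M(2) unfolding C_def by blast
  have "\<exists>i<p. y \<otimes> inv (x0 [^] i) \<in> M" if y: "y \<in> H" for y
  proof (cases "y \<in> M")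
    case True
    then show ?thesis using p0 HG[OF y] by (intro exI[of _ 0]) simp
  next
    case False
    have yG: "y \<in> carrier G" using y HG by blast
    have gy: "subgroup (generate G {y}) G" using yG by (intro generate_is_subgroup) simp
    have gyH: "generate G {y} \<subseteq> H" using y by (intro generate_subgroup_incl[OF _ H]) simp
    define L where "L = M <#> generate G {y}"
    have LG: "subgroup L G" unfolding L_def
    proof (rule subgroup_set_mult[OF M(1) gy])
      fix a b assume ab: "a \<in> M" "b \<in> generate G {y}"
      then have abH: "a \<in> H" "b \<in> H" using M(3) gyH by blast+
      then have "b \<otimes> a \<otimes> inv b = a" using comm[of b a] HG by (simp add: m_assoc)
      then show "b \<otimes> a \<otimes> inv b \<in> M" using ab(1) by simp
    qed
    have LH: "L \<subseteq> H" unfolding L_def set_mult_def using M(3) gyH subgroup.m_closed[OF H] by blast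
    have leL: "M \<subseteq> L" "y \<in> L" unfolding L_def using subset_set_mult[OF M(1) gy] by (auto intro: generate.incl)
    have "L \<notin> Z" using max[of L] leL False by blast
    then have "x0 \<in> L" unfolding Z_def using LG LH leL(1) M(2) by blast
    then obtain a b where ab: "a \<in> M" "b \<in> generate G {y}" "x0 = a \<otimes> b" unfolding L_def set_mult_def by blast
    obtain j :: int where j: "b = y [^] j" using ab(2) unfolding generate_pow[OF yG] by blast
    \<comment> \<open>Since \<open>y\<^sup>p \<in> M\<close>, only the residue of the exponent modulo \<open>p\<close> matters.\<close>
    define r where "r = nat (j mod int p)"
    have "j = int p * (j div int p) + int r" unfolding r_def using p0 by simp
    then have "b = (y [^] p) [^] (j div int p) \<otimes> y [^] r"
      unfolding j using yG by (metis int_pow_int int_pow_mult int_pow_pow)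
    moreover have "(y [^] p) [^] (j div int p) \<in> M"
      using powp[OF y] by (rule subgroup_int_pow_closed[OF M(1)])
    ultimately obtain a' where a': "a' \<in> M" "x0 = a' \<otimes> y [^] r"
      using ab(1,3) MG yG subgroup.m_closed[OF M(1)] by (metis m_assoc nat_pow_closed)
    have rp: "r < p" unfolding r_def using p0 by (simp add: nat_less_iff)
    have r0: "r \<noteq> 0"
    proof
      assume "r = 0"
      then have "x0 = a'" using a' MG by simp
      then show False using a'(1) M(4) by blast
    qed
    have ndvd: "\<not> p dvd r" using rp r0 by (auto dest: dvd_imp_le)
    have "coprime r p" using prime_imp_coprime[OF p(1) ndvd] by (simp add: coprime_commute)
    then obtain u v where uv: "r * u = p * v + 1" using bezout_nat[OF r0, of p] by (metis coprime_iff_gcd_eq_1)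
    have a'H: "a' \<in> H" "a' \<in> carrier G" using a'(1) M(3) MG by blast+
    have "x0 [^] u = a' [^] u \<otimes> (y [^] r) [^] u"
      unfolding a'(2) by (rule pow_mult_distrib[OF comm]) (use a'H yG subgroup_pow_closed[OF H y] in auto)
    also have "(y [^] r) [^] u = (y [^] p) [^] v \<otimes> y"
      using yG by (simp add: nat_pow_pow uv)
    finally have x0u: "x0 [^] u = (a' [^] u \<otimes> (y [^] p) [^] v) \<otimes> y" using a'H yG by (simp add: m_assoc)
    define w where "w = a' [^] u \<otimes> (y [^] p) [^] v"
    have w: "w \<in> M" unfolding w_def
      by (intro subgroup.m_closed[OF M(1)] subgroup_pow_closed[OF M(1)] a'(1) powp[OF y])
    define s where "s = (x0 [^] p) [^] (u div p)"
    have s: "s \<in> M" unfolding s_def by (intro subgroup_pow_closed[OF M(1)] powp[OF x0(1)])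
    have x0s: "x0 [^] u = s \<otimes> x0 [^] (u mod p)"
      unfolding s_def using x0G by (simp add: nat_pow_pow nat_pow_mult)
    have G: "w \<in> carrier G" "s \<in> carrier G" using w s MG by blast+
    have "w \<otimes> y = s \<otimes> x0 [^] (u mod p)" using x0u x0s unfolding w_def by simp
    then have "y = inv w \<otimes> (s \<otimes> x0 [^] (u mod p))" using G yG x0G by (metis mult_inv_cancel(2))
    then have "y \<otimes> inv (x0 [^] (u mod p)) = inv w \<otimes> s" using G x0G by (simp add: m_assoc)
    moreover have "inv w \<otimes> s \<in> M" by (intro subgroup.m_closed[OF M(1)] subgroup.m_inv_closed[OF M(1)] w s)
    ultimately show ?thesis using p0 by (intro exI[of _ "u mod p"]) simp
  qed
  then have "fin_index G M H"
    unfolding fin_index_def using subgroup_pow_closed[OF H x0(1)]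
    by (intro exI[of _ "(\<lambda>i. x0 [^] i) ` {..<p}"]) auto
  moreover have "M \<noteq> H" using M(4) x0(1) by blast
  ultimately show thesis using that M(1,3) by blast
qed

end

section \<open>A proper finite residual is impossible\<close>

text \<open>The situation to be refuted: the least subgroup of finite index is proper, and so is a CL-group.\<close>

locale loc_fin_MNCL_residual = loc_fin_MNCL G m for G (structure) and m +
  fixes N :: "'a set"
  assumes N_normal: "N \<lhd> G"
    and N_fin_index: "fin_index G N (carrier G)"
    and N_least: "\<And>K. subgroup K G \<Longrightarrow> fin_index G K (carrier G) \<Longrightarrow> N \<subseteq> K"
    and N_proper: "N \<noteq> carrier G"
begin

lemma N_subgroup: "subgroup N G"
  using N_normal normal_imp_subgroup by blast

lemmas N_carrier = subgroup.mem_carrier[OF N_subgroup]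

lemma N_no_fin_index:
  assumes "subgroup H G" "fin_index G H N"
  shows "N \<subseteq> H"
  using N_least[OF assms(1)] fin_index_trans[OF N_subgroup assms(1) subgroup_self _ N_fin_index assms(2)]
    subgroup.subset[OF N_subgroup] by blast

lemma N_CL: "CL_in G N"
  by (rule proper_CL[OF N_subgroup N_proper])

text \<open>The centraliser has finite index in \<open>N\<close>, and \<open>N\<close> has no proper subgroup of finite index.\<close>

lemma centralizes_finite_conjugates:
  assumes y: "y \<in> carrier G" and fin: "finite ((\<lambda>x. inv x \<otimes> y \<otimes> x) ` N)" and x: "x \<in> N"
  shows "x \<otimes> y = y \<otimes> x"
proof -
  have "fin_index G {x \<in> carrier G. \<forall>z\<in>{y}. x \<otimes> z = z \<otimes> x} N"
    by (rule centralizer_fin_index[OF y subgroup.subset[OF N_subgroup] fin])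
  then have "N \<subseteq> {x \<in> carrier G. \<forall>z\<in>{y}. x \<otimes> z = z \<otimes> x}"
    by (rule N_no_fin_index[OF centralizer_subgroup, rotated]) (use y in blast)
  then show ?thesis using x by blast
qed

text \<open>Let \<open>M\<close> be the layer of \<open>N\<close> containing \<open>y\<close> and \<open>D\<close> its divisible part. Elements of \<open>D\<close> have finitely many conjugates under \<open>N\<close>, as these lie in
a finite torsion part of \<open>D\<close>; so \<open>D\<close> is central in \<open>N\<close>. Then the conjugates of \<open>y\<close>, which all have the same order, are finite in number
in each of the finitely many cosets of \<open>D\<close> in \<open>M\<close>.\<close>

lemma N_abelian:
  assumes x: "x \<in> N" and y: "y \<in> N"
  shows "x \<otimes> y = y \<otimes> x"
proof -
  define M where "M = generate G {z \<in> N. ord z = ord y}"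
  have Mnor: "normal_in G M N" unfolding M_def by (rule normal_in_layer[OF N_subgroup])
  have M: "subgroup M G" "M \<subseteq> N" "\<And>w v. w \<in> N \<Longrightarrow> v \<in> M \<Longrightarrow> w \<otimes> v \<otimes> inv w \<in> M"
    using Mnor unfolding normal_in_def by blast+
  note MG = subgroup.mem_carrier[OF M(1)]
  have yG: "y \<in> carrier G" using y N_carrier by blast
  have yM: "y \<in> M" unfolding M_def using y by (intro generate.incl) simp
  have conjM: "inv w \<otimes> v \<otimes> w \<in> M" if "w \<in> N" "v \<in> M" for w v
    using M(3)[OF subgroup.m_inv_closed[OF N_subgroup that(1)] that(2)] N_carrier[OF that(1)] by simp
  have conj_pow': "(inv w \<otimes> v \<otimes> w) [^] i = inv w \<otimes> v [^] i \<otimes> w" if "w \<in> carrier G" "v \<in> carrier G" for w v and i :: nat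
    using conj_pow[of "inv w" v i] that by simp
  have "chernikov_in G M" using N_CL ord_pos[OF yG] unfolding CL_in_def M_def by blast
  then obtain c :: nat where "0 < c" and c: "\<And>d::nat. 0 < d \<Longrightarrow> c dvd d \<Longrightarrow> divisible_artinian G ((\<lambda>z. z [^] d) ` M) \<and>
      (\<lambda>z. z [^] d) ` M \<subseteq> M \<and> fin_index G ((\<lambda>z. z [^] d) ` M) M"
    using chernikov_in_powers by metis
  define D where "D = (\<lambda>z. z [^] c) ` M"
  have D: "divisible_artinian G D" "D \<subseteq> M" "fin_index G D M"
    using c[OF \<open>0 < c\<close> dvd_refl] unfolding D_def by blast+
  have DG: "subgroup D G" and Dfin: "\<And>k::nat. 0 < k \<Longrightarrow> finite {x \<in> D. x [^] k = \<one>}"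
    using D(1) unfolding divisible_artinian_def by blast+
  have conjD: "inv w \<otimes> d \<otimes> w \<in> D" if w: "w \<in> N" and d: "d \<in> D" for w d
  proof -
    obtain z where z: "z \<in> M" "d = z [^] c" using d unfolding D_def by blast
    show ?thesis
      unfolding z(2) conj_pow'[OF N_carrier[OF w] MG[OF z(1)], symmetric] D_def using conjM[OF w z(1)] by blast
  qed
  have D_central: "w \<otimes> d = d \<otimes> w" if w: "w \<in> N" and d: "d \<in> D" for w d
  proof (rule centralizes_finite_conjugates[OF _ _ w])
    show dG: "d \<in> carrier G" using d D(2) MG by blast
    have "(\<lambda>x. inv x \<otimes> d \<otimes> x) ` N \<subseteq> {x \<in> D. x [^] ord d = \<one>}"
      using conjD[OF _ d] conj_pow'[OF _ dG] N_carrier dG by auto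
    then show "finite ((\<lambda>x. inv x \<otimes> d \<otimes> x) ` N)" using Dfin[OF ord_pos[OF dG]] finite_subset by blast
  qed
  define S where "S = (\<lambda>x. inv x \<otimes> y \<otimes> x) ` N"
  have SM: "S \<subseteq> M" unfolding S_def using conjM yM by blast
  have Sord: "z [^] ord y = \<one>" if "z \<in> S" for z
    using that conj_pow'[OF N_carrier yG] yG N_carrier unfolding S_def by auto
  have "finite S"
  proof (rule finite_bounded_exponent_fin_index[OF DG Dfin[OF ord_pos[OF yG]] subgroup.subset[OF M(1)] D(3) SM Sord])
    fix z w assume "w \<in> S" "z \<otimes> inv w \<in> D"
    then show "(z \<otimes> inv w) \<otimes> w = w \<otimes> (z \<otimes> inv w)" using D_central[of w "z \<otimes> inv w"] SM M(2) by auto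
  qed
  then show ?thesis using centralizes_finite_conjugates[OF yG _ x] unfolding S_def by blast
qed

lemma N_divisible: "divisible G N"
  unfolding divisible_def
proof (intro allI impI)
  fix k :: nat assume k: "0 < k"
  have "(\<lambda>x. x [^] k) ` N = N"
  proof (rule ccontr)
    assume "(\<lambda>x. x [^] k) ` N \<noteq> N"
    then obtain M where "subgroup M G" "M \<subseteq> N" "M \<noteq> N" "fin_index G M N"
      using abelian_proper_fin_index[OF N_subgroup N_abelian k] by metis
    then show False using N_no_fin_index by blast
  qed
  then show "\<forall>d\<in>N. \<exists>e\<in>N. e [^] k = d" by (metis imageE)
qed

text \<open>For \<open>j = m\<close> the middle factor is trivial if \<open>f\<close> has order \<open>m\<close>, so \<open>x \<mapsto> (xf)\<^sup>m\<close> is a homomorphism on \<open>N\<close>.\<close>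

lemma pow_coset_mult:
  assumes f: "f \<in> carrier G" and x: "x \<in> N" and y: "y \<in> N"
  shows "(x \<otimes> y \<otimes> f) [^] (j::nat) = (x \<otimes> f) [^] j \<otimes> inv (f [^] j) \<otimes> (y \<otimes> f) [^] j"
proof (induction j)
  case 0 then show ?case by simp
next
  case (Suc j)
  have G: "x \<in> carrier G" "y \<in> carrier G" using x y N_carrier by blast+
  define u where "u = inv (f [^] j) \<otimes> (y \<otimes> f) [^] j"
  obtain n where n: "n \<in> N" "(y \<otimes> f) [^] j = n \<otimes> f [^] j"
    using pow_mult_normal[OF N_subgroup f y] normal.inv_op_closed2[OF N_normal f] by blast
  have "inv (f [^] j) \<otimes> n \<otimes> f [^] j \<in> N"
    using normal.inv_op_closed1[OF N_normal _ n(1)] f by simp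
  then have uN: "u \<in> N" unfolding u_def n(2) using f N_carrier[OF n(1)] by (simp add: m_assoc)
  have uG: "u \<in> carrier G" using uN N_carrier by blast
  have "(x \<otimes> y \<otimes> f) [^] Suc j = (x \<otimes> f) [^] j \<otimes> (u \<otimes> x) \<otimes> (y \<otimes> f)"
    using Suc G f unfolding u_def by (simp add: m_assoc)
  also have "u \<otimes> x = x \<otimes> u" by (rule N_abelian[OF uN x])
  also have "(x \<otimes> f) [^] j \<otimes> (x \<otimes> u) \<otimes> (y \<otimes> f) =
      (x \<otimes> f) [^] j \<otimes> (x \<otimes> f) \<otimes> (inv f \<otimes> inv (f [^] j)) \<otimes> ((y \<otimes> f) [^] j \<otimes> (y \<otimes> f))"
    using G f unfolding u_def by (simp add: m_assoc)
  also have "inv f \<otimes> inv (f [^] j) = inv (f [^] Suc j)" using f by (simp add: inv_mult_group)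
  finally show ?case by simp
qed

text \<open>The kernel \<open>L\<close> of \<open>x \<mapsto> (xf)\<^sup>m\<close> is invariant under \<open>f\<close>, and \<open>L\<langle>f\<rangle>\<close> contains the elements of order \<open>m\<close> in \<open>Nf\<close>, which generate \<open>G\<close>. So \<open>L\<close>
has finite index and contains \<open>N\<close>.\<close>

lemma coset_element_order:
  assumes f: "f \<in> order_m" and gen: "generate G {y \<in> order_m. y \<otimes> inv f \<in> N} = carrier G" and x: "x \<in> N"
  shows "(x \<otimes> f) [^] m = \<one>"
proof -
  have fG: "f \<in> carrier G" and fm: "f [^] m = \<one>" using f pow_ord_eq_1 by auto
  define L where "L = {x \<in> N. (x \<otimes> f) [^] m = \<one>}"
  have mult: "(x \<otimes> y \<otimes> f) [^] m = (x \<otimes> f) [^] m \<otimes> (y \<otimes> f) [^] m" if "x \<in> N" "y \<in> N" for x y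
    using pow_coset_mult[OF fG that, of m] that N_carrier fG fm by simp
  have LG: "subgroup L G"
  proof (rule subgroupI)
    show "L \<subseteq> carrier G" unfolding L_def using N_carrier by blast
    have "\<one> \<in> L" unfolding L_def using fG fm subgroup.one_closed[OF N_subgroup] by simp
    then show "L \<noteq> {}" by blast
  next
    fix a assume "a \<in> L"
    then have a: "a \<in> N" "(a \<otimes> f) [^] m = \<one>" "a \<in> carrier G" unfolding L_def using N_carrier by blast+
    have ai: "inv a \<in> N" using subgroup.m_inv_closed[OF N_subgroup a(1)] .
    have "(a \<otimes> inv a \<otimes> f) [^] m = (a \<otimes> f) [^] m \<otimes> (inv a \<otimes> f) [^] m" by (rule mult[OF a(1) ai])
    then have "(inv a \<otimes> f) [^] m = \<one>" using a fG fm by simp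
    then show "inv a \<in> L" unfolding L_def using ai by blast
  next
    fix a b assume "a \<in> L" "b \<in> L"
    then have ab: "a \<in> N" "b \<in> N" "(a \<otimes> f) [^] m = \<one>" "(b \<otimes> f) [^] m = \<one>" unfolding L_def by blast+
    then show "a \<otimes> b \<in> L" unfolding L_def using mult[OF ab(1,2)] subgroup.m_closed[OF N_subgroup] by simp
  qed
  have "f \<otimes> l \<otimes> inv f \<in> L" if l: "l \<in> L" for l
  proof -
    have lN: "l \<in> N" "(l \<otimes> f) [^] m = \<one>" "l \<in> carrier G" using l N_carrier unfolding L_def by blast+
    have "f \<otimes> l \<otimes> inv f \<otimes> f = f \<otimes> (l \<otimes> f) \<otimes> inv f" using fG lN by (simp add: m_assoc)
    then have "(f \<otimes> l \<otimes> inv f \<otimes> f) [^] m = \<one>" using conj_pow[OF fG, of "l \<otimes> f" m] lN fG by simp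
    then show ?thesis unfolding L_def using normal.inv_op_closed2[OF N_normal fG lN(1)] by blast
  qed
  then have LF: "subgroup (L <#> generate G {f}) G" "fin_index G L (L <#> generate G {f})"
    using cyclic_extension[OF LG fG] by blast+
  have "{y \<in> order_m. y \<otimes> inv f \<in> N} \<subseteq> L <#> generate G {f}"
  proof
    fix y assume "y \<in> {y \<in> order_m. y \<otimes> inv f \<in> N}"
    then have y: "y \<in> carrier G" "ord y = m" "y \<otimes> inv f \<in> N" by auto
    have yf: "y \<otimes> inv f \<otimes> f = y" using y(1) fG by (simp add: m_assoc)
    have "y [^] m = \<one>" using pow_ord_eq_1[OF y(1)] y(2) by simp
    then have "y \<otimes> inv f \<in> L" unfolding L_def using y(3) yf by simp
    then have "y \<otimes> inv f \<otimes> f \<in> L <#> generate G {f}" by (rule set_multI) (simp add: generate.incl)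
    then show "y \<in> L <#> generate G {f}" unfolding yf .
  qed
  from generate_subgroup_incl[OF this LF(1)] have "carrier G \<subseteq> L <#> generate G {f}" unfolding gen .
  then have "L <#> generate G {f} = carrier G" using subgroup.subset[OF LF(1)] by blast
  then have "N \<subseteq> L" using N_least[OF LG] LF(2) by simp
  then show ?thesis using x unfolding L_def by blast
qed

text \<open>The group \<open>W = H\<langle>f\<rangle>\<close> is proper, hence a CL-group. For \<open>h \<in> H\<close> both \<open>hf\<close> and \<open>f\<close> have order dividing \<open>m\<close>, so \<open>h\<close> lies in the
join of the finitely many layers of \<open>W\<close> of order at most \<open>m\<close>, each of which is Chernikov.\<close>

lemma proper_invariant_subgroup_bounded_primes:
  assumes f: "f \<in> order_m" and gen: "generate G {y \<in> order_m. y \<otimes> inv f \<in> N} = carrier G"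
    and H: "subgroup H G" "H \<subseteq> N" "H \<noteq> N" "\<And>h. h \<in> H \<Longrightarrow> f \<otimes> h \<otimes> inv f \<in> H"
  shows "bounded_primes G H"
proof -
  have fG: "f \<in> carrier G" using f by blast
  have F: "subgroup (generate G {f}) G" using fG by (intro generate_is_subgroup) simp
  define W where "W = H <#> generate G {f}"
  have W: "subgroup W G" "fin_index G H W" unfolding W_def using cyclic_extension[OF H(1) fG H(4)] by simp_all
  have "W \<noteq> carrier G"
  proof
    assume "W = carrier G"
    then have "N \<subseteq> H" using N_least[OF H(1)] W(2) by simp
    then show False using H(2,3) by blast
  qed
  then have WCL: "CL_in G W" by (rule proper_CL[OF W(1)])
  note WG = subgroup.mem_carrier[OF W(1)]
  have HW: "H \<subseteq> W" and FW: "generate G {f} \<subseteq> W"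
    unfolding W_def using subset_set_mult[OF H(1) F] by blast+
  have fW: "f \<in> W" using FW by (auto intro: generate.incl)
  define U where "U d = generate G {x \<in> W. ord x = d}" for d
  have one: "bounded_primes G {\<one>}" unfolding bounded_primes_def by (auto intro: exI[of _ 1])
  have U: "normal_in G V W \<and> bounded_primes G V" if mem: "V \<in> U ` {1..m}" for V
  proof -
    obtain d where d: "d \<in> {1..m}" "V = U d" using mem by blast
    have "chernikov_in G (U d)" using WCL d(1) unfolding CL_in_def U_def by auto
    then show ?thesis unfolding d(2) using chernikov_in_bounded_primes normal_in_layer[OF W(1)] unfolding U_def by blast
  qed
  obtain V where V: "normal_in G V W" "bounded_primes G V" "\<And>Q. Q \<in> U ` {1..m} \<Longrightarrow> Q \<subseteq> V"
    using normal_in_finite_join[OF W(1), of "bounded_primes G" "U ` {1..m}", OF one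
      bounded_primes_set_mult[OF W(1)] _ U] by blast
  have VG: "subgroup V G" using V(1) unfolding normal_in_def by blast
  have mem: "x \<in> V" if x: "x \<in> W" "x [^] m = \<one>" for x
  proof -
    have "ord x dvd m" using x WG pow_eq_id by blast
    then have "ord x \<le> m" using m_pos by (rule dvd_imp_le)
    moreover have "0 < ord x" using ord_pos WG x(1) by blast
    ultimately have "U (ord x) \<subseteq> V" using V(3) by auto
    moreover have "x \<in> U (ord x)" unfolding U_def using x(1) by (intro generate.incl) simp
    ultimately show ?thesis by blast
  qed
  have "f [^] m = \<one>" using f pow_ord_eq_1 by auto
  then have fV: "f \<in> V" by (rule mem[OF fW])
  have "H \<subseteq> V"
  proof
    fix h assume h: "h \<in> H"
    have hG: "h \<in> carrier G" using h HW WG by blast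
    have "(h \<otimes> f) [^] m = \<one>" using coset_element_order[OF f gen] h H(2) by blast
    moreover have "h \<otimes> f \<in> W" using h HW fW subgroup.m_closed[OF W(1)] by blast
    ultimately have "h \<otimes> f \<in> V" by (intro mem)
    then have "h \<otimes> f \<otimes> inv f \<in> V" using fV subgroup.m_closed[OF VG] subgroup.m_inv_closed[OF VG] by blast
    then show "h \<in> V" using hG fG by (simp add: m_assoc)
  qed
  then show ?thesis using V(2) unfolding bounded_primes_def by blast
qed

text \<open>If the prime \<open>p\<close> occurs in \<open>N\<close>, the subgroup \<open>H\<close> of elements of order prime to \<open>p\<close> is proper and invariant, so finitely many primes
occur in it; \<open>N\<close> adds only \<open>p\<close>.\<close>

lemma N_bounded_primes: "bounded_primes G N"
proof -
  obtain f where f: "f \<in> order_m" "generate G {y \<in> order_m. y \<otimes> inv f \<in> N} = carrier G"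
    using finite_quotient_cyclic[OF N_normal N_fin_index] by blast
  have fG: "f \<in> carrier G" using f(1) by blast
  show ?thesis
  proof (cases "N = {\<one>}")
    case True
    then show ?thesis unfolding bounded_primes_def by (auto intro: exI[of _ 1])
  next
    case False
    then obtain u where u: "u \<in> N" "u \<noteq> \<one>" using subgroup.one_closed[OF N_subgroup] by blast
    have uG: "u \<in> carrier G" using u N_carrier by blast
    have "ord u \<noteq> 1" using u uG ord_eq_1 by blast
    then obtain p where p: "Factorial_Ring.prime p" "p dvd ord u" using prime_factor_nat by blast
    have p0: "0 < p" using p(1) by (rule prime_gt_0_nat)
    \<comment> \<open>The \<open>p'\<close>-part of \<open>N\<close>, in a form in which closure under products is immediate.\<close>
    define H where "H = {x \<in> N. \<exists>r. \<not> p dvd r \<and> x [^] (r::nat) = \<one>}"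
    have H: "subgroup H G"
    proof (rule subgroupI)
      show "H \<subseteq> carrier G" unfolding H_def using N_carrier by blast
      have "\<not> p dvd 1" using p(1) by (simp add: not_prime_unit prime_nat_iff)
      then have "\<one> \<in> H" unfolding H_def using subgroup.one_closed[OF N_subgroup] by (auto intro!: exI[of _ 1])
      then show "H \<noteq> {}" by blast
    next
      fix a assume "a \<in> H"
      then obtain r where r: "a \<in> N" "\<not> p dvd r" "a [^] (r::nat) = \<one>" unfolding H_def by blast
      then have "(inv a) [^] r = \<one>" using N_carrier by (simp add: nat_pow_inv)
      then show "inv a \<in> H" unfolding H_def using r subgroup.m_inv_closed[OF N_subgroup] by blast
    next
      fix a b assume "a \<in> H" "b \<in> H"
      then obtain r s where r: "a \<in> N" "\<not> p dvd r" "a [^] (r::nat) = \<one>" and s: "b \<in> N" "\<not> p dvd s" "b [^] (s::nat) = \<one>"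
        unfolding H_def by blast
      have G: "a \<in> carrier G" "b \<in> carrier G" using r s N_carrier by blast+
      have "ord a dvd r * s" "ord b dvd r * s" using r(3) s(3) G by (auto simp: pow_eq_id)
      then have "a [^] (r * s) = \<one>" "b [^] (r * s) = \<one>" using G by (auto simp: pow_eq_id)
      then have "(a \<otimes> b) [^] (r * s) = \<one>"
        using pow_mult_distrib[OF N_abelian[OF r(1) s(1)] G] by simp
      moreover have "\<not> p dvd r * s" using r(2) s(2) p(1) by (simp add: prime_dvd_mult_iff)
      ultimately show "a \<otimes> b \<in> H" unfolding H_def using subgroup.m_closed[OF N_subgroup r(1) s(1)] by blast
    qed
    have HN: "H \<subseteq> N" unfolding H_def by blast
    have "u \<notin> H"
    proof
      assume "u \<in> H"
      then obtain r :: nat where "\<not> p dvd r" "u [^] r = \<one>" unfolding H_def by blast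
      then show False using p(2) pow_eq_id[OF uG] dvd_trans by blast
    qed
    then have ne: "H \<noteq> N" using u(1) by blast
    have "f \<otimes> h \<otimes> inv f \<in> H" if h: "h \<in> H" for h
    proof -
      obtain r where r: "h \<in> N" "\<not> p dvd r" "h [^] (r::nat) = \<one>" using h unfolding H_def by blast
      have "(f \<otimes> h \<otimes> inv f) [^] r = \<one>" unfolding conj_pow[OF fG N_carrier[OF r(1)]] r(3) using fG by simp
      then show ?thesis unfolding H_def using r(2) normal.inv_op_closed2[OF N_normal fG r(1)] by blast
    qed
    then have Hbp: "bounded_primes G H"
      by (rule proper_invariant_subgroup_bounded_primes[OF f H HN ne])
    show ?thesis
    proof (rule bounded_primes_extension[OF p0 subgroup.subset[OF H] Hbp subgroup.subset[OF N_subgroup]])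
      fix x assume x: "x \<in> N"
      have xG: "x \<in> carrier G" using x N_carrier by blast
      have "\<not> is_unit p" using p(1) not_prime_unit by blast
      moreover have "ord x \<noteq> 0" using ord_pos[OF xG] by simp
      ultimately obtain r where r: "ord x = p ^ multiplicity p (ord x) * r" "\<not> p dvd r"
        using multiplicity_decompose'[of "ord x" p] by metis
      have "(x [^] (p ^ multiplicity p (ord x))) [^] r = \<one>"
        using xG r(1) by (simp add: nat_pow_pow pow_eq_id)
      then have "x [^] (p ^ multiplicity p (ord x)) \<in> H"
        unfolding H_def using r(2) subgroup_pow_closed[OF N_subgroup x] by blast
      then show "\<exists>j. x [^] (p ^ j) \<in> H" by blast
    qed
  qed
qed

lemma inconsistent: False
proof -
  have "divisible_artinian G N"
    unfolding divisible_artinian_def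
    using N_subgroup N_abelian N_divisible N_bounded_primes
      CL_in_abelian_finite_torsion[OF N_subgroup N_CL N_subgroup subset_refl N_abelian] by blast
  then have "chernikov_in G (carrier G)"
    unfolding chernikov_in_def using subgroup_self N_fin_index subgroup.subset[OF N_subgroup] by blast
  then show False using not_chernikov by blast
qed

end

context loc_fin_MNCL begin

theorem no_proper_fin_index:
  assumes "subgroup K G" "fin_index G K (carrier G)"
  shows "K = carrier G"
proof -
  obtain N where N: "N \<lhd> G" "fin_index G N (carrier G)"
    "\<And>K. subgroup K G \<Longrightarrow> fin_index G K (carrier G) \<Longrightarrow> N \<subseteq> K"
    using least_fin_index_subgroup by blast
  have "N = carrier G"
  proof (rule ccontr)
    assume "N \<noteq> carrier G"
    then interpret loc_fin_MNCL_residual G m N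
      using N by (intro loc_fin_MNCL_residual.intro loc_fin_MNCL_residual_axioms.intro loc_fin_MNCL_axioms) auto
    show False by (rule inconsistent)
  qed
  then show ?thesis using N(3)[OF assms] subgroup.subset[OF assms(1)] by blast
qed

section \<open>Perfectness\<close>

text \<open>The quotient \<open>G/G'\<close> is abelian and generated by elements whose order divides \<open>m\<close>. If it were nontrivial, the \<open>m\<close>-th power map
on it would not be surjective, and the preimage of a proper subgroup of finite index would contradict \<open>no_proper_fin_index\<close>.\<close>

theorem derived_eq_carrier: "derived G (carrier G) = carrier G"
proof (rule ccontr)
  assume ne: "derived G (carrier G) \<noteq> carrier G"
  define K where "K = derived G (carrier G)"
  have KN: "K \<lhd> G" unfolding K_def by (rule derived_self_is_normal)
  have KG: "subgroup K G" using KN normal_imp_subgroup by blast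
  interpret Q: comm_group "G Mod K" unfolding K_def by (rule derived_quot_is_comm_group)
  have \<pi>: "group_hom G (G Mod K) (\<lambda>x. K #> x)"
    using normal.r_coset_hom_Mod[OF KN] is_group Q.is_group by (simp add: group_hom_def group_hom_axioms_def)
  interpret \<pi>: group_hom G "G Mod K" "\<lambda>x. K #> x" by (rule \<pi>)
  have carQ: "carrier (G Mod K) = (\<lambda>x. K #> x) ` carrier G" by (rule carrier_FactGroup)
  have exp: "c [^]\<^bsub>G Mod K\<^esub> m = \<one>\<^bsub>G Mod K\<^esub>" if c: "c \<in> carrier (G Mod K)" for c
  proof -
    let ?C = "{c \<in> carrier (G Mod K). c [^]\<^bsub>G Mod K\<^esub> m = \<one>\<^bsub>G Mod K\<^esub>}"
    let ?B = "{x \<in> carrier G. K #> x \<in> ?C}"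
    have "subgroup ?C (G Mod K)"
    proof (rule Q.subgroupI)
      show "?C \<noteq> {}" using Q.one_closed Q.nat_pow_one by blast
    qed (auto simp: Q.nat_pow_inv Q.nat_pow_distrib simp del: mult_FactGroup one_FactGroup)
    then have "subgroup ?B G" by (rule \<pi>.subgroup_preimage)
    moreover have "order_m \<subseteq> ?B"
    proof
      fix y assume y: "y \<in> order_m"
      then have "y [^] m = \<one>" using pow_ord_eq_1 by auto
      then have "K #> (y [^] m) = \<one>\<^bsub>G Mod K\<^esub>" by (simp only: \<pi>.hom_one)
      moreover have "K #> (y [^] m) = (K #> y) [^]\<^bsub>G Mod K\<^esub> m" using y by (intro \<pi>.hom_nat_pow) simp
      ultimately show "y \<in> ?B" using y \<pi>.hom_closed[of y] by simp
    qed
    ultimately have "carrier G \<subseteq> ?B" using generate_subgroup_incl[of order_m ?B] unfolding layer_generates by blast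
    then show ?thesis using c unfolding carQ by blast
  qed
  have "carrier (G Mod K) \<noteq> {\<one>\<^bsub>G Mod K\<^esub>}"
  proof
    assume triv: "carrier (G Mod K) = {\<one>\<^bsub>G Mod K\<^esub>}"
    have "x \<in> K" if x: "x \<in> carrier G" for x
    proof -
      have "K #> x = \<one>\<^bsub>G Mod K\<^esub>" using triv x unfolding carQ by blast
      then have "K #> x = K" by (simp add: FactGroup_def)
      then show ?thesis using rcos_self[OF x KG] by simp
    qed
    then show False using ne subgroup.subset[OF KG] unfolding K_def by blast
  qed
  moreover have "(\<lambda>c. c [^]\<^bsub>G Mod K\<^esub> m) ` carrier (G Mod K) = {\<one>\<^bsub>G Mod K\<^esub>}"
    using exp Q.one_closed by auto
  ultimately obtain M where M: "subgroup M (G Mod K)" "M \<noteq> carrier (G Mod K)" "fin_index (G Mod K) M (carrier (G Mod K))"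
    using Q.abelian_proper_fin_index[OF Q.subgroup_self Q.m_comm m_pos] by metis
  define P where "P = {x \<in> carrier G. K #> x \<in> M}"
  have PG: "subgroup P G" unfolding P_def by (rule \<pi>.subgroup_preimage[OF M(1)])
  obtain \<phi> :: "'a set \<Rightarrow> 'a set" where \<phi>: "finite (\<phi> ` carrier (G Mod K))"
    "\<And>x y. x \<in> carrier (G Mod K) \<Longrightarrow> y \<in> carrier (G Mod K) \<Longrightarrow> \<phi> x = \<phi> y \<Longrightarrow> x \<otimes>\<^bsub>G Mod K\<^esub> inv\<^bsub>G Mod K\<^esub> y \<in> M"
    using Q.fin_index_map[OF M(1) subset_refl M(3)] by blast
  have "fin_index G P (carrier G)"
  proof (rule fin_indexI[of "\<lambda>x. \<phi> (K #> x)"])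
    show "finite ((\<lambda>x. \<phi> (K #> x)) ` carrier G)" using \<phi>(1) unfolding carQ image_image .
    fix x y assume xy: "x \<in> carrier G" "y \<in> carrier G" "\<phi> (K #> x) = \<phi> (K #> y)"
    have "(K #> x) \<otimes>\<^bsub>G Mod K\<^esub> inv\<^bsub>G Mod K\<^esub> (K #> y) \<in> M"
      using \<phi>(2)[OF _ _ xy(3)] xy(1,2) unfolding carQ by blast
    then have "K #> (x \<otimes> inv y) \<in> M"
      unfolding \<pi>.hom_mult[OF xy(1) inv_closed[OF xy(2)]] \<pi>.hom_inv[OF xy(2)] .
    then show "x \<otimes> inv y \<in> P" unfolding P_def using xy(1,2) by simp
  qed
  then have "P = carrier G" by (rule no_proper_fin_index[OF PG])
  then have "carrier (G Mod K) \<subseteq> M" unfolding carQ P_def by blast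
  then show False using M(2) subgroup.subset[OF M(1)] by blast
qed

section \<open>Countability\<close>

text \<open>Assume that \<open>G\<close> is uncountable. Countable sets \<open>Z\<close> of elements of order \<open>m\<close> generate countable, hence proper, hence Chernikov subgroups; let
\<open>D Z\<close> be the divisible part. It grows with \<open>Z\<close>. The number of its elements of prime order is bounded, since countably many sets \<open>Z\<close> with
unbounded numbers would have a union with infinitely many such elements. For \<open>Z0\<close> attaining the maximum, \<open>D Z = D Z0\<close> for all \<open>Z \<supseteq> Z0\<close>.
Infinitely many cosets of \<open>D Z0\<close> in \<open>G\<close> would be visible in a single such \<open>Z\<close>; so \<open>D Z0\<close> has finite index and \<open>G\<close> is Chernikov.\<close>

theorem countable_carrier: "countable (carrier G)"
proof (rule ccontr)
  assume unc: "\<not> countable (carrier G)"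
  define \<F> where "\<F> = {Z. Z \<subseteq> order_m \<and> countable Z}"
  have ZG: "Z \<subseteq> carrier G" if "Z \<in> \<F>" for Z using that unfolding \<F>_def by blast
  have genG: "subgroup (generate G Z) G" if "Z \<in> \<F>" for Z by (rule generate_is_subgroup[OF ZG[OF that]])
  have "\<exists>D\<subseteq>generate G Z. divisible_artinian G D \<and> fin_index G D (generate G Z)" if Z: "Z \<in> \<F>" for Z
  proof -
    have "countable (generate G Z)" using Z loc_fin by (intro countable_generate) (auto simp: \<F>_def)
    then have "generate G Z \<noteq> carrier G" using unc by metis
    then have "chernikov_in G (generate G Z)" using Z chernikov_in_generate unfolding \<F>_def by blast
    then show ?thesis unfolding chernikov_in_def by blast
  qed
  then obtain D where D: "\<And>Z. Z \<in> \<F> \<Longrightarrow> D Z \<subseteq> generate G Z \<and> divisible_artinian G (D Z) \<and> fin_index G (D Z) (generate G Z)"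
    by metis
  have DG: "subgroup (D Z) G" and Ddiv: "divisible G (D Z)"
    and Dcomm: "\<And>x y. x \<in> D Z \<Longrightarrow> y \<in> D Z \<Longrightarrow> x \<otimes> y = y \<otimes> x" if "Z \<in> \<F>" for Z
    using D[OF that] unfolding divisible_artinian_def by blast+
  have Dmono: "D Z \<subseteq> D Z'" if Z: "Z \<in> \<F>" "Z' \<in> \<F>" "Z \<subseteq> Z'" for Z Z'
  proof -
    have "D Z \<subseteq> generate G Z'" using D[OF Z(1)] mono_generate[OF Z(3)] by blast
    then have "fin_index G (D Z') (D Z)"
      using fin_index_mono[OF DG[OF Z(2)] subgroup.subset[OF genG[OF Z(2)]]] D[OF Z(2)] by blast
    then show ?thesis by (rule divisible_subset_fin_index[OF DG[OF Z(2)] DG[OF Z(1)] _ Ddiv[OF Z(1)]])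
  qed
  define soc where "soc Z = {x \<in> D Z. Factorial_Ring.prime (ord x)}" for Z
  have soc_fin: "finite (soc Z)" if "Z \<in> \<F>" for Z
    unfolding soc_def using D[OF that] by (intro divisible_artinian_finite_socle) blast
  have soc_mono: "soc Z \<subseteq> soc Z'" if "Z \<in> \<F>" "Z' \<in> \<F>" "Z \<subseteq> Z'" for Z Z'
    unfolding soc_def using Dmono[OF that] by blast
  have "\<exists>b. \<forall>Z. Z \<in> \<F> \<longrightarrow> card (soc Z) < b"
  proof (rule ccontr)
    assume "\<not> ?thesis"
    then have "\<forall>b. \<exists>Z. Z \<in> \<F> \<and> b \<le> card (soc Z)" by (meson not_le)
    then obtain Z where Z: "\<And>b. Z b \<in> \<F> \<and> b \<le> card (soc (Z b))" by metis
    \<comment> \<open>Joining sets with more and more elements of prime order.\<close>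
    define U where "U = (\<Union>b. Z b)"
    have U: "U \<in> \<F>" using Z unfolding \<F>_def U_def by auto
    have "b \<le> card (soc U)" for b
    proof -
      have "soc (Z b) \<subseteq> soc U" using Z[of b] U by (intro soc_mono) (auto simp: U_def)
      then have "card (soc (Z b)) \<le> card (soc U)" by (rule card_mono[OF soc_fin[OF U]])
      moreover have "b \<le> card (soc (Z b))" using Z by blast
      ultimately show ?thesis by (rule le_trans[rotated])
    qed
    from this[of "Suc (card (soc U))"] show False by simp
  qed
  then obtain b where b: "\<forall>Z. Z \<in> \<F> \<longrightarrow> card (soc Z) < b" by blast
  have "{} \<in> \<F>" unfolding \<F>_def by simp
  then have "\<exists>Z. Z \<in> \<F> \<and> (\<forall>Z'. Z' \<in> \<F> \<longrightarrow> card (soc Z') \<le> card (soc Z))"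
    using b by (rule ex_has_greatest_nat)
  then obtain Z0 where Z0: "Z0 \<in> \<F>" and max: "\<And>Z. Z \<in> \<F> \<Longrightarrow> card (soc Z) \<le> card (soc Z0)" by blast
  have Dmax: "D Z \<subseteq> D Z0" if Z: "Z \<in> \<F>" "Z0 \<subseteq> Z" for Z
  proof -
    have "soc Z0 = soc Z"
      by (rule card_seteq[OF soc_fin[OF Z(1)] soc_mono[OF Z0 Z] max[OF Z(1)]])
    then have soc: "x \<in> D Z0" if "x \<in> D Z" "Factorial_Ring.prime (ord x)" for x
      using that unfolding soc_def by blast
    have tors: "0 < ord x" if "x \<in> D Z" for x
      using ord_pos subgroup.mem_carrier[OF DG[OF Z(1)] that] by blast
    show ?thesis
      by (rule torsion_subset_divisible[OF DG[OF Z0] Dmono[OF Z0 Z] Ddiv[OF Z0] DG[OF Z(1)] Dcomm[OF Z(1)] tors soc])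
  qed
  have "\<not> fin_index G (D Z0) (carrier G)"
  proof
    assume "fin_index G (D Z0) (carrier G)"
    then have "chernikov_in G (carrier G)"
      unfolding chernikov_in_def using subgroup_self D[OF Z0] subgroup.subset[OF DG[OF Z0]] by blast
    then show False using not_chernikov by blast
  qed
  moreover have sep: "x \<otimes> inv y \<in> D Z0" if xy: "x \<in> carrier G" "y \<in> carrier G" "D Z0 #> x = D Z0 #> y" for x y
    using subgroup.rcos_module_imp[OF DG[OF Z0] is_group xy(2)] rcos_self[OF xy(1) DG[OF Z0]] xy(3) by simp
  ultimately have "infinite ((\<lambda>x. D Z0 #> x) ` carrier G)"
    using fin_indexI[of "\<lambda>x. D Z0 #> x" "carrier G" G "D Z0"] by blast
  then obtain g :: "nat \<Rightarrow> 'a set" where g: "inj g" "range g \<subseteq> (\<lambda>x. D Z0 #> x) ` carrier G"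
    using infinite_countable_subset by blast
  then have "\<forall>i. \<exists>x. x \<in> carrier G \<and> g i = D Z0 #> x" by blast
  then obtain x where x: "\<And>i. x i \<in> carrier G \<and> g i = D Z0 #> x i" by metis
  have "\<exists>F. finite F \<and> F \<subseteq> order_m \<and> x i \<in> generate G F" for i
  proof -
    have xi: "x i \<in> generate G order_m" unfolding layer_generates using x by blast
    have "order_m \<subseteq> carrier G" by blast
    from this xi obtain F where "finite F" "F \<subseteq> order_m" "x i \<in> generate G F" by (rule generate_finite_support)
    then show ?thesis by blast
  qed
  then obtain F where F: "\<And>i. finite (F i) \<and> F i \<subseteq> order_m \<and> x i \<in> generate G (F i)" by metis
  define Z where "Z = Z0 \<union> (\<Union>i. F i)"
  have Z: "Z \<in> \<F>" "Z0 \<subseteq> Z"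
    using Z0 F unfolding \<F>_def Z_def by (auto intro: countable_finite)
  have xZ: "x i \<in> generate G Z" for i
    using F[of i] mono_generate[of "F i" Z] unfolding Z_def by blast
  obtain \<phi> :: "'a \<Rightarrow> 'a" where \<phi>: "finite (\<phi> ` generate G Z)"
    "\<And>x y. x \<in> generate G Z \<Longrightarrow> y \<in> generate G Z \<Longrightarrow> \<phi> x = \<phi> y \<Longrightarrow> x \<otimes> inv y \<in> D Z"
    using fin_index_map[OF DG[OF Z(1)] subgroup.subset[OF genG[OF Z(1)]]] D[OF Z(1)] by blast
  have "inj (\<lambda>i. \<phi> (x i))"
  proof (rule injI)
    fix i j assume "\<phi> (x i) = \<phi> (x j)"
    then have "x i \<otimes> inv (x j) \<in> D Z0" using \<phi>(2)[OF xZ xZ] Dmax[OF Z] by blast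
    then have "x i \<in> D Z0 #> x j"
      using subgroup.rcos_module_rev[OF DG[OF Z0] is_group, of "x j" "x i"] x by blast
    then have "D Z0 #> x j = D Z0 #> x i" by (rule repr_independence[OF _ _ DG[OF Z0]]) (use x in blast)
    then have "g i = g j" using x by simp
    then show "i = j" using g(1) by (simp add: inj_eq)
  qed
  then have "infinite (range (\<lambda>i. \<phi> (x i)))" by (rule range_inj_infinite)
  moreover have "range (\<lambda>i. \<phi> (x i)) \<subseteq> \<phi> ` generate G Z" using xZ by blast
  ultimately show False using \<phi>(1) finite_subset by blast
qed

theorem finite_residual_eq_carrier: "finite_residual G = carrier G"
proof
  have "carrier G \<lhd> G" by (rule normal_invI[OF subgroup_self]) (simp only: m_closed inv_closed)
  moreover have "finite (carrier (G Mod carrier G))"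
    using fin_index_iff_rcosets[OF subgroup_self] fin_index_self[OF subgroup_self] by (simp add: FactGroup_def)
  ultimately show "finite_residual G \<subseteq> carrier G" unfolding finite_residual_def by blast
  have "K = carrier G" if K: "K \<lhd> G" "finite (carrier (G Mod K))" for K
  proof -
    have KG: "subgroup K G" using K(1) normal_imp_subgroup by blast
    have "finite (rcosets K)" using K(2) by (simp add: FactGroup_def)
    then show ?thesis using no_proper_fin_index[OF KG] fin_index_iff_rcosets[OF KG] by blast
  qed
  then show "carrier G \<subseteq> finite_residual G" unfolding finite_residual_def by blast
qed

end

section \<open>Locally graded MNCL-groups\<close>

theorem theorem3p5:
  fixes G :: "('a, 'b) monoid_scheme"
  assumes "locally_graded G"
    and "MNCL_group G"
  shows "locally_finite G \<and> countable (carrier G) \<and>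
    carrier G = finite_residual G \<and> finite_residual G = derived G (carrier G) \<and>
    perfect_group G"
proof -
  interpret group G using assms(2) unfolding MNCL_group_def by blast
  have CL: "CL_in G H" if "subgroup H G" "H \<noteq> carrier G" for H
    using assms(2) that CL_group_iff unfolding MNCL_group_def by blast
  have notCL: "\<not> CL_in G (carrier G)"
    using assms(2) CL_group_iff[OF subgroup_self] unfolding MNCL_group_def by simp
  have lf: "loc_fin G (carrier G)" by (rule locally_graded_proper_CL_loc_fin[OF assms(1) CL])
  obtain m where "loc_fin_MNCL G m" using loc_fin_MNCL_exists[OF lf notCL CL] by blast
  then interpret loc_fin_MNCL G m .
  have "locally_finite G"
    using lf is_group unfolding locally_finite_def loc_fin_def by blast
  then show ?thesis
    using countable_carrier finite_residual_eq_carrier derived_eq_carrier is_group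
    unfolding perfect_group_def by simp
qed

end
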